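(* Let $p$ be an odd prime. The line subbundle $\mathcal{L}\to\mathfrak{D}$ of the trivial bundle $W\times\mathfrak{D}\to\mathfrak{D}$ is invariant with respect to the KZ connection. In other words, if $s(z)$ is any section of $\mathcal{L}\to\mathfrak{D}$, then $\nabla_i^{\mathrm{KZ}}s(z)$, $i=1,2,3$, are also sections of $\mathcal{L}\to\mathfrak{D}$ (where $\nabla_i^{\mathrm{KZ}}$ is defined, i.e. at points with pairwise distinct coordinates $z_1,z_2,z_3$).
   Context: Let $z=(z_1,z_2,z_3)$. For $s\ge1$ let $T_s(z)$ be the coefficient of $t^{p^s-1}$ in $\big((t-z_1)(t-z_2)(t-z_3)\big)^{(p^s-1)/2}$, so $$T_s(z)=(-1)^{(p^s-1)/2}\sum_{k_1+k_2+k_3=(p^s-1)/2}\binom{(p^s-1)/2}{k_1}\binom{(p^s-1)/2}{k_2}\binom{(p^s-1)/2}{k_3}z_1^{k_1}z_2^{k_2}z_3^{k_3}.$$ Let $\mathfrak{D}=\{z\in\mathbb{Z}_p^3 : |T_1(z)|_p=1\}$. For $i=1,2,3$ the rational functions $\eta_s^{(i)}(z)=\frac{\partial T_s}{\partial z_i}(z)/T_s(z)$ are regular on $\mathfrak{D}$ and converge uniformly on $\mathfrak{D}$, as $s\to\infty$, to analytic functions $\eta^{(i)}(z)$. Put $\vec\eta=(\eta^{(1)},\eta^{(2)},\eta^{(3)})$ (a column vector); it satisfies $\eta^{(1)}+\eta^{(2)}+\eta^{(3)}=0$ and is nonzero at every point of $\mathfrak{D}$. Let $W=\{(I_1,I_2,I_3)\in\mathbb{Q}_p^3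 : I_1+I_2+I_3=0\}$ (column vectors). For $a\in\mathfrak{D}$ let $\mathcal{L}_a\subset W$ be the line spanned by $\vec\eta(a)$, and let $\mathcal{L}=\bigcup_{a\in\mathfrak{D}}\mathcal{L}_a\to\mathfrak{D}$, an analytic line subbundle of $W\times\mathfrak{D}\to\mathfrak{D}$. KZ connection: $\nabla_i^{\mathrm{KZ}}=\frac{\partial}{\partial z_i}-H_i(z)$, $i=1,2,3$, where $H_i(z)=\frac12\sum_{j\ne i}\frac{\Omega_{ij}}{z_i-z_j}$, $\Omega_{ij}=\Omega_{ji}$, and $$\Omega_{12}=\begin{pmatrix}-1&1&0\\1&-1&0\\0&0&0\end{pmatrix},\quad \Omega_{13}=\begin{pmatrix}-1&0&1\\0&0&0\\1&0&-1\end{pmatrix},\quad \Omega_{23}=\begin{pmatrix}0&0&0\\0&-1&1\\0&1&-1\end{pmatrix}.$$ Sections are analytic functions $\mathfrak{D}\to W$ (possibly defined locally) with values $s(z)\in\mathcal{L}_z$. *)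

theory Defs
  imports
    "HOL-Analysis.Analysis"
    "HOL-Computational_Algebra.Polynomial"
    "Berlekamp_Zassenhaus.Finite_Field"
begin

section \<open>The $p$-adic absolute value on the rationals\<close>

text \<open>
  \<open>rat_padic_abs p (a / b) = p powi (v b - v a)\<close> with \<open>v\<close> the multiplicity of \<open>p\<close>,
  normalised by \<open>rat_padic_abs p p = 1 / p\<close>; see \<open>rat_padic_abs_frac\<close>.
\<close>

definition rat_padic_abs :: "nat \<Rightarrow> rat \<Rightarrow> real" where
  "rat_padic_abs p x = (if x = 0 then 0 else
     real p powi (int (multiplicity (int p) (snd (quotient_of x)))
                - int (multiplicity (int p) (fst (quotient_of x)))))"

lemma rat_padic_abs_0 [simp]: "rat_padic_abs p 0 = 0"
  by (simp add: rat_padic_abs_def)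

lemma rat_padic_abs_nonneg [simp]: "rat_padic_abs p x \<ge> 0"
  by (simp add: rat_padic_abs_def)

lemma rat_padic_abs_frac:
  assumes p: "prime p" and a: "a \<noteq> 0" and b: "b \<noteq> 0"
  shows "rat_padic_abs p (of_int a / of_int b) =
    real p powi (int (multiplicity (int p) b) - int (multiplicity (int p) a))"
proof -
  define x :: rat where "x = of_int a / of_int b"
  obtain n d where nd: "quotient_of x = (n, d)" by force
  have d: "d \<noteq> 0" using quotient_of_denom_pos[OF nd] by simp
  have x: "x = of_int n / of_int d" using quotient_of_div[OF nd] .
  have x0: "x \<noteq> 0" using a b by (simp add: x_def)
  hence n: "n \<noteq> 0" using x by auto
  have "(of_int (a * d) :: rat) = of_int (n * b)"
    using x b d by (simp add: x_def field_simps)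
  hence "a * d = n * b" by (simp only: of_int_eq_iff)
  hence "multiplicity (int p) (a * d) = multiplicity (int p) (n * b)" by simp
  moreover have "prime_elem (int p)" using p by auto
  ultimately have "multiplicity (int p) a + multiplicity (int p) d =
      multiplicity (int p) n + multiplicity (int p) b"
    using a b n d by (simp add: prime_elem_multiplicity_mult_distrib)
  hence "int (multiplicity (int p) d) - int (multiplicity (int p) n)
      = int (multiplicity (int p) b) - int (multiplicity (int p) a)" by linarith
  thus ?thesis using x0 nd by (simp add: rat_padic_abs_def x_def)
qed

lemma rat_frac_cases:
  fixes x :: rat
  obtains a b where "b \<noteq> 0" "x = of_int a / of_int b"
proof -
  obtain n d where nd: "quotient_of x = (n, d)" by force
  show ?thesis
    using that[of d n] quotient_of_denom_pos[OF nd] quotient_of_div[OF nd] by auto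
qed

context
  fixes p :: nat
  assumes p: "prime p"
begin

lemma rat_padic_abs_1 [simp]: "rat_padic_abs p 1 = 1"
  using rat_padic_abs_frac[OF p, of 1 1] by simp

lemma rat_padic_abs_eq_0_iff [simp]: "rat_padic_abs p x = 0 \<longleftrightarrow> x = 0"
  using prime_gt_0_nat[OF p] by (auto simp: rat_padic_abs_def)

lemma rat_padic_abs_mult: "rat_padic_abs p (x * y) = rat_padic_abs p x * rat_padic_abs p y"
proof (cases "x = 0 \<or> y = 0")
  case False
  obtain a b where b: "b \<noteq> 0" and x: "x = of_int a / of_int b" by (rule rat_frac_cases)
  obtain c d where d: "d \<noteq> 0" and y: "y = of_int c / of_int d" by (rule rat_frac_cases)
  have a: "a \<noteq> 0" and c: "c \<noteq> 0" using False x y by auto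
  have "prime_elem (int p)" using p by auto
  note m = prime_elem_multiplicity_mult_distrib[OF this]
  have xy: "x * y = of_int (a * c) / of_int (b * d)" by (simp add: x y)
  have "rat_padic_abs p (x * y) = real p powi
     (int (multiplicity (int p) (b * d)) - int (multiplicity (int p) (a * c)))"
    unfolding xy by (rule rat_padic_abs_frac) (use p a b c d in auto)
  also have "\<dots> = real p powi
     ((int (multiplicity (int p) b) - int (multiplicity (int p) a)) +
      (int (multiplicity (int p) d) - int (multiplicity (int p) c)))"
    using m[OF a c] m[OF b d] by (simp add: algebra_simps)
  also have "\<dots> = rat_padic_abs p x * rat_padic_abs p y"
    unfolding x y rat_padic_abs_frac[OF p a b] rat_padic_abs_frac[OF p c d]
    using prime_gt_0_nat[OF p] by (subst power_int_add) auto
  finally show ?thesis .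
qed auto

lemma rat_padic_abs_minus [simp]: "rat_padic_abs p (- x) = rat_padic_abs p x"
proof -
  have "rat_padic_abs p (-1) * rat_padic_abs p (-1) = 1"
    by (subst rat_padic_abs_mult[symmetric]) simp
  hence "(rat_padic_abs p (-1))\<^sup>2 = 1" by (simp add: power2_eq_square)
  hence "rat_padic_abs p (-1) = 1"
    using rat_padic_abs_nonneg[of p "-1"] unfolding power2_eq_1_iff by linarith
  thus ?thesis using rat_padic_abs_mult[of "-1" x] by simp
qed

lemma rat_padic_abs_inverse: "rat_padic_abs p (inverse x) = inverse (rat_padic_abs p x)"
proof (cases "x = 0")
  case False
  hence "rat_padic_abs p x * rat_padic_abs p (inverse x) = 1"
    by (simp add: rat_padic_abs_mult[symmetric])
  thus ?thesis by (metis inverse_unique)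
qed auto

lemma rat_padic_abs_ultra:
  "rat_padic_abs p (x + y) \<le> max (rat_padic_abs p x) (rat_padic_abs p y)"
proof (cases "x = 0 \<or> y = 0 \<or> x + y = 0")
  case True
  thus ?thesis by (auto simp: le_max_iff_disj)
next
  case False
  obtain a b where b: "b \<noteq> 0" and x: "x = of_int a / of_int b" by (rule rat_frac_cases)
  obtain c d where d: "d \<noteq> 0" and y: "y = of_int c / of_int d" by (rule rat_frac_cases)
  define A C where "A = a * d" and "C = c * b"
  have bd: "b * d \<noteq> 0" using b d by simp
  have x: "x = of_int A / of_int (b * d)" and y: "y = of_int C / of_int (b * d)"
    using b d by (simp_all add: x y A_def C_def)
  have xy: "x + y = of_int (A + C) / of_int (b * d)"
    unfolding x y by (simp add: add_divide_distrib)
  have A: "A \<noteq> 0" and C: "C \<noteq> 0" and AC: "A + C \<noteq> 0"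
    using False x y xy by auto
  have pu: "\<not> is_unit (int p)" using p by (metis not_prime_unit prime_nat_int_transfer)
  define k where "k = min (multiplicity (int p) A) (multiplicity (int p) C)"
  have "int p ^ k dvd A + C"
    by (rule dvd_add) (auto intro!: multiplicity_dvd' simp: k_def)
  hence "k \<le> multiplicity (int p) (A + C)"
    using AC pu by (intro multiplicity_geI)
  hence *: "real p powi (int (multiplicity (int p) (b * d)) - int (multiplicity (int p) (A + C)))
      \<le> real p powi (int (multiplicity (int p) (b * d)) - int k)"
    using prime_ge_1_nat[OF p] by (intro power_int_increasing) auto
  show ?thesis
    unfolding xy unfolding x y rat_padic_abs_frac[OF p A bd] rat_padic_abs_frac[OF p C bd]
      rat_padic_abs_frac[OF p AC bd]
    using * by (auto simp: k_def min_def le_max_iff_disj split: if_splits)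
qed

lemma rat_padic_abs_triangle:
  "rat_padic_abs p (x + y) \<le> rat_padic_abs p x + rat_padic_abs p y"
  using rat_padic_abs_ultra[of x y] rat_padic_abs_nonneg[of p x] rat_padic_abs_nonneg[of p y]
  by linarith

lemma rat_padic_abs_diff_commute: "rat_padic_abs p (x - y) = rat_padic_abs p (y - x)"
  using rat_padic_abs_minus[of "x - y"] by simp

lemma rat_padic_abs_diff:
  "\<bar>rat_padic_abs p x - rat_padic_abs p y\<bar> \<le> rat_padic_abs p (x - y)"
  using rat_padic_abs_triangle[of "x - y" y] rat_padic_abs_triangle[of "y - x" x]
    rat_padic_abs_diff_commute[of x y] by simp

end


section \<open>Cauchy sequences and null sequences\<close>

definition padic_vanishes :: "nat \<Rightarrow> (nat \<Rightarrow> rat) \<Rightarrow> bool" where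
  "padic_vanishes p X \<longleftrightarrow> (\<lambda>n. rat_padic_abs p (X n)) \<longlonglongrightarrow> 0"

definition padic_cauchy :: "nat \<Rightarrow> (nat \<Rightarrow> rat) \<Rightarrow> bool" where
  "padic_cauchy p X \<longleftrightarrow> (\<forall>e>0. \<exists>N. \<forall>m\<ge>N. \<forall>n\<ge>N. rat_padic_abs p (X m - X n) < e)"

definition padic_rel :: "nat \<Rightarrow> (nat \<Rightarrow> rat) \<Rightarrow> (nat \<Rightarrow> rat) \<Rightarrow> bool" where
  "padic_rel p X Y \<longleftrightarrow> padic_cauchy p X \<and> padic_cauchy p Y \<and> padic_vanishes p (\<lambda>n. X n - Y n)"

context
  fixes p :: nat
  assumes p: "prime p"
begin

lemma padic_cauchy_const [simp]: "padic_cauchy p (\<lambda>_. x)"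
  by (simp add: padic_cauchy_def)

lemma padic_vanishes_le:
  assumes "padic_vanishes p X" "eventually (\<lambda>n. rat_padic_abs p (Y n) \<le> C * rat_padic_abs p (X n)) sequentially"
  shows "padic_vanishes p Y"
  unfolding padic_vanishes_def
proof (rule tendsto_sandwich[where f = "\<lambda>_. 0" and h = "\<lambda>n. C * rat_padic_abs p (X n)"])
  show "(\<lambda>n. C * rat_padic_abs p (X n)) \<longlonglongrightarrow> 0"
    using tendsto_mult_left[OF assms(1)[unfolded padic_vanishes_def], of C] by simp
qed (use assms(2) in auto)

lemma padic_vanishes_minus: "padic_vanishes p X \<Longrightarrow> padic_vanishes p (\<lambda>n. - X n)"
  using p by (simp add: padic_vanishes_def)

lemma padic_vanishes_add:
  assumes "padic_vanishes p X" "padic_vanishes p Y"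
  shows "padic_vanishes p (\<lambda>n. X n + Y n)"
  unfolding padic_vanishes_def
proof (rule tendsto_sandwich[where f = "\<lambda>_. 0"
      and h = "\<lambda>n. rat_padic_abs p (X n) + rat_padic_abs p (Y n)"])
  show "(\<lambda>n. rat_padic_abs p (X n) + rat_padic_abs p (Y n)) \<longlonglongrightarrow> 0"
    using tendsto_add[OF assms[unfolded padic_vanishes_def]] by simp
qed (use rat_padic_abs_triangle[OF p] in auto)

lemma padic_cauchy_add:
  assumes "padic_cauchy p X" "padic_cauchy p Y"
  shows "padic_cauchy p (\<lambda>n. X n + Y n)"
  unfolding padic_cauchy_def
proof safe
  fix e :: real assume e: "e > 0"
  obtain M N where M: "\<forall>m\<ge>M. \<forall>n\<ge>M. rat_padic_abs p (X m - X n) < e"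
    and N: "\<forall>m\<ge>N. \<forall>n\<ge>N. rat_padic_abs p (Y m - Y n) < e"
    using assms e unfolding padic_cauchy_def by meson
  have "rat_padic_abs p ((X m + Y m) - (X n + Y n)) < e"
    if "m \<ge> max M N" "n \<ge> max M N" for m n
  proof -
    have "rat_padic_abs p ((X m - X n) + (Y m - Y n))
      \<le> max (rat_padic_abs p (X m - X n)) (rat_padic_abs p (Y m - Y n))"
      by (rule rat_padic_abs_ultra[OF p])
    thus ?thesis using M N that by (auto simp: algebra_simps le_max_iff_disj max_def split: if_splits intro: le_less_trans)
  qed
  thus "\<exists>N. \<forall>m\<ge>N. \<forall>n\<ge>N. rat_padic_abs p ((X m + Y m) - (X n + Y n)) < e" by blast
qed

lemma padic_cauchy_minus:
  assumes "padic_cauchy p X" shows "padic_cauchy p (\<lambda>n. - X n)"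
proof -
  have "rat_padic_abs p (- X m - - X n) = rat_padic_abs p (X m - X n)" for m n
    using rat_padic_abs_minus[OF p, of "X m - X n"] by simp
  thus ?thesis using assms unfolding padic_cauchy_def by presburger
qed

lemma padic_cauchy_abs_convergent:
  assumes "padic_cauchy p X" shows "convergent (\<lambda>n. rat_padic_abs p (X n))"
proof (rule Cauchy_convergent, rule metric_CauchyI)
  fix e :: real assume "e > 0"
  then obtain N where N: "\<forall>m\<ge>N. \<forall>n\<ge>N. rat_padic_abs p (X m - X n) < e"
    using assms unfolding padic_cauchy_def by meson
  thus "\<exists>M. \<forall>m\<ge>M. \<forall>n\<ge>M. dist (rat_padic_abs p (X m)) (rat_padic_abs p (X n)) < e"
    using rat_padic_abs_diff[OF p] by (metis dist_real_def le_less_trans)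
qed

lemma padic_cauchy_bounded:
  assumes "padic_cauchy p X" obtains B where "B > 0" "\<And>n. rat_padic_abs p (X n) \<le> B"
proof -
  have "Bseq (\<lambda>n. rat_padic_abs p (X n))"
    using padic_cauchy_abs_convergent[OF assms] by (rule convergent_imp_Bseq)
  then obtain K where "K > 0" "\<forall>n. norm (rat_padic_abs p (X n)) \<le> K" by (rule BseqE)
  thus ?thesis using that by simp
qed

lemma padic_cauchy_mult:
  assumes X: "padic_cauchy p X" and Y: "padic_cauchy p Y"
  shows "padic_cauchy p (\<lambda>n. X n * Y n)"
  unfolding padic_cauchy_def
proof safe
  fix e :: real assume e: "e > 0"
  obtain A where A: "A > 0" "\<And>n. rat_padic_abs p (X n) \<le> A" using padic_cauchy_bounded[OF X] by blast
  obtain B where B: "B > 0" "\<And>n. rat_padic_abs p (Y n) \<le> B" using padic_cauchy_bounded[OF Y] by blast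
  obtain M where M: "\<forall>m\<ge>M. \<forall>n\<ge>M. rat_padic_abs p (X m - X n) < e / B"
    using X e B unfolding padic_cauchy_def by (meson divide_pos_pos)
  obtain N where N: "\<forall>m\<ge>N. \<forall>n\<ge>N. rat_padic_abs p (Y m - Y n) < e / A"
    using Y e A unfolding padic_cauchy_def by (meson divide_pos_pos)
  have "rat_padic_abs p (X m * Y m - X n * Y n) < e"
    if mn: "m \<ge> max M N" "n \<ge> max M N" for m n
  proof -
    have 1: "rat_padic_abs p (X m * (Y m - Y n)) < e"
    proof -
      have "rat_padic_abs p (X m * (Y m - Y n)) \<le> A * rat_padic_abs p (Y m - Y n)"
        unfolding rat_padic_abs_mult[OF p] by (intro mult_right_mono A) simp
      also have "\<dots> < A * (e / A)" using A N mn by (intro mult_strict_left_mono) auto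
      finally show ?thesis using A by simp
    qed
    have 2: "rat_padic_abs p ((X m - X n) * Y n) < e"
    proof -
      have "rat_padic_abs p ((X m - X n) * Y n) \<le> rat_padic_abs p (X m - X n) * B"
        unfolding rat_padic_abs_mult[OF p] by (intro mult_left_mono B) simp
      also have "\<dots> < e / B * B" using B M mn by (intro mult_strict_right_mono) auto
      finally show ?thesis using B by simp
    qed
    have "X m * Y m - X n * Y n = X m * (Y m - Y n) + (X m - X n) * Y n"
      by (simp add: algebra_simps)
    thus ?thesis
      using rat_padic_abs_ultra[OF p, of "X m * (Y m - Y n)" "(X m - X n) * Y n"] 1 2 by simp
  qed
  thus "\<exists>N. \<forall>m\<ge>N. \<forall>n\<ge>N. rat_padic_abs p (X m * Y m - X n * Y n) < e" by blast
qed

lemma padic_cauchy_not_vanishes: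
  assumes X: "padic_cauchy p X" and nv: "\<not> padic_vanishes p X"
  obtains b where "b > 0" "eventually (\<lambda>n. rat_padic_abs p (X n) > b) sequentially"
proof -
  obtain L where L: "(\<lambda>n. rat_padic_abs p (X n)) \<longlonglongrightarrow> L"
    using padic_cauchy_abs_convergent[OF X] by (auto simp: convergent_def)
  have "L \<ge> 0" by (rule LIMSEQ_le_const[OF L]) auto
  moreover have "L \<noteq> 0" using L nv by (auto simp: padic_vanishes_def)
  ultimately have "L / 2 > 0" "L / 2 < L" by auto
  thus ?thesis using that[of "L / 2"] order_tendstoD(1)[OF L] by blast
qed

lemma rat_padic_abs_diff_inverse:
  assumes "b > 0" "rat_padic_abs p x > b" "rat_padic_abs p y > b"
  shows "rat_padic_abs p (inverse x - inverse y) \<le> inverse (b * b) * rat_padic_abs p (x - y)"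
proof -
  have nz: "x \<noteq> 0" "y \<noteq> 0" using assms by auto
  hence "inverse x - inverse y = inverse (x * y) * (y - x)"
    by (simp add: field_simps)
  hence "rat_padic_abs p (inverse x - inverse y)
      = inverse (rat_padic_abs p x * rat_padic_abs p y) * rat_padic_abs p (x - y)"
    by (simp add: rat_padic_abs_mult[OF p] rat_padic_abs_inverse[OF p]
        rat_padic_abs_diff_commute[OF p, of y x])
  also have "\<dots> \<le> inverse (b * b) * rat_padic_abs p (x - y)"
    using assms by (intro mult_right_mono le_imp_inverse_le mult_mono) auto
  finally show ?thesis .
qed

lemma padic_cauchy_inverse:
  assumes X: "padic_cauchy p X" and nv: "\<not> padic_vanishes p X"
  shows "padic_cauchy p (\<lambda>n. inverse (X n))"
  unfolding padic_cauchy_def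
proof safe
  fix e :: real assume e: "e > 0"
  obtain b where b: "b > 0" and ev: "eventually (\<lambda>n. rat_padic_abs p (X n) > b) sequentially"
    using padic_cauchy_not_vanishes[OF assms] by blast
  obtain M where M: "\<And>n. n \<ge> M \<Longrightarrow> rat_padic_abs p (X n) > b"
    using ev unfolding eventually_sequentially by blast
  obtain N where N: "\<forall>m\<ge>N. \<forall>n\<ge>N. rat_padic_abs p (X m - X n) < e * (b * b)"
    using X e b unfolding padic_cauchy_def by (meson mult_pos_pos)
  have "rat_padic_abs p (inverse (X m) - inverse (X n)) < e"
    if mn: "m \<ge> max M N" "n \<ge> max M N" for m n
  proof -
    have "rat_padic_abs p (inverse (X m) - inverse (X n))
        \<le> inverse (b * b) * rat_padic_abs p (X m - X n)"
      using M mn b by (intro rat_padic_abs_diff_inverse) auto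
    also have "\<dots> < inverse (b * b) * (e * (b * b))"
      using N mn b by (intro mult_strict_left_mono) auto
    also have "\<dots> = e" using b by (simp add: field_simps)
    finally show ?thesis .
  qed
  thus "\<exists>N. \<forall>m\<ge>N. \<forall>n\<ge>N. rat_padic_abs p (inverse (X m) - inverse (X n)) < e" by blast
qed

lemma padic_rel_refl: "padic_cauchy p X \<Longrightarrow> padic_rel p X X"
  by (simp add: padic_rel_def padic_vanishes_def)

lemma padic_rel_sym: "padic_rel p X Y \<Longrightarrow> padic_rel p Y X"
  by (simp add: padic_rel_def padic_vanishes_def rat_padic_abs_diff_commute[OF p])

lemma padic_rel_trans: "padic_rel p X Y \<Longrightarrow> padic_rel p Y Z \<Longrightarrow> padic_rel p X Z"
  unfolding padic_rel_def
  using padic_vanishes_add[of "\<lambda>n. X n - Y n" "\<lambda>n. Y n - Z n"] by simp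

lemma part_equivp_padic_rel: "part_equivp (padic_rel p)"
  by (rule part_equivpI)
    (auto simp: symp_def transp_def intro: padic_rel_sym padic_rel_trans
       intro!: exI[of _ "\<lambda>_. 0"] padic_rel_refl)

lemma padic_rel_add:
  assumes "padic_rel p X X'" "padic_rel p Y Y'"
  shows "padic_rel p (\<lambda>n. X n + Y n) (\<lambda>n. X' n + Y' n)"
proof -
  have "padic_vanishes p (\<lambda>n. (X n - X' n) + (Y n - Y' n))"
    using assms unfolding padic_rel_def by (intro padic_vanishes_add) auto
  thus ?thesis using assms unfolding padic_rel_def
    by (auto intro!: padic_cauchy_add simp: add_diff_add)
qed

lemma padic_rel_minus:
  assumes "padic_rel p X X'" shows "padic_rel p (\<lambda>n. - X n) (\<lambda>n. - X' n)"
proof -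
  have "padic_vanishes p (\<lambda>n. - (X n - X' n))"
    using assms unfolding padic_rel_def by (intro padic_vanishes_minus) auto
  thus ?thesis using assms unfolding padic_rel_def
    by (auto intro!: padic_cauchy_minus)
qed

lemma padic_rel_mult:
  assumes X: "padic_rel p X X'" and Y: "padic_rel p Y Y'"
  shows "padic_rel p (\<lambda>n. X n * Y n) (\<lambda>n. X' n * Y' n)"
proof -
  obtain A where A: "A > 0" "\<And>n. rat_padic_abs p (X n) \<le> A"
    using padic_cauchy_bounded X unfolding padic_rel_def by metis
  obtain B where B: "B > 0" "\<And>n. rat_padic_abs p (Y' n) \<le> B"
    using padic_cauchy_bounded Y unfolding padic_rel_def by metis
  have "padic_vanishes p (\<lambda>n. X n * (Y n - Y' n))"
    using Y unfolding padic_rel_def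
    by (auto intro!: padic_vanishes_le[of "\<lambda>n. Y n - Y' n" _ A] always_eventually mult_right_mono A
          simp: rat_padic_abs_mult[OF p])
  moreover have "padic_vanishes p (\<lambda>n. (X n - X' n) * Y' n)"
    using X unfolding padic_rel_def
    by (auto intro!: padic_vanishes_le[of "\<lambda>n. X n - X' n" _ B] always_eventually mult_left_mono B
          simp: rat_padic_abs_mult[OF p] mult.commute[of B])
  ultimately have "padic_vanishes p (\<lambda>n. X n * (Y n - Y' n) + (X n - X' n) * Y' n)"
    by (rule padic_vanishes_add)
  hence "padic_vanishes p (\<lambda>n. X n * Y n - X' n * Y' n)"
    by (simp add: algebra_simps)
  thus ?thesis using X Y unfolding padic_rel_def by (auto intro!: padic_cauchy_mult)
qed

lemma padic_rel_vanishes: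
  assumes "padic_rel p X X'" shows "padic_vanishes p X \<longleftrightarrow> padic_vanishes p X'"
  using assms padic_vanishes_add[of "\<lambda>n. X n - X' n" X'] padic_vanishes_add[of "\<lambda>n. X' n - X n" X]
    padic_rel_sym[OF assms]
  unfolding padic_rel_def by auto

lemma padic_rel_inverse:
  assumes X: "padic_rel p X X'"
  shows "padic_rel p (if padic_vanishes p X then (\<lambda>n. 0) else (\<lambda>n. inverse (X n)))
                     (if padic_vanishes p X' then (\<lambda>n. 0) else (\<lambda>n. inverse (X' n)))"
proof (cases "padic_vanishes p X")
  case True
  thus ?thesis using padic_rel_vanishes[OF X] by (auto intro: padic_rel_refl)
next
  case False
  hence nv': "\<not> padic_vanishes p X'" using padic_rel_vanishes[OF X] by simp
  have c: "padic_cauchy p X" "padic_cauchy p X'" using X by (auto simp: padic_rel_def)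
  obtain a where a: "a > 0" "eventually (\<lambda>n. rat_padic_abs p (X n) > a) sequentially"
    using padic_cauchy_not_vanishes[OF c(1) False] by blast
  obtain b where b: "b > 0" "eventually (\<lambda>n. rat_padic_abs p (X' n) > b) sequentially"
    using padic_cauchy_not_vanishes[OF c(2) nv'] by blast
  define d where "d = min a b"
  have "d > 0" using a b by (simp add: d_def)
  have "eventually (\<lambda>n. rat_padic_abs p (inverse (X n) - inverse (X' n))
      \<le> inverse (d * d) * rat_padic_abs p (X n - X' n)) sequentially"
    using a(2) b(2)
  proof eventually_elim
    case (elim n)
    thus ?case using \<open>d > 0\<close> by (intro rat_padic_abs_diff_inverse) (auto simp: d_def)
  qed
  hence "padic_vanishes p (\<lambda>n. inverse (X n) - inverse (X' n))"
    using X unfolding padic_rel_def by (blast intro: padic_vanishes_le)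
  thus ?thesis using False nv' c by (auto simp: padic_rel_def intro: padic_cauchy_inverse)
qed

lemma padic_rel_lim:
  assumes X: "padic_rel p X X'"
  shows "lim (\<lambda>n. rat_padic_abs p (X n)) = lim (\<lambda>n. rat_padic_abs p (X' n))"
proof -
  have c: "padic_cauchy p X" "padic_cauchy p X'" using X by (auto simp: padic_rel_def)
  have L: "(\<lambda>n. rat_padic_abs p (X n)) \<longlonglongrightarrow> lim (\<lambda>n. rat_padic_abs p (X n))"
    using padic_cauchy_abs_convergent[OF c(1)] by (simp add: convergent_LIMSEQ_iff)
  have "(\<lambda>n. rat_padic_abs p (X' n) - rat_padic_abs p (X n)) \<longlonglongrightarrow> 0"
  proof (rule Lim_null_comparison)
    show "eventually (\<lambda>n. norm (rat_padic_abs p (X' n) - rat_padic_abs p (X n))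
        \<le> rat_padic_abs p (X' n - X n)) sequentially"
      using rat_padic_abs_diff[OF p] by simp
    show "(\<lambda>n. rat_padic_abs p (X' n - X n)) \<longlonglongrightarrow> 0"
      using padic_rel_sym[OF X] by (simp add: padic_rel_def padic_vanishes_def)
  qed
  from tendsto_add[OF L this] have "(\<lambda>n. rat_padic_abs p (X' n)) \<longlonglongrightarrow> lim (\<lambda>n. rat_padic_abs p (X n))"
    by simp
  thus ?thesis by (simp add: limI)
qed

end


section \<open>The field of $p$-adic numbers\<close>

text \<open>
  The prime \<open>p\<close> enters as the cardinality of the type parameter, so that \<open>'p padic\<close> is
  the field \<open>Q_p\<close> for \<open>p = CARD('p)\<close>: the completion of the rationals with respect to
  the \<open>p\<close>-adic absolute value. A \<open>p\<close>-adic number is a class of \<open>p\<close>-adic Cauchy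
  sequences of rationals modulo null sequences.
\<close>

typedef ('p::prime_card) padic =
  "{C :: (nat \<Rightarrow> rat) set. \<exists>X. padic_rel CARD('p) X X \<and> C = Collect (padic_rel CARD('p) X)}"
  morphisms padic_class Padic_class
  by (auto intro!: exI[of _ "\<lambda>_. 0"] padic_rel_refl padic_cauchy_const prime_card)

definition abs_padic :: "(nat \<Rightarrow> rat) \<Rightarrow> 'p::prime_card padic" where
  "abs_padic X = Padic_class (Collect (padic_rel CARD('p) X))"

definition rep_padic :: "'p::prime_card padic \<Rightarrow> nat \<Rightarrow> rat" where
  "rep_padic x = (SOME X. X \<in> padic_class x)"

definition cr_padic :: "(nat \<Rightarrow> rat) \<Rightarrow> 'p::prime_card padic \<Rightarrow> bool" where
  "cr_padic X x \<longleftrightarrow> padic_rel CARD('p) X X \<and> abs_padic X = x"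

lemma Quotient_padic:
  "Quotient (padic_rel CARD('p)) abs_padic rep_padic
     (cr_padic :: (nat \<Rightarrow> rat) \<Rightarrow> 'p::prime_card padic \<Rightarrow> bool)"
proof -
  note sym = padic_rel_sym[OF prime_card[where 'a='p]]
    and trans = padic_rel_trans[OF prime_card[where 'a='p]]
  have Coll: "Collect (padic_rel CARD('p) X) = Collect (padic_rel CARD('p) Y) \<longleftrightarrow> padic_rel CARD('p) X Y"
    if Y: "padic_rel CARD('p) Y Y" for X Y
  proof
    assume "Collect (padic_rel CARD('p) X) = Collect (padic_rel CARD('p) Y)"
    moreover have "Y \<in> Collect (padic_rel CARD('p) Y)" using Y by simp
    ultimately have "Y \<in> Collect (padic_rel CARD('p) X)" by (simp only:)
    thus "padic_rel CARD('p) X Y" by simp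
  next
    assume XY: "padic_rel CARD('p) X Y"
    show "Collect (padic_rel CARD('p) X) = Collect (padic_rel CARD('p) Y)"
    proof (rule Collect_cong)
      show "padic_rel CARD('p) X Z \<longleftrightarrow> padic_rel CARD('p) Y Z" for Z
      proof
        show "padic_rel CARD('p) Y Z" if "padic_rel CARD('p) X Z"
          by (rule trans[OF sym[OF XY] that])
        show "padic_rel CARD('p) X Z" if "padic_rel CARD('p) Y Z"
          by (rule trans[OF XY that])
      qed
    qed
  qed
  have class_abs: "padic_class (abs_padic X :: 'p padic) = Collect (padic_rel CARD('p) X)"
    if "padic_rel CARD('p) X X" for X
    unfolding abs_padic_def
    by (rule Padic_class_inverse, rule CollectI, rule exI[of _ X], rule conjI[OF that refl])
  have rep: "padic_rel CARD('p) (rep_padic x) (rep_padic x) \<and> abs_padic (rep_padic x) = x"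
    for x :: "'p padic"
  proof -
    obtain X where X: "padic_rel CARD('p) X X" "padic_class x = Collect (padic_rel CARD('p) X)"
      using padic_class[of x] by blast
    have "X \<in> padic_class x" using X(1) by (simp add: X(2))
    hence "rep_padic x \<in> padic_class x"
      unfolding rep_padic_def by (rule someI[where P = "\<lambda>X. X \<in> padic_class x"])
    hence r: "padic_rel CARD('p) X (rep_padic x)" by (simp add: X(2))
    have rr: "padic_rel CARD('p) (rep_padic x) (rep_padic x)" by (rule trans[OF sym[OF r] r])
    have "padic_class (abs_padic (rep_padic x) :: 'p padic) = padic_class x"
      unfolding class_abs[OF rr] X(2) Coll[OF X(1)] by (rule sym[OF r])
    hence "abs_padic (rep_padic x) = x" unfolding padic_class_inject .
    with rr show ?thesis ..
  qed
  have eq: "(abs_padic X :: 'p padic) = abs_padic Y \<longleftrightarrow> padic_rel CARD('p) X Y"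
    if "padic_rel CARD('p) X X" "padic_rel CARD('p) Y Y" for X Y
  proof -
    have "(abs_padic X :: 'p padic) = abs_padic Y \<longleftrightarrow>
        padic_class (abs_padic X :: 'p padic) = padic_class (abs_padic Y :: 'p padic)"
      by (rule padic_class_inject[symmetric])
    thus ?thesis unfolding class_abs[OF that(1)] class_abs[OF that(2)] Coll[OF that(2)] .
  qed
  show ?thesis
  proof (rule QuotientI)
    show "padic_rel CARD('p) r s \<longleftrightarrow> padic_rel CARD('p) r r \<and> padic_rel CARD('p) s s
        \<and> (abs_padic r :: 'p padic) = abs_padic s" for r s
    proof
      assume rs: "padic_rel CARD('p) r s"
      have "padic_rel CARD('p) r r" "padic_rel CARD('p) s s"
        by (rule trans[OF rs sym[OF rs]], rule trans[OF sym[OF rs] rs])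
      thus "padic_rel CARD('p) r r \<and> padic_rel CARD('p) s s
          \<and> (abs_padic r :: 'p padic) = abs_padic s"
        using eq[of r s] rs by simp
    qed (use eq[of r s] in simp)
    show "(cr_padic :: _ \<Rightarrow> 'p padic \<Rightarrow> bool) = (\<lambda>x y. padic_rel CARD('p) x x \<and> abs_padic x = y)"
      by (intro ext) (rule cr_padic_def)
    show "abs_padic (rep_padic x) = x" for x :: "'p padic" by (rule conjunct2[OF rep])
    show "padic_rel CARD('p) (rep_padic x) (rep_padic x)" for x :: "'p padic" by (rule conjunct1[OF rep])
  qed
qed

setup_lifting Quotient_padic

instantiation padic :: (prime_card) field
begin

lift_definition zero_padic :: "'a padic" is "\<lambda>n. 0"
  by (simp add: padic_rel_refl prime_card)

lift_definition one_padic :: "'a padic" is "\<lambda>n. 1"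
  by (simp add: padic_rel_refl prime_card)

lift_definition plus_padic :: "'a padic \<Rightarrow> 'a padic \<Rightarrow> 'a padic" is "\<lambda>X Y n. X n + Y n"
  by (rule padic_rel_add[OF prime_card])

lift_definition uminus_padic :: "'a padic \<Rightarrow> 'a padic" is "\<lambda>X n. - X n"
  by (rule padic_rel_minus[OF prime_card])

lift_definition times_padic :: "'a padic \<Rightarrow> 'a padic \<Rightarrow> 'a padic" is "\<lambda>X Y n. X n * Y n"
  by (rule padic_rel_mult[OF prime_card])

lift_definition inverse_padic :: "'a padic \<Rightarrow> 'a padic" is
  "\<lambda>X. if padic_vanishes CARD('a) X then (\<lambda>n. 0) else (\<lambda>n. inverse (X n))"
  by (rule padic_rel_inverse[OF prime_card])

definition minus_padic :: "'a padic \<Rightarrow> 'a padic \<Rightarrow> 'a padic" where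
  "x - y = x + - (y :: 'a padic)"

definition divide_padic :: "'a padic \<Rightarrow> 'a padic \<Rightarrow> 'a padic" where
  "x div y = x * inverse (y :: 'a padic)"

instance
proof
  fix a b c :: "'a padic"
  note [simp] = padic_rel_def padic_vanishes_def
  show "a * b * c = a * (b * c)"
    by transfer (auto simp: mult.assoc intro!: padic_cauchy_mult prime_card)
  show "a * b = b * a"
    by transfer (auto simp: mult.commute intro!: padic_cauchy_mult prime_card)
  show "1 * a = a" by transfer auto
  show "a + b + c = a + (b + c)"
    by transfer (auto simp: add.assoc intro!: padic_cauchy_add prime_card)
  show "a + b = b + a"
    by transfer (auto simp: add.commute intro!: padic_cauchy_add prime_card)
  show "0 + a = a" by transfer auto
  show "- a + a = 0" by transfer (auto simp: prime_card)
  show "a - b = a + - b" by (rule minus_padic_def)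
  show "(a + b) * c = a * c + b * c"
    by transfer (auto simp: algebra_simps intro!: padic_cauchy_mult padic_cauchy_add prime_card)
  show "(0 :: 'a padic) \<noteq> 1"
    by transfer (auto simp: prime_card rat_padic_abs_minus tendsto_const_iff)
  show "inverse (0 :: 'a padic) = 0"
    by transfer (auto simp: prime_card)
  show "a div b = a * inverse b" by (rule divide_padic_def)
  show "a \<noteq> 0 \<Longrightarrow> inverse a * a = 1"
  proof transfer
    fix X :: "nat \<Rightarrow> rat"
    assume "padic_rel CARD('a) X X" "\<not> padic_rel CARD('a) X (\<lambda>n. 0)"
    hence X: "padic_cauchy CARD('a) X" and nv: "\<not> padic_vanishes CARD('a) X"
      by (auto simp: prime_card)
    obtain b where b: "b > 0" "eventually (\<lambda>n. rat_padic_abs CARD('a) (X n) > b) sequentially"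
      using padic_cauchy_not_vanishes[OF prime_card X nv] by blast
    have "eventually (\<lambda>n. rat_padic_abs CARD('a) (inverse (X n) * X n - 1) = 0) sequentially"
      using b(2)
    proof eventually_elim
      case (elim n)
      hence "X n \<noteq> 0" using b(1) by auto
      thus ?case by simp
    qed
    hence "padic_vanishes CARD('a) (\<lambda>n. inverse (X n) * X n - 1)"
      unfolding padic_vanishes_def by (rule tendsto_eventually)
    moreover have "padic_cauchy CARD('a) (\<lambda>n. inverse (X n) * X n)"
      by (intro padic_cauchy_mult padic_cauchy_inverse prime_card X nv)
    ultimately have "padic_rel CARD('a) (\<lambda>n. inverse (X n) * X n) (\<lambda>n. 1)"
      by (simp add: prime_card)
    thus "padic_rel CARD('a)
        (\<lambda>n. (if padic_vanishes CARD('a) X then (\<lambda>n. 0) else (\<lambda>n. inverse (X n))) n * X n) (\<lambda>n. 1)"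
      using nv by simp
  qed
qed

end

lift_definition padic_abs :: "'p::prime_card padic \<Rightarrow> real"
  is "\<lambda>X. lim (\<lambda>n. rat_padic_abs CARD('p) (X n))"
  by (rule padic_rel_lim[OF prime_card])

lemma padic_abs_tendsto:
  fixes x :: "'p::prime_card padic"
  obtains X where "padic_cauchy CARD('p) X" "x = abs_padic X"
    "(\<lambda>n. rat_padic_abs CARD('p) (X n)) \<longlonglongrightarrow> padic_abs x"
proof -
  define X where "X = rep_padic x"
  have r: "padic_rel CARD('p) X X"
    unfolding X_def by (rule Quotient_rep_reflp[OF Quotient_padic])
  hence X: "padic_cauchy CARD('p) X" by (simp add: padic_rel_def)
  have x: "x = abs_padic X"
    unfolding X_def by (simp add: Quotient_abs_rep[OF Quotient_padic])
  have "padic_abs x = lim (\<lambda>n. rat_padic_abs CARD('p) (X n))"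
    unfolding x by (rule padic_abs.abs_eq[OF r])
  moreover have "(\<lambda>n. rat_padic_abs CARD('p) (X n)) \<longlonglongrightarrow> lim (\<lambda>n. rat_padic_abs CARD('p) (X n))"
    using padic_cauchy_abs_convergent[OF prime_card X] unfolding convergent_LIMSEQ_iff .
  ultimately have "(\<lambda>n. rat_padic_abs CARD('p) (X n)) \<longlonglongrightarrow> padic_abs x" by (simp only:)
  with that[OF X x] show ?thesis .
qed

lemma padic_abs_abs_padic:
  assumes "padic_cauchy CARD('p::prime_card) X"
  shows "(\<lambda>n. rat_padic_abs CARD('p) (X n)) \<longlonglongrightarrow> padic_abs (abs_padic X :: 'p padic)"
  using padic_cauchy_abs_convergent[OF prime_card assms]
  unfolding convergent_LIMSEQ_iff padic_abs.abs_eq[OF padic_rel_refl[OF prime_card assms]] .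

lemma padic_abs_nonneg: "padic_abs (x :: 'p::prime_card padic) \<ge> 0"
proof -
  obtain X where "(\<lambda>n. rat_padic_abs CARD('p) (X n)) \<longlonglongrightarrow> padic_abs x"
    by (rule padic_abs_tendsto[of x])
  thus ?thesis by (rule LIMSEQ_le_const) auto
qed

lemma padic_abs_eq_0_iff [simp]: "padic_abs (x :: 'p::prime_card padic) = 0 \<longleftrightarrow> x = 0"
proof -
  obtain X where X: "padic_cauchy CARD('p) X" "x = abs_padic X"
    and L: "(\<lambda>n. rat_padic_abs CARD('p) (X n)) \<longlonglongrightarrow> padic_abs x"
    by (rule padic_abs_tendsto[of x])
  have "x = 0 \<longleftrightarrow> padic_rel CARD('p) X (\<lambda>n. 0)"
    unfolding X(2) zero_padic_def
    using Quotient_rel[OF Quotient_padic[where 'p='p], of X "\<lambda>n. 0"] X(1)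
    by (auto simp: padic_rel_refl[OF prime_card] padic_cauchy_const[OF prime_card])
  also have "\<dots> \<longleftrightarrow> padic_vanishes CARD('p) X"
    using X(1) by (simp add: padic_rel_def padic_cauchy_const[OF prime_card])
  also have "\<dots> \<longleftrightarrow> padic_abs x = 0"
    unfolding padic_vanishes_def using L LIMSEQ_unique by auto
  finally show ?thesis by simp
qed

lemma padic_abs_mult: "padic_abs (x * y :: 'p::prime_card padic) = padic_abs x * padic_abs y"
proof -
  obtain X where X: "padic_cauchy CARD('p) X" "x = abs_padic X"
    and LX: "(\<lambda>n. rat_padic_abs CARD('p) (X n)) \<longlonglongrightarrow> padic_abs x"
    by (rule padic_abs_tendsto[of x])
  obtain Y where Y: "padic_cauchy CARD('p) Y" "y = abs_padic Y"
    and LY: "(\<lambda>n. rat_padic_abs CARD('p) (Y n)) \<longlonglongrightarrow> padic_abs y"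
    by (rule padic_abs_tendsto[of y])
  have "x * y = abs_padic (\<lambda>n. X n * Y n)"
    using X Y by (simp add: times_padic.abs_eq padic_rel_refl[OF prime_card])
  hence "(\<lambda>n. rat_padic_abs CARD('p) (X n * Y n)) \<longlonglongrightarrow> padic_abs (x * y)"
    using padic_abs_abs_padic[OF padic_cauchy_mult[OF prime_card X(1) Y(1)]] by simp
  moreover have "(\<lambda>n. rat_padic_abs CARD('p) (X n * Y n)) \<longlonglongrightarrow> padic_abs x * padic_abs y"
    using tendsto_mult[OF LX LY] by (simp add: rat_padic_abs_mult[OF prime_card])
  ultimately show ?thesis by (rule LIMSEQ_unique)
qed

lemma padic_abs_ultra: "padic_abs (x + y :: 'p::prime_card padic) \<le> max (padic_abs x) (padic_abs y)"
proof -
  obtain X where X: "padic_cauchy CARD('p) X" "x = abs_padic X"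
    and LX: "(\<lambda>n. rat_padic_abs CARD('p) (X n)) \<longlonglongrightarrow> padic_abs x"
    by (rule padic_abs_tendsto[of x])
  obtain Y where Y: "padic_cauchy CARD('p) Y" "y = abs_padic Y"
    and LY: "(\<lambda>n. rat_padic_abs CARD('p) (Y n)) \<longlonglongrightarrow> padic_abs y"
    by (rule padic_abs_tendsto[of y])
  have "x + y = abs_padic (\<lambda>n. X n + Y n)"
    using X Y by (simp add: plus_padic.abs_eq padic_rel_refl[OF prime_card])
  hence "(\<lambda>n. rat_padic_abs CARD('p) (X n + Y n)) \<longlonglongrightarrow> padic_abs (x + y)"
    using padic_abs_abs_padic[OF padic_cauchy_add[OF prime_card X(1) Y(1)]] by simp
  thus ?thesis
    by (rule LIMSEQ_le[OF _ tendsto_max[OF LX LY]]) (auto intro: rat_padic_abs_ultra[OF prime_card])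
qed

lemma padic_abs_1 [simp]: "padic_abs (1 :: 'p::prime_card padic) = 1"
proof -
  have "padic_abs (1 :: 'p padic) * padic_abs (1 :: 'p padic) = padic_abs (1 :: 'p padic) * 1"
    by (subst padic_abs_mult[symmetric]) simp
  thus ?thesis by (subst (asm) mult_left_cancel) auto
qed

lemma padic_abs_minus [simp]: "padic_abs (- x :: 'p::prime_card padic) = padic_abs x"
proof -
  have "padic_abs (-1 :: 'p padic) * padic_abs (-1 :: 'p padic) = 1"
    by (subst padic_abs_mult[symmetric]) simp
  hence "(padic_abs (-1 :: 'p padic))\<^sup>2 = 1" by (simp add: power2_eq_square)
  hence "padic_abs (-1 :: 'p padic) = 1"
    using padic_abs_nonneg[of "-1 :: 'p padic"] unfolding power2_eq_1_iff by linarith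
  thus ?thesis using padic_abs_mult[of "-1" x] by simp
qed

lemma padic_abs_triangle: "padic_abs (x + y :: 'p::prime_card padic) \<le> padic_abs x + padic_abs y"
  using padic_abs_ultra[of x y] padic_abs_nonneg[of x] padic_abs_nonneg[of y] by linarith

instantiation padic :: (prime_card) metric_space
begin

definition dist_padic :: "'a padic \<Rightarrow> 'a padic \<Rightarrow> real" where
  "dist_padic x y = padic_abs (x - y)"

definition uniformity_padic :: "('a padic \<times> 'a padic) filter" where
  "uniformity_padic = (INF e\<in>{0<..}. principal {(x, y). dist x y < e})"

definition open_padic :: "'a padic set \<Rightarrow> bool" where
  "open_padic U \<longleftrightarrow> (\<forall>x\<in>U. eventually (\<lambda>(x', y). x' = x \<longrightarrow> y \<in> U) uniformity)"

instance
proof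
  fix x y z :: "'a padic" and U :: "'a padic set"
  show "uniformity = (INF e\<in>{0<..}. principal {(x :: 'a padic, y). dist x y < e})"
    by (rule uniformity_padic_def)
  show "open U \<longleftrightarrow> (\<forall>x\<in>U. \<forall>\<^sub>F (x', y) in uniformity. x' = x \<longrightarrow> y \<in> U)"
    by (rule open_padic_def)
  show "dist x y = 0 \<longleftrightarrow> x = y"
    by (simp add: dist_padic_def)
  have "padic_abs (z - y) = padic_abs (y - z)" using padic_abs_minus[of "y - z"] by simp
  thus "dist x y \<le> dist x z + dist y z"
    using padic_abs_triangle[of "x - z" "z - y"] by (simp add: dist_padic_def)
qed

end

text \<open>
  \<open>'p padic\<close> is a complete field of characteristic zero in which the rationals are dense,
  and its absolute value extends the \<open>p\<close>-adic one.
\<close>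

lemma abs_padic_const_add: "(abs_padic (\<lambda>_. a + b) :: 'p::prime_card padic) = abs_padic (\<lambda>_. a) + abs_padic (\<lambda>_. b)"
  by (simp add: plus_padic.abs_eq padic_rel_refl[OF prime_card] padic_cauchy_const[OF prime_card])

lemma abs_padic_const_mult: "(abs_padic (\<lambda>_. a * b) :: 'p::prime_card padic) = abs_padic (\<lambda>_. a) * abs_padic (\<lambda>_. b)"
  by (simp add: times_padic.abs_eq padic_rel_refl[OF prime_card] padic_cauchy_const[OF prime_card])

lemma abs_padic_const_minus: "(abs_padic (\<lambda>_. - a) :: 'p::prime_card padic) = - abs_padic (\<lambda>_. a)"
  by (simp add: uminus_padic.abs_eq padic_rel_refl[OF prime_card] padic_cauchy_const[OF prime_card])

lemma padic_abs_const: "padic_abs (abs_padic (\<lambda>_. q) :: 'p::prime_card padic) = rat_padic_abs CARD('p) q"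
proof -
  have "(\<lambda>_. rat_padic_abs CARD('p) q) \<longlonglongrightarrow> padic_abs (abs_padic (\<lambda>_. q) :: 'p padic)"
    by (intro padic_abs_abs_padic padic_cauchy_const prime_card)
  thus ?thesis by (simp add: LIMSEQ_const_iff)
qed

lemma abs_padic_of_nat: "(abs_padic (\<lambda>_. of_nat n) :: 'p::prime_card padic) = of_nat n"
  by (induction n) (simp_all add: abs_padic_const_add zero_padic_def one_padic_def)

instance padic :: (prime_card) field_char_0
proof
  have *: "m = n" if "(of_nat m :: 'a padic) = of_nat n" "m \<le> n" for m n
  proof -
    have "(of_nat (n - m) :: 'a padic) = 0" using that by (simp add: of_nat_diff)
    hence "padic_abs (abs_padic (\<lambda>_. of_nat (n - m)) :: 'a padic) = 0"
      unfolding abs_padic_of_nat by simp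
    hence "(of_nat (n - m) :: rat) = 0"
      unfolding padic_abs_const rat_padic_abs_eq_0_iff[OF prime_card] .
    hence "n - m = 0" by (simp only: of_nat_eq_0_iff)
    thus ?thesis using that by simp
  qed
  show "inj (of_nat :: nat \<Rightarrow> 'a padic)"
  proof (rule injI)
    fix m n assume "(of_nat m :: 'a padic) = of_nat n"
    thus "m = n" using *[of m n] *[of n m] by (cases "m \<le> n") auto
  qed
qed

lemma abs_padic_of_rat: "(abs_padic (\<lambda>_. q) :: 'p::prime_card padic) = of_rat q"
proof -
  let ?c = "\<lambda>q. abs_padic (\<lambda>_. q) :: 'p padic"
  have int: "?c (of_int a) = of_int a" for a
    by (cases a rule: int_cases2)
      (simp_all add: abs_padic_of_nat abs_padic_const_minus del: of_nat_Suc)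
  obtain a b where b: "b \<noteq> 0" and q: "q = of_int a / of_int b" by (rule rat_frac_cases)
  have "?c q * of_int b = of_int a"
    unfolding int[symmetric] abs_padic_const_mult[symmetric] using b by (simp add: q)
  thus ?thesis using b by (simp add: q of_rat_divide field_simps)
qed

lemma padic_abs_of_rat: "padic_abs (of_rat q :: 'p::prime_card padic) = rat_padic_abs CARD('p) q"
  unfolding abs_padic_of_rat[symmetric] by (rule padic_abs_const)

lemma padic_abs_diff_of_rat_le:
  assumes X: "padic_cauchy CARD('p::prime_card) X"
    and e: "\<And>n. n \<ge> N \<Longrightarrow> rat_padic_abs CARD('p) (X n - q) \<le> e"
  shows "padic_abs (abs_padic X - of_rat q :: 'p padic) \<le> e"
proof -
  have c: "padic_cauchy CARD('p) (\<lambda>n. X n + - q)"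
    by (intro padic_cauchy_add X padic_cauchy_const prime_card)
  have "(abs_padic X - of_rat q :: 'p padic) = abs_padic X + of_rat (- q)"
    by (simp add: of_rat_minus)
  also have "\<dots> = abs_padic (\<lambda>n. X n + - q)"
    unfolding abs_padic_of_rat[symmetric]
    by (rule plus_padic.abs_eq) (intro padic_rel_refl X padic_cauchy_const prime_card)+
  finally have "(\<lambda>n. rat_padic_abs CARD('p) (X n + - q)) \<longlonglongrightarrow> padic_abs (abs_padic X - of_rat q :: 'p padic)"
    using padic_abs_abs_padic[OF c] by (simp only:)
  thus ?thesis
    by (rule LIMSEQ_le_const2) (use e in auto)
qed

lemma padic_rat_dense:
  fixes x :: "'p::prime_card padic"
  assumes "e > 0" obtains q where "padic_abs (x - of_rat q) < e"
proof -
  obtain X where X: "padic_cauchy CARD('p) X" "x = abs_padic X"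
    by (rule padic_abs_tendsto[of x])
  have "e / 2 > 0" using assms by simp
  then obtain N where N: "\<forall>m\<ge>N. \<forall>n\<ge>N. rat_padic_abs CARD('p) (X m - X n) < e / 2"
    using X(1) unfolding padic_cauchy_def by meson
  have "padic_abs (x - of_rat (X N)) \<le> e / 2"
    unfolding X(2) by (rule padic_abs_diff_of_rat_le[OF X(1), of N]) (use N in \<open>auto intro: less_imp_le\<close>)
  also have "\<dots> < e" using assms by simp
  finally show ?thesis by (rule that)
qed

instance padic :: (prime_card) complete_space
proof
  fix x :: "nat \<Rightarrow> 'a padic" assume C: "Cauchy x"
  have "\<exists>q. padic_abs (x k - of_rat q) < 1 / real (Suc k)" for k
    by (rule padic_rat_dense[of "1 / real (Suc k)" "x k"]) auto
  then obtain q where q: "\<And>k. padic_abs (x k - of_rat (q k)) < 1 / real (Suc k)" by metis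
  have small: "\<exists>N. \<forall>k\<ge>N. padic_abs (x k - of_rat (q k)) < e" if e: "e > 0" for e :: real
  proof -
    obtain N where N: "1 / real (Suc N) < e" using nat_approx_posE[OF e] by blast
    have "padic_abs (x k - of_rat (q k)) < e" if "k \<ge> N" for k
    proof -
      have "1 / real (Suc k) \<le> 1 / real (Suc N)" using that by (simp add: frac_le)
      thus ?thesis using q[of k] N by linarith
    qed
    thus ?thesis by blast
  qed
  have qC: "padic_cauchy CARD('a) q"
    unfolding padic_cauchy_def
  proof safe
    fix e :: real assume e: "e > 0"
    obtain M where M: "\<And>m n. m \<ge> M \<Longrightarrow> n \<ge> M \<Longrightarrow> dist (x m) (x n) < e"
      using metric_CauchyD[OF C e] by blast
    obtain N where N: "\<And>k. k \<ge> N \<Longrightarrow> padic_abs (x k - of_rat (q k)) < e" using small[OF e] by blast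
    have "rat_padic_abs CARD('a) (q m - q n) < e" if mn: "m \<ge> max M N" "n \<ge> max M N" for m n
    proof -
      have "rat_padic_abs CARD('a) (q m - q n) = padic_abs (of_rat (q m) - of_rat (q n) :: 'a padic)"
        by (simp add: padic_abs_of_rat[symmetric] of_rat_diff)
      also have "of_rat (q m) - of_rat (q n) = (- (x m - of_rat (q m)) + (x n - of_rat (q n))) + (x m - x n)"
        by simp
      also have "padic_abs \<dots> \<le> max (max (padic_abs (x m - of_rat (q m))) (padic_abs (x n - of_rat (q n))))
          (dist (x m) (x n))"
        unfolding dist_padic_def
        by (rule order.trans[OF padic_abs_ultra], rule max.mono[OF order.trans[OF padic_abs_ultra] order.refl])
          (simp only: padic_abs_minus order.refl)
      also have "\<dots> < e" using M[of m n] N[of m] N[of n] mn by simp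
      finally show ?thesis .
    qed
    thus "\<exists>N. \<forall>m\<ge>N. \<forall>n\<ge>N. rat_padic_abs CARD('a) (q m - q n) < e" by blast
  qed
  have "x \<longlonglongrightarrow> abs_padic q"
  proof (rule metric_LIMSEQ_I)
    fix e :: real assume e: "e > 0"
    hence "e / 2 > 0" by simp
    then obtain M where M: "\<forall>m\<ge>M. \<forall>n\<ge>M. rat_padic_abs CARD('a) (q m - q n) < e / 2"
      using qC unfolding padic_cauchy_def by meson
    obtain N where N: "\<And>k. k \<ge> N \<Longrightarrow> padic_abs (x k - of_rat (q k)) < e" using small[OF e] by blast
    have "dist (x k) (abs_padic q) < e" if k: "k \<ge> max M N" for k
    proof -
      have "padic_abs (abs_padic q - of_rat (q k) :: 'a padic) \<le> e / 2"
        by (rule padic_abs_diff_of_rat_le[OF qC, of M]) (use M k in \<open>auto intro: less_imp_le\<close>)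
      hence 1: "padic_abs (abs_padic q - of_rat (q k) :: 'a padic) < e" using e by simp
      have "x k - abs_padic q = (x k - of_rat (q k)) + - (abs_padic q - of_rat (q k))" by simp
      hence "dist (x k) (abs_padic q) \<le>
          max (padic_abs (x k - of_rat (q k))) (padic_abs (abs_padic q - of_rat (q k) :: 'a padic))"
        unfolding dist_padic_def using padic_abs_ultra padic_abs_minus by metis
      thus ?thesis using 1 N[of k] k by simp
    qed
    thus "\<exists>N. \<forall>k\<ge>N. dist (x k) (abs_padic q) < e" by blast
  qed
  thus "convergent x" by (rule convergentI)
qed

section \<open>Analytic functions of three $p$-adic variables\<close>

text \<open>
  \<open>f\<close> is given near \<open>a\<close> by a power series in three variables with vector coefficients.
  Over a non-archimedean complete field, \<open>has_sum\<close> (unconditional convergence) is the same as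
  the terms tending to zero.
\<close>

definition padic_analytic_at ::
    "('p::prime_card padic ^ 3 \<Rightarrow> 'p padic ^ 3) \<Rightarrow> 'p padic ^ 3 \<Rightarrow> bool" where
  "padic_analytic_at f a \<longleftrightarrow>
     (\<exists>r>0. \<exists>c :: nat ^ 3 \<Rightarrow> 'p padic ^ 3. \<forall>z. (\<forall>i. dist (z $ i) (a $ i) < r) \<longrightarrow>
        ((\<lambda>k. (\<Prod>i\<in>UNIV. (z $ i - a $ i) ^ (k $ i)) *s c k) has_sum f z) UNIV)"

definition padic_analytic_on ::
    "('p::prime_card padic ^ 3) set \<Rightarrow> ('p padic ^ 3 \<Rightarrow> 'p padic ^ 3) \<Rightarrow> bool" where
  "padic_analytic_on U f \<longleftrightarrow> (\<forall>a\<in>U. padic_analytic_at f a)"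

text \<open>
  The field is not a real algebra, so the library's derivatives do not apply; the partial
  derivative is the limit of the difference quotient.
\<close>

definition partial_deriv ::
    "3 \<Rightarrow> ('p::prime_card padic ^ 3 \<Rightarrow> 'p padic) \<Rightarrow> 'p padic ^ 3 \<Rightarrow> 'p padic" where
  "partial_deriv i f z = Lim (at 0) (\<lambda>h. (f (z + axis i h) - f z) / h)"


section \<open>The line bundle\<close>

definition T_KZ :: "nat \<Rightarrow> 'p::prime_card padic ^ 3 \<Rightarrow> 'p padic" where
  "T_KZ s z = poly.coeff
     (([:- (z $ 1), 1:] * [:- (z $ 2), 1:] * [:- (z $ 3), 1:]) ^ ((CARD('p) ^ s - 1) div 2))
     (CARD('p) ^ s - 1)"

definition padic_integers :: "'p::prime_card padic set" where
  "padic_integers = {x. padic_abs x \<le> 1}"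

definition domain_D :: "('p::prime_card padic ^ 3) set" where
  "domain_D = {z. (\<forall>i. z $ i \<in> padic_integers) \<and> padic_abs (T_KZ 1 z) = 1}"

text \<open>
  \<open>T_KZ s\<close> is a polynomial in \<open>z\<close>, so its \<open>partial_deriv\<close> is the formal partial
  derivative. The limit in \<open>eta z\<close> is meaningful for \<open>z \<in> domain_D\<close>, the only points at
  which \<open>line_L\<close> is used.
\<close>

definition eta_approx :: "nat \<Rightarrow> 3 \<Rightarrow> 'p::prime_card padic ^ 3 \<Rightarrow> 'p padic" where
  "eta_approx s i z = partial_deriv i (T_KZ s) z / T_KZ s z"

definition eta :: "'p::prime_card padic ^ 3 \<Rightarrow> 'p padic ^ 3" where
  "eta z = (\<chi> i. lim (\<lambda>s. eta_approx s i z))"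

definition W_KZ :: "('p::prime_card padic ^ 3) set" where
  "W_KZ = {I. I $ 1 + I $ 2 + I $ 3 = 0}"

definition line_L :: "'p::prime_card padic ^ 3 \<Rightarrow> ('p padic ^ 3) set" where
  "line_L a = vec.span {eta a}"

text \<open>
  Sections over an open part \<open>U\<close> of the base. The function \<open>s\<close> is total; only its values on \<open>U\<close> matter.
\<close>

definition is_section ::
    "('p::prime_card padic ^ 3) set \<Rightarrow> ('p padic ^ 3 \<Rightarrow> 'p padic ^ 3) \<Rightarrow> bool" where
  "is_section U s \<longleftrightarrow> open U \<and> U \<subseteq> domain_D \<and> padic_analytic_on U s \<and>
     (\<forall>z\<in>U. s z \<in> W_KZ \<and> s z \<in> line_L z)"


section \<open>The KZ connection\<close>

definition Omega12 :: "'p::prime_card padic ^ 3 ^ 3" where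
  "Omega12 = vector [vector [-1, 1, 0], vector [1, -1, 0], vector [0, 0, 0]]"

definition Omega13 :: "'p::prime_card padic ^ 3 ^ 3" where
  "Omega13 = vector [vector [-1, 0, 1], vector [0, 0, 0], vector [1, 0, -1]]"

definition Omega23 :: "'p::prime_card padic ^ 3 ^ 3" where
  "Omega23 = vector [vector [0, 0, 0], vector [0, -1, 1], vector [0, 1, -1]]"

definition Omega :: "3 \<Rightarrow> 3 \<Rightarrow> 'p::prime_card padic ^ 3 ^ 3" where
  "Omega i j = (if {i, j} = {1, 2} then Omega12
     else if {i, j} = {1, 3} then Omega13
     else if {i, j} = {2, 3} then Omega23 else 0)"

definition H_KZ :: "3 \<Rightarrow> 'p::prime_card padic ^ 3 \<Rightarrow> 'p padic ^ 3 ^ 3" where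
  "H_KZ i z = (\<chi> a b. 1 / 2 * (\<Sum>j\<in>UNIV - {i}. Omega i j $ a $ b / (z $ i - z $ j)))"

definition nabla_KZ ::
    "3 \<Rightarrow> ('p::prime_card padic ^ 3 \<Rightarrow> 'p padic ^ 3) \<Rightarrow> 'p padic ^ 3 \<Rightarrow> 'p padic ^ 3" where
  "nabla_KZ i s z = (\<chi> k. partial_deriv i (\<lambda>w. s w $ k) z) - H_KZ i z *v s z"

definition distinct_coords :: "('p::prime_card padic ^ 3) set" where
  "distinct_coords = {z. z $ 1 \<noteq> z $ 2 \<and> z $ 1 \<noteq> z $ 3 \<and> z $ 2 \<noteq> z $ 3}"

end

theory Submission
  imports Defs
begin

text \<open>
  Write \<open>T_s\<close> for the Hasse polynomials, \<open>n_s = (p ^ s - 1) / 2\<close> for their degrees, and \<open>\<eta>\<close> for the limit of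
  the logarithmic gradients of \<open>T_s\<close> on the domain \<open>D\<close> where \<open>T_1\<close> is a unit. Three facts about \<open>\<eta>\<close>
  give the theorem.

  \<^item> The logarithmic gradients converge (\<open>eta_tendsto\<close>). This rests on Dwork's congruences
    \<open>T_(s+1)(z) T_(s-1)(z ^ p) \<equiv> T_s(z) T_s(z ^ p)\<close> modulo \<open>p ^ s\<close>, proved by the method of ghost terms
    (\<open>ghost_divisible\<close>, \<open>hasse_recurrence\<close>, \<open>dwork_congruence\<close>). They are proved over any commutative ring with
    a filtration that imitates divisibility by powers of \<open>p\<close>. Evaluating them at \<open>z + h e\<^sub>i\<close> modulo \<open>h\<^sup>2\<close> yields
    the congruence for the logarithmic derivatives without dividing or differentiating
    polynomials in several variables.

  \<^item> \<open>\<eta>\<close> satisfies \<open>\<Sum> \<eta>\<^sub>i = 0\<close> and \<open>\<Sum> z\<^sub>i \<eta>\<^sub>i = - 1/2\<close> (\<open>sum_eta\<close>, \<open>euler_eta\<close>). The first holds since \<open>T_s\<close> is a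
    coefficient whose translation derivative is divisible by \<open>p ^ s\<close>, the second is Euler's
    relation, because \<open>n_s\<close> tends to \<open>- 1/2\<close>.

  \<^item> For \<open>j \<noteq> i\<close> and \<open>z\<^sub>i \<noteq> z\<^sub>j\<close> the \<open>i\<close>-th partial derivative of \<open>\<eta>\<^sub>j\<close> is \<open>(1/2) (\<eta>\<^sub>i - \<eta>\<^sub>j) / (z\<^sub>i - z\<^sub>j) - \<eta>\<^sub>i \<eta>\<^sub>j\<close>
    (\<open>eta_has_partial\<close>). Indeed a partial fraction identity (\<open>zprod_partial_fractions\<close>) shows that the gradient
    of \<open>T_s\<close> satisfies the KZ equations with the parameter \<open>- n_s\<close> in place of \<open>1/2\<close>. Derivative
    and limit are exchanged with the help of Taylor estimates that are uniform in \<open>s\<close>.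

  In other words \<open>\<nabla>\<^sub>i \<eta> = - \<eta>\<^sub>i \<eta>\<close>: the off-diagonal components say so, and the remaining component
  follows because both sides lie in \<open>W\<close>. A section is \<open>s = f \<eta>\<close> with \<open>f = - 2 \<Sum> z\<^sub>l s\<^sub>l\<close> by Euler's relation,
  so \<open>f\<close> is differentiable and \<open>\<nabla>\<^sub>i s = (\<partial>\<^sub>i f - f \<eta>\<^sub>i) \<eta>\<close> lies on the line again.

  Sections are required to be analytic, so it must also be shown that \<open>\<nabla>\<^sub>i s\<close> is analytic. This is the
  elementary theory of power series over a complete non-archimedean field: sums, products,
  termwise differentiation (\<open>analytic_coord_partial\<close>) and the expansion of \<open>1 / (z\<^sub>i - z\<^sub>j)\<close>.
\<close>

section \<open>Rings filtered by powers of a prime\<close>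

text \<open>
  Congruences modulo powers of \<open>p\<close> are needed in three rings at once: the field of \<open>p\<close>-adic
  numbers, polynomials over it truncated to first order, and polynomials in \<open>t\<close> over either of
  these. Since \<open>p\<close> is invertible in all of them, divisibility says nothing; \<open>x \<in> I k\<close> plays
  the part of \<open>x \<equiv> 0\<close> modulo \<open>p ^ k\<close>, and \<open>I 0\<close> that of the ring of integers.
\<close>

locale filtered_ring =
  fixes p :: nat and I :: "nat \<Rightarrow> 'r::comm_ring_1 set"
  assumes I_zero: "0 \<in> I k"
    and I_add: "x \<in> I k \<Longrightarrow> y \<in> I k \<Longrightarrow> x + y \<in> I k"
    and I_minus: "x \<in> I k \<Longrightarrow> - x \<in> I k"
    and I_mult: "x \<in> I j \<Longrightarrow> y \<in> I k \<Longrightarrow> x * y \<in> I (j + k)"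
    and I_Suc: "x \<in> I (Suc k) \<Longrightarrow> x \<in> I k"
    and I_one: "1 \<in> I 0"
    and I_p: "of_nat p \<in> I 1"
begin

lemma I_diff: "x \<in> I k \<Longrightarrow> y \<in> I k \<Longrightarrow> x - y \<in> I k"
  using I_add[of x k "- y"] I_minus[of y k] by simp

lemma I_antimono:
  assumes "j \<le> k" "x \<in> I k" shows "x \<in> I j"
  using assms by (induction rule: dec_induct) (auto intro: I_Suc)

lemma I_mult0: "x \<in> I 0 \<Longrightarrow> y \<in> I k \<Longrightarrow> x * y \<in> I k"
  and I_mult0': "x \<in> I k \<Longrightarrow> y \<in> I 0 \<Longrightarrow> x * y \<in> I k"
  using I_mult[of x 0 y k] I_mult[of x k y 0] by simp_all

lemma I_sum: "(\<And>x. x \<in> A \<Longrightarrow> f x \<in> I k) \<Longrightarrow> sum f A \<in> I k"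
  by (induction A rule: infinite_finite_induct) (auto intro: I_zero I_add)

lemma I_prod0: "(\<And>x. x \<in> A \<Longrightarrow> f x \<in> I 0) \<Longrightarrow> prod f A \<in> I 0"
  by (induction A rule: infinite_finite_induct) (auto intro: I_one I_mult0)

lemma I_power0: "x \<in> I 0 \<Longrightarrow> x ^ n \<in> I 0"
  by (induction n) (auto intro: I_one I_mult0)

lemma I_of_nat: "of_nat n \<in> I 0"
  by (induction n) (auto intro: I_zero I_one I_add)

lemma I_trans: "x - y \<in> I k \<Longrightarrow> y - z \<in> I k \<Longrightarrow> x - z \<in> I k"
  using I_add[of "x - y" k "y - z"] by simp

lemma I_mult_cong:
  assumes "a - b \<in> I k" "c - d \<in> I k" "c \<in> I 0" "b \<in> I 0"
  shows "a * c - b * d \<in> I k"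
proof -
  have "a * c - b * d = (a - b) * c + b * (c - d)" by (simp add: algebra_simps)
  thus ?thesis using assms by (auto intro: I_add I_mult0 I_mult0')
qed

lemma I_power_cong:
  assumes "a - b \<in> I k" "a \<in> I 0" "b \<in> I 0"
  shows "a ^ n - b ^ n \<in> I k"
  by (induction n) (auto intro: I_zero I_mult_cong I_power0 assms)

lemma I_prod_cong:
  assumes "\<And>x. x \<in> A \<Longrightarrow> f x - g x \<in> I k" "\<And>x. x \<in> A \<Longrightarrow> f x \<in> I 0" "\<And>x. x \<in> A \<Longrightarrow> g x \<in> I 0"
  shows "prod f A - prod g A \<in> I k"
  using assms
proof (induction A rule: infinite_finite_induct)
  case (insert x A)
  have "f x * prod f A - g x * prod g A \<in> I k"
    using insert.prems by (intro I_mult_cong insert.IH I_prod0) auto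
  thus ?case using insert.hyps by simp
qed (auto intro: I_zero)

text \<open>
  The remainder is integral because it is a polynomial in \<open>x\<close> and \<open>y\<close> with integer
  coefficients; no factorials appear in denominators.
\<close>

lemma taylor_power:
  assumes "x \<in> I 0" "y \<in> I 0"
  shows "\<exists>q\<in>I 0. (x + y) ^ n = x ^ n + of_nat n * x ^ (n - 1) * y + y\<^sup>2 * q"
proof (induction n)
  case 0
  show ?case by (auto intro!: bexI[of _ 0] I_zero)
next
  case (Suc n)
  then obtain q where q: "q \<in> I 0" "(x + y) ^ n = x ^ n + of_nat n * x ^ (n - 1) * y + y\<^sup>2 * q" by blast
  have x: "of_nat n * x ^ n = of_nat n * x ^ (n - 1) * x" by (cases n) auto
  have "(x + y) ^ Suc n = (x + y) * (x ^ n + of_nat n * x ^ (n - 1) * y + y\<^sup>2 * q)"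
    using q(2) by simp
  also have "\<dots> = x ^ Suc n + x ^ n * y + (of_nat n * x ^ (n - 1) * x) * y
      + y\<^sup>2 * (of_nat n * x ^ (n - 1) + q * (x + y))"
    by (simp add: algebra_simps power2_eq_square)
  also have "\<dots> = x ^ Suc n + of_nat (Suc n) * x ^ (Suc n - 1) * y
      + y\<^sup>2 * (of_nat n * x ^ (n - 1) + q * (x + y))"
    unfolding x[symmetric] by (simp add: algebra_simps)
  finally show ?case
    using assms q(1) by (blast intro: I_add I_mult0 I_of_nat I_power0)
qed

text \<open>
  With \<open>a = b + c\<close> the linear term of \<open>(b + c) ^ p\<close> gains a factor \<open>p\<close>, and the remaining
  terms contain \<open>c\<^sup>2\<close>, which is already smaller than \<open>p * c\<close>.
\<close>

lemma power_p_cong: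
  assumes "a - b \<in> I (Suc k)" "b \<in> I 0"
  shows "a ^ p - b ^ p \<in> I (Suc (Suc k))"
proof -
  have ab: "a - b \<in> I 0" by (rule I_antimono[OF _ assms(1)]) simp
  obtain q where q: "q \<in> I 0"
    "(b + (a - b)) ^ p = b ^ p + of_nat p * b ^ (p - 1) * (a - b) + (a - b)\<^sup>2 * q"
    using taylor_power[OF assms(2) ab] by blast
  have "of_nat p * (b ^ (p - 1) * (a - b)) \<in> I (1 + Suc k)"
    by (intro I_mult I_p I_mult0 I_power0 assms)
  moreover have "(a - b) * (a - b) * q \<in> I (Suc k + Suc k)"
    by (intro I_mult0' I_mult assms q)
  hence "(a - b) * (a - b) * q \<in> I (Suc (Suc k))" by (rule I_antimono[rotated]) simp
  moreover have "a ^ p - b ^ p = of_nat p * (b ^ (p - 1) * (a - b)) + (a - b) * (a - b) * q"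
    using q(2) by (simp add: algebra_simps power2_eq_square)
  ultimately show ?thesis by (auto intro: I_add)
qed

lemma power_pow_cong:
  assumes "a - b \<in> I 1" "b \<in> I 0"
  shows "a ^ (p ^ m) - b ^ (p ^ m) \<in> I (Suc m)"
proof (induction m)
  case 0 thus ?case using assms by simp
next
  case (Suc m)
  show ?case using power_p_cong[OF Suc I_power0[OF assms(2)]]
    by (simp add: power_mult[symmetric] mult.commute)
qed

lemma frobenius_add:
  assumes "prime p" "x \<in> I 0" "y \<in> I 0"
  shows "(x + y) ^ p - (x ^ p + y ^ p) \<in> I 1"
proof -
  have p: "p > 0" using assms(1) prime_gt_0_nat by blast
  have "(x + y) ^ p = (\<Sum>k\<le>p. of_nat (p choose k) * x ^ k * y ^ (p - k))"
    by (simp add: binomial_ring)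
  also have "{..p} = insert 0 (insert p {0<..<p})" by auto
  also have "(\<Sum>k\<in>insert 0 (insert p {0<..<p}). of_nat (p choose k) * x ^ k * y ^ (p - k))
     = y ^ p + (x ^ p + (\<Sum>k\<in>{0<..<p}. of_nat (p choose k) * x ^ k * y ^ (p - k)))"
    using p by (subst sum.insert; (subst sum.insert)?) auto
  finally have eq: "(x + y) ^ p - (x ^ p + y ^ p)
      = (\<Sum>k\<in>{0<..<p}. of_nat (p choose k) * x ^ k * y ^ (p - k))" by simp
  show ?thesis unfolding eq
  proof (rule I_sum)
    fix k assume "k \<in> {0<..<p}"
    hence "p dvd p choose k" using assms(1) by (intro dvd_choose_prime) auto
    then obtain c where "p choose k = p * c" by blast
    hence "of_nat (p choose k) * x ^ k * y ^ (p - k) = of_nat p * (of_nat c * x ^ k * y ^ (p - k))"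
      by (simp add: algebra_simps)
    moreover have "\<dots> \<in> I 1"
      by (intro I_mult0' I_p I_mult0 I_power0 I_of_nat assms)
    ultimately show "of_nat (p choose k) * x ^ k * y ^ (p - k) \<in> I 1" by simp
  qed
qed

definition I_poly :: "nat \<Rightarrow> 'r poly set" where
  "I_poly k = {f. \<forall>n. poly.coeff f n \<in> I k}"

lemma filtered_ring_poly: "filtered_ring p I_poly"
proof
  fix f g :: "'r poly" and j k :: nat
  show "f * g \<in> I_poly (j + k)" if "f \<in> I_poly j" "g \<in> I_poly k"
    using that unfolding I_poly_def by (auto simp: coeff_mult intro!: I_sum I_mult)
  show "1 \<in> I_poly 0" by (auto simp: I_poly_def intro: I_one I_zero)
  show "of_nat p \<in> I_poly 1"
    using I_p I_zero by (auto simp: I_poly_def of_nat_poly coeff_pCons split: nat.splits)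
qed (auto simp: I_poly_def intro: I_zero I_add I_minus I_Suc)

end

section \<open>Ghost terms\<close>

text \<open>
  The ghost terms \<open>G k\<close> are what is left of a sequence \<open>F s\<close> when it is expanded through its
  Frobenius twists, \<open>F s 0 = (\<Sum>k. G k * F (s - k) k)\<close>. The second index of \<open>F\<close> counts how often
  the Frobenius lift \<open>t \<mapsto> t ^ p\<close>, \<open>z \<mapsto> z ^ p\<close> has been applied.
\<close>

function ghost :: "(nat \<Rightarrow> nat \<Rightarrow> 'a::comm_ring_1) \<Rightarrow> nat \<Rightarrow> 'a" where
  "ghost F s = F s 0 - (\<Sum>k\<in>{1..<s}. ghost F k * F (s - k) k)"
  by auto
termination by (relation "Wellfounded.measure (\<lambda>(F, s). s)") auto

declare ghost.simps [simp del]

lemma ghost_expansion: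
  assumes "s > 0" "\<And>k. F 0 k = 1"
  shows "F s 0 = (\<Sum>k\<in>{1..s}. ghost F k * F (s - k) k)"
proof -
  have "{1..s} = insert s {1..<s}" using assms(1) by auto
  hence "(\<Sum>k\<in>{1..s}. ghost F k * F (s - k) k) = ghost F s + (\<Sum>k\<in>{1..<s}. ghost F k * F (s - k) k)"
    using assms(2) by simp
  also have "\<dots> = F s 0" by (subst ghost.simps) simp
  finally show ?thesis by simp
qed

context filtered_ring
begin

text \<open>
  Suppose that \<open>F s\<close> is the product of the \<open>L ^ (p ^ j)\<close> for \<open>j < s\<close>. Multiplying the expansion
  of \<open>F s\<close> by \<open>L ^ (p ^ s)\<close> and subtracting the expansion of \<open>F (s + 1)\<close> shows that the next ghost
  term is a sum of \<open>G k * F (s - k) k\<close> times the difference of \<open>L 0 ^ (p ^ s)\<close> and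
  \<open>L k ^ (p ^ (s - k))\<close>. The first factor is divisible by \<open>p ^ (k - 1)\<close> by induction and the
  difference by \<open>p ^ (s - k + 1)\<close>, since \<open>L 0 ^ (p ^ k) \<equiv> L k\<close> modulo \<open>p\<close>.
\<close>

lemma ghost_divisible:
  fixes F :: "nat \<Rightarrow> nat \<Rightarrow> 'r"
  assumes F0: "\<And>k. F 0 k = 1" and FS: "\<And>s k. F (Suc s) k = F s k * L k ^ (p ^ s)"
    and L0: "\<And>k. L k \<in> I 0" and LS: "\<And>k. L k ^ p - L (Suc k) \<in> I 1"
  shows "ghost F (Suc s) \<in> I s"
proof (induction s rule: less_induct)
  case (less s)
  have F_int: "F s k \<in> I 0" for s k
    by (induction s) (auto simp: F0 FS intro: I_one I_mult0 I_power0 L0)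
  show ?case
  proof (cases "s = 0")
    case True
    thus ?thesis by (simp add: ghost.simps[of F "Suc 0"] F_int)
  next
    case False
    have L_pow: "L 0 ^ (p ^ k) - L k \<in> I 1" for k
    proof (induction k)
      case 0 thus ?case by (simp add: I_zero)
    next
      case (Suc k)
      have "L 0 ^ p ^ Suc k - L k ^ p \<in> I 1"
        using I_power_cong[OF Suc I_power0[OF L0] L0, of p]
        by (simp add: power_mult[symmetric] mult.commute)
      thus ?case using LS by (rule I_trans)
    qed
    have "ghost F (Suc s) = F s 0 * L 0 ^ (p ^ s) - (\<Sum>k\<in>{1..s}. ghost F k * F (Suc s - k) k)"
      by (subst ghost.simps) (simp add: FS atLeastLessThanSuc_atLeastAtMost)
    also have "F s 0 * L 0 ^ (p ^ s) = (\<Sum>k\<in>{1..s}. ghost F k * F (s - k) k * L 0 ^ (p ^ s))"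
      using False ghost_expansion[of s F] F0 by (simp add: sum_distrib_right)
    also have "(\<Sum>k\<in>{1..s}. ghost F k * F (Suc s - k) k)
        = (\<Sum>k\<in>{1..s}. ghost F k * F (s - k) k * L k ^ (p ^ (s - k)))"
      by (rule sum.cong) (auto simp: Suc_diff_le FS)
    finally have eq: "ghost F (Suc s)
        = (\<Sum>k\<in>{1..s}. ghost F k * F (s - k) k * (L 0 ^ (p ^ s) - L k ^ (p ^ (s - k))))"
      by (simp add: sum_subtractf right_diff_distrib)
    show ?thesis unfolding eq
    proof (rule I_sum)
      fix k assume k: "k \<in> {1..s}"
      then obtain k' where k': "k = Suc k'" by (cases k) auto
      have g: "ghost F k * F (s - k) k \<in> I k'"
        using less[of k'] k k' by (auto intro!: I_mult0' F_int)
      have "(L 0 ^ p ^ k) ^ p ^ (s - k) - L k ^ p ^ (s - k) \<in> I (Suc (s - k))"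
        by (intro power_pow_cong L_pow L0)
      moreover have "(L 0 ^ p ^ k) ^ p ^ (s - k) = L 0 ^ p ^ s"
        using k by (simp add: power_mult[symmetric] power_add[symmetric])
      ultimately have "ghost F k * F (s - k) k * (L 0 ^ (p ^ s) - L k ^ (p ^ (s - k))) \<in> I (k' + Suc (s - k))"
        using g by (intro I_mult) auto
      thus "ghost F k * F (s - k) k * (L 0 ^ (p ^ s) - L k ^ (p ^ (s - k))) \<in> I s"
        by (rule I_antimono[rotated]) (use k k' in auto)
    qed
  qed
qed

text \<open>
  Regular elements are those which may be cancelled from congruences. They replace units:
  in the jet filtration below an element whose constant term is a unit is regular, although
  it need not have an inverse among the polynomials.
\<close>

definition regular :: "'r \<Rightarrow> bool" where
  "regular a \<longleftrightarrow> a \<in> I 0 \<and> (\<forall>k. \<forall>x\<in>I 0. a * x \<in> I k \<longrightarrow> x \<in> I k)"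

lemma regular_mult: "regular a \<Longrightarrow> regular b \<Longrightarrow> regular (a * b)"
  unfolding regular_def by (metis I_mult0 mult.assoc)

lemma regular_one: "regular 1"
  by (simp add: regular_def I_one)

lemma regular_power: "regular a \<Longrightarrow> regular (a ^ n)"
  by (induction n) (simp_all add: regular_one regular_mult)

lemma regular_cong:
  assumes "regular a" "b - a \<in> I 1"
  shows "regular b"
proof -
  have "(b - a) + a \<in> I 0"
    using assms by (intro I_add I_antimono[of 0 1 "b - a"]) (auto simp: regular_def)
  hence "b \<in> I 0" by simp
  moreover have "x \<in> I k" if x: "x \<in> I 0" "b * x \<in> I k" for k x
    using x
  proof (induction k)
    case (Suc k)
    hence "x \<in> I k" using I_Suc by blast
    hence "(b - a) * x \<in> I (1 + k)" using assms(2) by (intro I_mult)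
    hence "b * x - (b - a) * x \<in> I (Suc k)" using Suc.prems by (intro I_diff) auto
    moreover have "b * x - (b - a) * x = a * x" by (simp add: algebra_simps)
    ultimately have "a * x \<in> I (Suc k)" by simp
    thus ?case using assms(1) Suc.prems(1) unfolding regular_def by blast
  qed simp
  ultimately show ?thesis unfolding regular_def by blast
qed

text \<open>
  This is \<open>T (s + 1) / \<sigma> (T s) \<equiv> T s / \<sigma> (T (s - 1))\<close> modulo \<open>p ^ s\<close>, cleared of denominators and
  with \<open>s + 1\<close> in place of \<open>s\<close>. Substituting the recurrence for the two leading factors leaves
  terms \<open>\<gamma> k\<close> times a two by two determinant. The determinants are telescoped: the one for \<open>k + 1\<close>
  follows from the one for \<open>k\<close> and the induction hypothesis for the smaller index \<open>s - k\<close>. Each step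
  loses one power of \<open>p\<close>, which the divisibility of \<open>\<gamma> k\<close> pays back.
\<close>

lemma dwork_congruence_abstract:
  fixes T \<gamma> :: "nat \<Rightarrow> nat \<Rightarrow> 'r"
  assumes rec: "\<And>s m. s > 0 \<Longrightarrow> T s m = (\<Sum>k\<in>{1..s}. \<gamma> k m * T (s - k) (m + k))"
    and \<gamma>: "\<And>k m. \<gamma> (Suc k) m \<in> I k" and reg: "\<And>s m. regular (T s m)"
  shows "T (Suc (Suc s)) m * T s (Suc m) - T (Suc s) m * T (Suc s) (Suc m) \<in> I (Suc s)"
proof (induction s arbitrary: m rule: less_induct)
  case (less s)
  define P Q where "P = T s (Suc m)" and "Q = T (Suc s) (Suc m)"
  have T_int: "T s m \<in> I 0" for s m using reg by (simp add: regular_def)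
  have C: "T (Suc s - j) (m + Suc j) * P - T (s - j) (m + Suc j) * Q \<in> I (Suc s - j)"
    if "j \<le> s" for j using that
  proof (induction j)
    case 0
    thus ?case by (simp add: P_def Q_def mult.commute I_zero)
  next
    case (Suc j)
    define r M where "r = s - Suc j" and "M = m + Suc j"
    have r: "Suc s - j = Suc (Suc r)" "s - j = Suc r" "Suc s - Suc j = Suc r" "r < s"
      using Suc.prems by (auto simp: r_def)
    let ?a1 = "T (Suc (Suc r)) M" and ?a0 = "T (Suc r) M"
    let ?b1 = "T (Suc r) (Suc M)" and ?b0 = "T r (Suc M)"
    \<comment> \<open>Both ratios \<open>b1 / b0\<close> and \<open>Q / P\<close> agree with \<open>a1 / a0\<close>, one by the step before and one by the
      outer induction; eliminating \<open>a1\<close> and cancelling \<open>a0\<close> compares them with each other.\<close>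
    have 1: "?a1 * P - ?a0 * Q \<in> I (Suc r)"
      using Suc.IH Suc.prems by (auto simp: r M_def intro: I_Suc)
    have 2: "?a1 * ?b0 - ?a0 * ?b1 \<in> I (Suc r)"
      using less.IH[OF r(4), of M] .
    have "?b0 * (?a1 * P - ?a0 * Q) - (?a1 * ?b0 - ?a0 * ?b1) * P \<in> I (Suc r)"
      by (intro I_diff I_mult0[OF _ 1] I_mult0'[OF 2]) (auto simp: T_int P_def)
    hence "?a0 * (?b1 * P - ?b0 * Q) \<in> I (Suc r)"
      by (simp add: algebra_simps)
    moreover have "?b1 * P - ?b0 * Q \<in> I 0"
      by (intro I_diff I_mult0) (auto simp: T_int P_def Q_def)
    ultimately have "?b1 * P - ?b0 * Q \<in> I (Suc r)"
      using reg[of "Suc r" M] unfolding regular_def by blast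
    thus ?case by (simp add: r M_def flip: r_def)
  qed
  have "T (Suc (Suc s)) m * P - T (Suc s) m * Q
      = (\<Sum>k\<in>{1..Suc (Suc s)}. \<gamma> k m * T (Suc (Suc s) - k) (m + k)) * P
      - (\<Sum>k\<in>{1..Suc s}. \<gamma> k m * T (Suc s - k) (m + k)) * Q"
    by (subst (1 2) rec) auto
  also have "\<dots> = (\<Sum>k\<in>{1..Suc s}. \<gamma> k m * (T (Suc (Suc s) - k) (m + k) * P - T (Suc s - k) (m + k) * Q))
      + \<gamma> (Suc (Suc s)) m * T 0 (m + Suc (Suc s)) * P"
    by (simp add: sum_distrib_right sum_subtractf right_diff_distrib mult.assoc distrib_right)
  also have "\<dots> \<in> I (Suc s)"
  proof (intro I_add I_sum)
    fix k assume "k \<in> {1..Suc s}"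
    then obtain j where j: "k = Suc j" "j \<le> s" by (cases k) auto
    have "\<gamma> k m * (T (Suc (Suc s) - k) (m + k) * P - T (Suc s - k) (m + k) * Q) \<in> I (j + (Suc s - j))"
      using C[OF j(2)] j by (intro I_mult) (auto simp: \<gamma>)
    thus "\<gamma> k m * (T (Suc (Suc s) - k) (m + k) * P - T (Suc s - k) (m + k) * Q) \<in> I (Suc s)"
      using j by simp
  qed (auto intro!: I_mult0' \<gamma> simp: T_int P_def)
  finally show ?case by (simp add: P_def Q_def)
qed

end

section \<open>Hasse polynomials and their Dwork congruences\<close>

lemma coeff_pcompose_monom:
  fixes f :: "'a::comm_ring_1 poly"
  assumes "q > 0"
  shows "poly.coeff (pcompose f (Polynomial.monom 1 q)) n = (if q dvd n then poly.coeff f (n div q) else 0)"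
proof (induction f arbitrary: n)
  case 0 thus ?case by simp
next
  case (pCons a f)
  show ?case
  proof (cases "n < q")
    case True
    thus ?thesis using assms
      by (auto simp: pcompose_pCons coeff_monom_mult coeff_pCons split: nat.splits dest: dvd_imp_le)
  next
    case False
    then obtain d where d: "n = q + d" using le_Suc_ex not_less by blast
    thus ?thesis using assms pCons.IH[of d]
      by (auto simp: pcompose_pCons coeff_monom_mult coeff_pCons split: nat.splits)
  qed
qed

text \<open>
  The exponents occurring in the second factor are multiples of \<open>q\<close>, so only exponents of \<open>g\<close>
  congruent to \<open>q - 1\<close> modulo \<open>q\<close> contribute, and the degree bound leaves \<open>q - 1\<close> as the only one.
\<close>

lemma coeff_mult_pcompose_monom:
  fixes f g :: "'a::comm_ring_1 poly"
  assumes q: "q > 0" and deg: "degree g < 2 * q - 1"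
  shows "poly.coeff (g * pcompose f (Polynomial.monom 1 q)) (q * b + (q - 1)) = poly.coeff g (q - 1) * poly.coeff f b"
proof -
  let ?N = "q * b + (q - 1)"
  have "poly.coeff (g * pcompose f (Polynomial.monom 1 q)) ?N
      = (\<Sum>i\<le>?N. poly.coeff g i * poly.coeff (pcompose f (Polynomial.monom 1 q)) (?N - i))"
    by (rule coeff_mult)
  also have "\<dots> = (\<Sum>i\<in>{q - 1}. poly.coeff g i * poly.coeff (pcompose f (Polynomial.monom 1 q)) (?N - i))"
  proof (rule sum.mono_neutral_right)
    show "\<forall>i\<in>{..?N} - {q - 1}. poly.coeff g i * poly.coeff (pcompose f (Polynomial.monom 1 q)) (?N - i) = 0"
    proof
      fix i assume i: "i \<in> {..?N} - {q - 1}"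
      show "poly.coeff g i * poly.coeff (pcompose f (Polynomial.monom 1 q)) (?N - i) = 0"
      proof (cases "i < 2 * q - 1 \<and> q dvd ?N - i")
        case True
        then obtain c where c: "?N - i = q * c" by blast
        hence "q * c + i + 1 = q * (b + 1)" using i q by (auto simp: algebra_simps)
        hence "q dvd q * c + (i + 1)" by (metis add.assoc dvd_triv_left)
        hence "q dvd i + 1" by (subst (asm) dvd_add_right_iff) auto
        then obtain d where d: "i + 1 = q * d" by blast
        have "q * d < q * 2" using d True by linarith
        moreover have "d \<noteq> 0" using d by (cases "d = 0") auto
        ultimately have "d = 1" using q by simp
        thus ?thesis using d i q by auto
      next
        case False
        hence "poly.coeff g i = 0 \<or> poly.coeff (pcompose f (Polynomial.monom 1 q)) (?N - i) = 0"
          using deg by (auto simp: coeff_pcompose_monom[OF q] coeff_eq_0)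
        thus ?thesis by auto
      qed
    qed
  qed auto
  also have "\<dots> = poly.coeff g (q - 1) * poly.coeff f b"
    using q by (simp add: coeff_pcompose_monom[OF q])
  finally show ?thesis .
qed


definition zprod :: "'r::comm_ring_1 ^ 3 \<Rightarrow> (3 \<Rightarrow> nat) \<Rightarrow> 'r poly" where
  "zprod v a = (\<Prod>l\<in>UNIV. [:- (v $ l), 1:] ^ a l)"

definition vpow :: "'r::comm_ring_1 ^ 3 \<Rightarrow> nat \<Rightarrow> 'r ^ 3" where
  "vpow v n = (\<chi> l. (v $ l) ^ n)"

text \<open>
  The polynomial \<open>T_s\<close> over an arbitrary commutative ring, so that it can also be evaluated at
  points that depend on an infinitesimal parameter.
\<close>

definition hasse :: "nat \<Rightarrow> nat \<Rightarrow> 'r::comm_ring_1 ^ 3 \<Rightarrow> 'r" where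
  "hasse p s v = poly.coeff (zprod v (\<lambda>_. (p ^ s - 1) div 2)) (p ^ s - 1)"

lemma vpow_nth [simp]: "vpow v n $ l = (v $ l) ^ n"
  by (simp add: vpow_def)

lemma vpow_vpow: "vpow (vpow v m) n = vpow v (m * n)"
  by (simp add: vec_eq_iff power_mult)

lemma vpow_1 [simp]: "vpow v (Suc 0) = v"
  by (simp add: vec_eq_iff)

lemma zprod_add: "zprod v (\<lambda>l. a l + b l) = zprod v a * zprod v b"
  by (simp add: zprod_def power_add prod.distrib)

lemma zprod_mult: "zprod v (\<lambda>l. a l * n) = zprod v a ^ n"
  by (simp add: zprod_def power_mult prod_power_distrib)

lemma zprod_0 [simp]: "zprod v (\<lambda>_. 0) = 1"
  by (simp add: zprod_def)

lemma zprod_split: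
  "zprod v a = [:- (v $ i), 1:] ^ a i * (\<Prod>l\<in>UNIV - {i}. [:- (v $ l), 1:] ^ a l)"
  unfolding zprod_def by (subst prod.remove[of _ i]) auto

lemma zprod_upd:
  "zprod v (a(i := n)) = [:- (v $ i), 1:] ^ n * (\<Prod>l\<in>UNIV - {i}. [:- (v $ l), 1:] ^ a l)"
  unfolding zprod_split[of v "a(i := n)" i] by (auto intro!: arg_cong2[of _ _ _ _ "(*)"] prod.cong)

lemma degree_zprod_le: "degree (zprod v a) \<le> (\<Sum>l\<in>UNIV. a l)"
proof -
  have "degree (zprod v a) \<le> (\<Sum>l\<in>UNIV. degree ([:- (v $ l), 1:] ^ a l))"
    unfolding zprod_def using degree_prod_sum_le[of UNIV "\<lambda>l. [:- (v $ l), 1:] ^ a l"] by simp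
  also have "\<dots> \<le> (\<Sum>l\<in>UNIV. a l)"
    by (intro sum_mono order.trans[OF degree_power_le]) auto
  finally show ?thesis .
qed

lemma hasse_0 [simp]: "hasse p 0 v = 1"
  by (simp add: hasse_def)

lemma half_power_split:
  fixes p :: nat
  assumes "odd p"
  shows "(p ^ (j + k) - 1) div 2 = (p ^ j - 1) div 2 + (p ^ k - 1) div 2 * p ^ j"
proof -
  have "2 * ((p ^ n - 1) div 2) = p ^ n - 1" for n
    using assms by (intro dvd_mult_div_cancel) (auto simp: even_diff_nat)
  note * = this
  have "p ^ j > 0" "p ^ k > 0" using assms by (auto simp: odd_pos)
  then obtain A B where AB: "p ^ j = Suc A" "p ^ k = Suc B" using gr0_implies_Suc by metis
  have "2 * ((p ^ (j + k) - 1) div 2) = (p ^ j - 1) + (p ^ k - 1) * p ^ j"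
    unfolding *[of "j + k"] unfolding power_add AB by simp
  also have "\<dots> = 2 * ((p ^ j - 1) div 2) + 2 * ((p ^ k - 1) div 2) * p ^ j"
    unfolding * ..
  also have "\<dots> = 2 * ((p ^ j - 1) div 2 + (p ^ k - 1) div 2 * p ^ j)"
    by simp
  finally have "2 * ((p ^ (j + k) - 1) div 2) = 2 * ((p ^ j - 1) div 2 + (p ^ k - 1) div 2 * p ^ j)" .
  thus ?thesis by simp
qed

lemma pcompose_power: "pcompose (f ^ n) g = pcompose f g ^ n"
  by (induction n) (simp_all add: pcompose_mult pcompose_1)

text \<open>
  The image of \<open>\<Phi> ^ ((p ^ s - 1) div 2)\<close>, where \<open>\<Phi> = (t - v\<^sub>1) (t - v\<^sub>2) (t - v\<^sub>3)\<close>, under the \<open>k\<close>-th power of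
  the Frobenius lift.
\<close>

definition twist :: "nat \<Rightarrow> nat \<Rightarrow> 'r::comm_ring_1 ^ 3 \<Rightarrow> nat \<Rightarrow> 'r poly" where
  "twist p s v k = pcompose (zprod (vpow v (p ^ k)) (\<lambda>_. (p ^ s - 1) div 2)) (Polynomial.monom 1 (p ^ k))"

lemma twist_prod:
  "twist p s v k = (\<Prod>l\<in>UNIV. (Polynomial.monom 1 (p ^ k) + [:- ((v $ l) ^ p ^ k):]) ^ ((p ^ s - 1) div 2))"
  by (simp add: twist_def zprod_def pcompose_prod pcompose_power pcompose_pCons add.commute)

lemma twist_0 [simp]: "twist p 0 v k = 1"
  by (simp add: twist_def pcompose_1)

lemma twist_Suc:
  assumes "odd p"
  shows "twist p (Suc s) v k = twist p s v k * twist p 1 v k ^ (p ^ s)"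
proof -
  have "(p ^ Suc s - 1) div 2 = (p ^ s - 1) div 2 + (p ^ 1 - 1) div 2 * p ^ s"
    using half_power_split[OF assms, of s 1] by simp
  thus ?thesis
    unfolding twist_def by (simp only: zprod_add zprod_mult pcompose_mult pcompose_power)
qed

lemma degree_twist_le: "degree (twist p s v k) \<le> 3 * ((p ^ s - 1) div 2) * p ^ k"
proof -
  have "degree (twist p s v k)
      \<le> degree (zprod (vpow v (p ^ k)) (\<lambda>_. (p ^ s - 1) div 2)) * degree (Polynomial.monom (1::'a) (p ^ k))"
    unfolding twist_def by (rule degree_pcompose_le)
  also have "\<dots> \<le> (\<Sum>l\<in>(UNIV::3 set). (p ^ s - 1) div 2) * p ^ k"
    by (intro mult_mono degree_zprod_le degree_monom_le) auto
  finally show ?thesis by simp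
qed

text \<open>
  The degrees in \<open>t\<close> of all products in the ghost expansion add up to the same bound, because
  \<open>(p ^ s - 1) / 2\<close> has all its base \<open>p\<close> digits equal to \<open>(p - 1) / 2\<close>.
\<close>

lemma degree_ghost_twist_le:
  assumes "odd p"
  shows "degree (ghost (\<lambda>s. twist p s v) s) \<le> 3 * ((p ^ s - 1) div 2)"
proof (induction s rule: less_induct)
  case (less s)
  have "degree (ghost (\<lambda>s. twist p s v) k * twist p (s - k) v k) \<le> 3 * ((p ^ s - 1) div 2)"
    if k: "k \<in> {1..<s}" for k
  proof -
    have "degree (ghost (\<lambda>s. twist p s v) k * twist p (s - k) v k)
        \<le> 3 * ((p ^ k - 1) div 2) + 3 * ((p ^ (s - k) - 1) div 2) * p ^ k"
      by (intro order.trans[OF degree_mult_le] add_mono less degree_twist_le) (use k in auto)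
    also have "\<dots> = 3 * ((p ^ s - 1) div 2)"
      using half_power_split[OF assms, of k "s - k"] k by simp
    finally show ?thesis .
  qed
  moreover have "degree (twist p s v 0) \<le> 3 * ((p ^ s - 1) div 2)"
    using degree_twist_le[of p s v 0] by simp
  ultimately show ?case
    by (subst ghost.simps) (intro degree_diff_le degree_sum_le; auto)
qed

definition ghost_coeff :: "nat \<Rightarrow> 'r::comm_ring_1 ^ 3 \<Rightarrow> nat \<Rightarrow> 'r" where
  "ghost_coeff p v k = poly.coeff (ghost (\<lambda>s. twist p s v) k) (p ^ k - 1)"

text \<open>
  The ghost term of index \<open>k\<close> has degree at most \<open>3 (p ^ k - 1) / 2 < 2 p ^ k - 1\<close>. Hence \<open>t ^ (p ^ k - 1)\<close> is its only
  monomial that can meet the coefficient of \<open>t ^ (p ^ s - 1)\<close> in the product, and taking coefficients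
  is multiplicative.
\<close>

lemma hasse_recurrence:
  assumes p: "odd p" and s: "s > 0"
  shows "hasse p s v = (\<Sum>k\<in>{1..s}. ghost_coeff p v k * hasse p (s - k) (vpow v (p ^ k)))"
proof -
  have "hasse p s v = poly.coeff (twist p s v 0) (p ^ s - 1)"
    by (simp add: hasse_def twist_def coeff_pcompose_monom)
  also have "twist p s v 0 = (\<Sum>k\<in>{1..s}. ghost (\<lambda>s. twist p s v) k * twist p (s - k) v k)"
    using ghost_expansion[OF s, of "\<lambda>s. twist p s v"] by simp
  also have "poly.coeff \<dots> (p ^ s - 1) = (\<Sum>k\<in>{1..s}. ghost_coeff p v k * hasse p (s - k) (vpow v (p ^ k)))"
    unfolding coeff_sum
  proof (rule sum.cong)
    fix k assume k: "k \<in> {1..s}"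
    have pk: "p ^ k > 0" using p by (simp add: odd_pos)
    have "3 * ((p ^ k - 1) div 2) < 2 * p ^ k - 1" using pk by linarith
    hence deg: "degree (ghost (\<lambda>s. twist p s v) k) < 2 * p ^ k - 1"
      using degree_ghost_twist_le[OF p, of v k] by linarith
    have "p ^ s = p ^ k * p ^ (s - k)" using k by (simp flip: power_add)
    moreover have "p ^ (s - k) > 0" using p by (simp add: odd_pos)
    then obtain B where "p ^ (s - k) = Suc B" using gr0_implies_Suc by blast
    moreover obtain A where "p ^ k = Suc A" using pk gr0_implies_Suc by blast
    ultimately have "p ^ s - 1 = p ^ k * (p ^ (s - k) - 1) + (p ^ k - 1)"
      by simp
    thus "poly.coeff (ghost (\<lambda>s. twist p s v) k * twist p (s - k) v k) (p ^ s - 1)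
        = ghost_coeff p v k * hasse p (s - k) (vpow v (p ^ k))"
      unfolding twist_def[of p "s - k"] ghost_coeff_def hasse_def
      by (simp only: coeff_mult_pcompose_monom[OF pk deg])
  qed simp
  finally show ?thesis .
qed

context filtered_ring
begin

lemma zprod_int:
  assumes "\<And>l. v $ l \<in> I 0" shows "zprod v a \<in> I_poly 0"
proof -
  interpret P: filtered_ring p I_poly by (rule filtered_ring_poly)
  have "[:- (v $ l), 1:] \<in> I_poly 0" for l
    using assms by (auto simp: I_poly_def coeff_pCons intro: I_minus I_one I_zero split: nat.splits)
  thus ?thesis unfolding zprod_def by (intro P.I_prod0 P.I_power0)
qed

lemma zprod_coeff_int:
  assumes "\<And>l. v $ l \<in> I 0" shows "poly.coeff (zprod v a) n \<in> I 0"
  using zprod_int[OF assms] by (simp add: I_poly_def)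

end

locale filtered_ring_odd = filtered_ring p I
  for p :: nat and I :: "nat \<Rightarrow> 'r::comm_ring_1 set" +
  assumes prime_p: "prime p" and odd_p: "odd p"
begin

lemma p_pos: "p > 0" using prime_p prime_gt_0_nat by blast

lemma twist_int:
  assumes "\<And>l. v $ l \<in> I 0" shows "twist p s v k \<in> I_poly 0"
proof -
  have "zprod (vpow v (p ^ k)) (\<lambda>_. (p ^ s - 1) div 2) \<in> I_poly 0"
    using assms by (intro zprod_int) (simp add: I_power0)
  thus ?thesis
    using p_pos by (auto simp: twist_def I_poly_def coeff_pcompose_monom I_zero)
qed

lemma twist_frobenius:
  assumes "\<And>l. v $ l \<in> I 0"
  shows "twist p s v k ^ p - twist p s v (Suc k) \<in> I_poly 1"
proof -
  interpret P: filtered_ring p I_poly by (rule filtered_ring_poly)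
  let ?x = "Polynomial.monom 1 (p ^ k) :: 'r poly" and ?y = "\<lambda>l. [:- ((v $ l) ^ p ^ k):]"
  have x: "?x \<in> I_poly 0" by (auto simp: I_poly_def I_one I_zero)
  have y: "?y l \<in> I_poly 0" for l
    using assms by (auto simp: I_poly_def coeff_pCons intro: I_minus I_power0 I_zero split: nat.splits)
  have xp: "?x ^ p = Polynomial.monom 1 (p ^ Suc k)"
    by (simp add: monom_power mult.commute)
  have yp: "?y l ^ p = [:- ((v $ l) ^ p ^ Suc k):]" for l
    using odd_p by (simp add: poly_const_pow power_mult[symmetric] mult.commute)
  have eq: "twist p s v k ^ p = (\<Prod>l\<in>UNIV. ((?x + ?y l) ^ p) ^ ((p ^ s - 1) div 2))"
    unfolding twist_prod prod_power_distrib by (simp add: power_mult[symmetric] mult.commute)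
  have eq': "twist p s v (Suc k) = (\<Prod>l\<in>UNIV. (?x ^ p + ?y l ^ p) ^ ((p ^ s - 1) div 2))"
    unfolding twist_prod xp yp ..
  show ?thesis unfolding eq eq'
    by (intro P.I_prod_cong P.I_power_cong P.frobenius_add P.I_power0 P.I_add prime_p x y)
qed

lemma ghost_coeff_int:
  assumes "\<And>l. v $ l \<in> I 0" shows "ghost_coeff p v (Suc k) \<in> I k"
proof -
  interpret P: filtered_ring p I_poly by (rule filtered_ring_poly)
  have "ghost (\<lambda>s. twist p s v) (Suc k) \<in> I_poly k"
    by (rule P.ghost_divisible[where L = "twist p 1 v"])
      (use twist_Suc[OF odd_p] twist_int[OF assms] twist_frobenius[OF assms] in auto)
  thus ?thesis by (simp add: ghost_coeff_def I_poly_def)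
qed

lemma hasse_int:
  assumes "\<And>l. v $ l \<in> I 0" shows "hasse p s v \<in> I 0"
  using zprod_int[OF assms] by (simp add: hasse_def I_poly_def)

text \<open>
  Raising a polynomial to the power \<open>p\<close> is modulo \<open>p\<close> the same as raising its coefficients and its
  variable to that power.
\<close>

lemma coeff_power_p:
  assumes "f \<in> I_poly 0"
  shows "poly.coeff (f ^ p) (p * n) - poly.coeff f n ^ p \<in> I 1"
  using assms
proof (induction f arbitrary: n)
  case 0
  thus ?case using p_pos by (simp add: I_zero zero_power)
next
  case (pCons a f)
  interpret P: filtered_ring p I_poly by (rule filtered_ring_poly)
  have "poly.coeff (pCons a f) k \<in> I 0" for k using pCons.prems by (simp add: I_poly_def)
  from this[of 0] this[of "Suc k" for k] have f: "f \<in> I_poly 0" and a: "a \<in> I 0"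
    by (auto simp: I_poly_def)
  have int: "[:a:] \<in> I_poly 0" "Polynomial.monom 1 1 * f \<in> I_poly 0"
    using a f by (auto simp: I_poly_def coeff_pCons coeff_monom_mult I_zero split: nat.splits)
  have eq: "pCons a f = [:a:] + Polynomial.monom 1 1 * f"
    by (simp add: monom_Suc)
  have "pCons a f ^ p - ([:a:] ^ p + (Polynomial.monom 1 1 * f) ^ p) \<in> I_poly 1"
    unfolding eq by (rule P.frobenius_add[OF prime_p int])
  hence 1: "poly.coeff (pCons a f ^ p) (p * n) - poly.coeff ([:a:] ^ p + (Polynomial.monom 1 1 * f) ^ p) (p * n) \<in> I 1"
    by (simp add: I_poly_def)
  have 2: "poly.coeff ([:a:] ^ p + (Polynomial.monom 1 1 * f) ^ p) (p * n)
      = (case n of 0 \<Rightarrow> a ^ p | Suc m \<Rightarrow> poly.coeff (f ^ p) (p * m))"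
    using p_pos by (auto simp: power_mult_distrib monom_power poly_const_pow coeff_monom_mult
        coeff_pCons split: nat.splits)
  show ?case
  proof (cases n)
    case 0
    thus ?thesis using 1 2 by simp
  next
    case (Suc m)
    thus ?thesis using I_trans[OF 1] 2 pCons.IH[OF f, of m] by simp
  qed
qed

lemma hasse_frobenius:
  assumes "\<And>l. v $ l \<in> I 0"
  shows "hasse p 1 (vpow v p) - hasse p 1 v ^ p \<in> I 1"
proof -
  have 1: "hasse p 1 v = poly.coeff (twist p 1 v 0) (p - 1)"
    by (simp add: hasse_def twist_def coeff_pcompose_monom)
  have 2: "hasse p 1 (vpow v p) = poly.coeff (twist p 1 v 1) (p * (p - 1))"
    using p_pos by (simp add: hasse_def twist_def coeff_pcompose_monom)
  have 3: "poly.coeff (twist p 1 v 0 ^ p) (p * (p - 1)) - poly.coeff (twist p 1 v 1) (p * (p - 1)) \<in> I 1"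
    using twist_frobenius[OF assms, of 1 0] by (simp add: I_poly_def)
  have 4: "poly.coeff (twist p 1 v 0 ^ p) (p * (p - 1)) - poly.coeff (twist p 1 v 0) (p - 1) ^ p \<in> I 1"
    by (rule coeff_power_p[OF twist_int[OF assms]])
  show ?thesis unfolding 1 2 using I_diff[OF 4 3] by simp
qed

text \<open>
  Modulo \<open>p\<close> only the first ghost term survives, so \<open>T_s(v) \<equiv> T_1(v) T_1(v ^ p) \<dots>\<close>, and \<open>T_1(v ^ p)\<close> is
  congruent to \<open>T_1(v) ^ p\<close>.
\<close>

lemma regular_hasse:
  assumes int: "\<And>l. v $ l \<in> I 0" and reg: "regular (hasse p 1 v)"
  shows "regular (hasse p s (vpow v (p ^ m)))"
proof -
  have one: "regular (hasse p 1 (vpow v (p ^ m)))" for m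
  proof (induction m)
    case 0 thus ?case using reg by simp
  next
    case (Suc m)
    have "hasse p 1 (vpow (vpow v (p ^ m)) p) - hasse p 1 (vpow v (p ^ m)) ^ p \<in> I 1"
      using int by (intro hasse_frobenius) (simp add: I_power0)
    thus ?case using regular_cong[OF regular_power[OF Suc]] by (simp add: vpow_vpow mult.commute)
  qed
  show ?thesis
  proof (induction s arbitrary: m)
    case 0 thus ?case by (simp add: regular_one)
  next
    case (Suc s)
    let ?v = "vpow v (p ^ m)"
    have int': "?v $ l \<in> I 0" for l using int by (simp add: I_power0)
    have "hasse p (Suc s) ?v - ghost_coeff p ?v 1 * hasse p s (vpow ?v (p ^ 1))
        = (\<Sum>k\<in>{2..Suc s}. ghost_coeff p ?v k * hasse p (Suc s - k) (vpow ?v (p ^ k)))"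
      unfolding hasse_recurrence[OF odd_p zero_less_Suc]
      by (subst sum.atLeast_Suc_atMost) (auto simp: numeral_2_eq_2)
    also have "\<dots> \<in> I 1"
    proof (rule I_sum)
      fix k assume "k \<in> {2..Suc s}"
      then obtain j where j: "k = Suc (Suc j)" by (metis Suc_le_D add_2_eq_Suc atLeastAtMost_iff le_Suc_ex numeral_2_eq_2)
      have "ghost_coeff p ?v (Suc (Suc j)) \<in> I 1"
        by (rule I_antimono[OF _ ghost_coeff_int[OF int']]) simp
      thus "ghost_coeff p ?v k * hasse p (Suc s - k) (vpow ?v (p ^ k)) \<in> I 1"
        unfolding j using int' by (intro I_mult0' hasse_int) (auto simp: I_power0)
    qed
    finally have "hasse p (Suc s) ?v - hasse p 1 ?v * hasse p s (vpow ?v (p ^ 1)) \<in> I 1"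
      using hasse_recurrence[OF odd_p, of 1 ?v] by simp
    moreover have "regular (hasse p 1 ?v * hasse p s (vpow ?v (p ^ 1)))"
      using Suc[of "Suc m"] by (intro regular_mult one) (simp add: vpow_vpow mult.commute)
    ultimately show ?case by (rule regular_cong[rotated])
  qed
qed

lemma dwork_congruence:
  assumes int: "\<And>l. v $ l \<in> I 0" and reg: "regular (hasse p 1 v)"
  shows "hasse p (Suc (Suc s)) v * hasse p s (vpow v p)
      - hasse p (Suc s) v * hasse p (Suc s) (vpow v p) \<in> I (Suc s)"
proof -
  define T where "T s m = hasse p s (vpow v (p ^ m))" for s m
  define \<gamma> where "\<gamma> k m = ghost_coeff p (vpow v (p ^ m)) k" for k m
  have "T (Suc (Suc s)) 0 * T s (Suc 0) - T (Suc s) 0 * T (Suc s) (Suc 0) \<in> I (Suc s)"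
  proof (rule dwork_congruence_abstract[where \<gamma> = \<gamma>])
    show "T s m = (\<Sum>k = 1..s. \<gamma> k m * T (s - k) (m + k))" if "s > 0" for s m
      unfolding T_def \<gamma>_def hasse_recurrence[OF odd_p that, of "vpow v (p ^ m)"]
      by (simp add: vpow_vpow power_add)
    show "\<gamma> (Suc k) m \<in> I k" for k m
      unfolding \<gamma>_def using int by (intro ghost_coeff_int) (simp add: I_power0)
    show "regular (T s m)" for s m
      unfolding T_def by (rule regular_hasse[OF assms])
  qed
  thus ?thesis by (simp add: T_def)
qed

end

section \<open>The topological field of $p$-adic numbers\<close>

lemma padic_abs_0 [simp]: "padic_abs (0 :: 'p::prime_card padic) = 0"
  by simp

lemma padic_abs_diff_commute: "padic_abs (x - y :: 'p::prime_card padic) = padic_abs (y - x)"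
  using padic_abs_minus[of "x - y"] by simp

lemma padic_abs_ultra_diff:
  "padic_abs (x - y :: 'p::prime_card padic) \<le> max (padic_abs x) (padic_abs y)"
  using padic_abs_ultra[of x "- y"] by simp

lemma padic_abs_add_le:
  "padic_abs (x :: 'p::prime_card padic) \<le> r \<Longrightarrow> padic_abs y \<le> r \<Longrightarrow> padic_abs (x + y) \<le> r"
  using padic_abs_ultra[of x y] by simp

lemma padic_abs_diff_le:
  "padic_abs (x :: 'p::prime_card padic) \<le> r \<Longrightarrow> padic_abs y \<le> r \<Longrightarrow> padic_abs (x - y) \<le> r"
  using padic_abs_ultra_diff[of x y] by simp

lemma padic_abs_sum_le:
  fixes f :: "'a \<Rightarrow> 'p::prime_card padic"
  assumes "\<And>x. x \<in> A \<Longrightarrow> padic_abs (f x) \<le> r" "r \<ge> 0"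
  shows "padic_abs (sum f A) \<le> r"
  using assms(1) by (induction A rule: infinite_finite_induct) (auto intro: padic_abs_add_le assms(2))

lemma padic_abs_power: "padic_abs (x ^ n :: 'p::prime_card padic) = padic_abs x ^ n"
  by (induction n) (simp_all add: padic_abs_mult)

lemma padic_abs_prod: "padic_abs (prod f A :: 'p::prime_card padic) = (\<Prod>x\<in>A. padic_abs (f x))"
  by (induction A rule: infinite_finite_induct) (simp_all add: padic_abs_mult)

lemma padic_abs_inverse: "padic_abs (inverse x :: 'p::prime_card padic) = inverse (padic_abs x)"
proof (cases "x = 0")
  case False
  hence "padic_abs x * padic_abs (inverse x) = 1" by (simp flip: padic_abs_mult)
  thus ?thesis by (metis inverse_unique)
qed simp

lemma padic_abs_divide: "padic_abs (x / y :: 'p::prime_card padic) = padic_abs x / padic_abs y"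
  by (simp add: divide_inverse padic_abs_mult padic_abs_inverse)

lemma padic_abs_of_nat_le: "padic_abs (of_nat n :: 'p::prime_card padic) \<le> 1"
  by (induction n) (auto intro: padic_abs_add_le)

lemma padic_abs_card: "padic_abs (of_nat CARD('p) :: 'p::prime_card padic) = 1 / real CARD('p)"
proof -
  have p: "prime CARD('p)" by (rule prime_card)
  have "padic_abs (of_nat CARD('p) :: 'p padic) = rat_padic_abs CARD('p) (of_int (int CARD('p)) / of_int 1)"
    by (subst padic_abs_of_rat[symmetric, where 'p = 'p]) simp
  also have "\<dots> = real CARD('p) powi (- 1)"
    using prime_gt_0_nat[OF p] p
    by (subst rat_padic_abs_frac[OF p]) (auto simp: multiplicity_self not_prime_unit)
  finally show ?thesis by (simp add: power_int_minus divide_inverse)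
qed

lemma card_gt_1: "real CARD('p::prime_card) > 1"
  using prime_gt_1_nat[OF prime_card[where 'a = 'p]] by simp

instance padic :: (prime_card) topological_ab_group_add
proof
  fix a b :: "'a padic"
  show "LIM x (nhds a \<times>\<^sub>F nhds b). fst x + snd x :> nhds (a + b)"
    unfolding tendsto_dist_iff[of _ "a + b"]
  proof (rule Lim_null_comparison)
    have "dist (x + y) (a + b) \<le> dist x a + dist y b" for x y
      using padic_abs_triangle[of "x - a" "y - b"] by (simp add: dist_padic_def add_diff_add)
    thus "\<forall>\<^sub>F x in nhds a \<times>\<^sub>F nhds b. norm (dist (fst x + snd x) (a + b)) \<le> dist (fst x) a + dist (snd x) b"
      by simp
    have "((\<lambda>x. dist (fst x) a + dist (snd x) b) \<longlongrightarrow> dist a a + dist b b) (nhds a \<times>\<^sub>F nhds b)"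
      by (intro tendsto_intros filterlim_fst filterlim_snd)
    thus "((\<lambda>x. dist (fst x) a + dist (snd x) b) \<longlongrightarrow> 0) (nhds a \<times>\<^sub>F nhds b)" by simp
  qed
  have eq: "dist (- x) (- a) = dist x a" for x
    using padic_abs_diff_commute[of a x] by (simp add: dist_padic_def)
  have "((\<lambda>x. dist x a) \<longlongrightarrow> dist a a) (nhds a)"
    by (intro tendsto_intros filterlim_ident)
  thus "(uminus \<longlongrightarrow> - a) (nhds a)"
    unfolding tendsto_dist_iff[of _ "- a"] eq by simp
qed

instance padic :: (prime_card) topological_comm_monoid_mult
proof
  fix a b :: "'a padic"
  show "LIM x (nhds a \<times>\<^sub>F nhds b). fst x * snd x :> nhds (a * b)"
    unfolding tendsto_dist_iff[of _ "a * b"]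
  proof (rule Lim_null_comparison)
    let ?g = "\<lambda>x. dist (fst x) a * dist (snd x) b + (dist (fst x) a * padic_abs b + padic_abs a * dist (snd x) b)"
    have "dist (x * y) (a * b) \<le> ?g (x, y)" for x y
    proof -
      have "x * y - a * b = (x - a) * (y - b) + ((x - a) * b + a * (y - b))" by (simp add: algebra_simps)
      thus ?thesis
        using padic_abs_triangle[of "(x - a) * (y - b)" "(x - a) * b + a * (y - b)"]
          padic_abs_triangle[of "(x - a) * b" "a * (y - b)"]
        by (simp add: dist_padic_def padic_abs_mult)
    qed
    thus "\<forall>\<^sub>F x in nhds a \<times>\<^sub>F nhds b. norm (dist (fst x * snd x) (a * b)) \<le> ?g x" by simp
    have "(?g \<longlongrightarrow> dist a a * dist b b + (dist a a * padic_abs b + padic_abs a * dist b b)) (nhds a \<times>\<^sub>F nhds b)"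
      by (intro tendsto_intros filterlim_fst filterlim_snd)
    thus "(?g \<longlongrightarrow> 0) (nhds a \<times>\<^sub>F nhds b)" by simp
  qed
qed

lemma tendsto_padic_abs:
  fixes f :: "'a \<Rightarrow> 'p::prime_card padic"
  assumes "(f \<longlongrightarrow> l) F" shows "((\<lambda>x. padic_abs (f x)) \<longlongrightarrow> padic_abs l) F"
  using tendsto_dist[OF assms tendsto_const[of 0]] by (simp add: dist_padic_def)

lemma padic_abs_power_card_tendsto:
  "(\<lambda>n. (1 / real CARD('p::prime_card)) ^ n) \<longlonglongrightarrow> 0"
  using card_gt_1[where 'p = 'p] by (intro LIMSEQ_realpow_zero) auto

lemma card_power_tendsto_0: "(\<lambda>n. of_nat CARD('p) ^ n :: 'p::prime_card padic) \<longlonglongrightarrow> 0"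
  using padic_abs_power_card_tendsto[where 'p = 'p]
  by (subst tendsto_dist_iff) (simp add: dist_padic_def padic_abs_power padic_abs_card)

instance padic :: (prime_card) perfect_space
proof
  fix x :: "'a padic"
  show "\<not> open {x}"
  proof
    assume "open {x}"
    moreover have "(\<lambda>n. x + of_nat CARD('a) ^ n) \<longlonglongrightarrow> x + 0"
      by (intro tendsto_intros card_power_tendsto_0)
    ultimately have "\<forall>\<^sub>F n in sequentially. x + of_nat CARD('a) ^ n \<in> {x}"
      by (intro topological_tendstoD) auto
    then obtain n where "(of_nat CARD('a) :: 'a padic) ^ n = 0"
      by (auto simp: eventually_sequentially)
    thus False by simp
  qed
qed

section \<open>Partial derivatives\<close>

text \<open>
  The relational form of \<^const>\<open>partial_deriv\<close>: it also asserts that the limit exists.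
\<close>

definition has_partial ::
    "3 \<Rightarrow> ('p::prime_card padic ^ 3 \<Rightarrow> 'p padic) \<Rightarrow> 'p padic ^ 3 \<Rightarrow> 'p padic \<Rightarrow> bool" where
  "has_partial i f z D \<longleftrightarrow> ((\<lambda>h. (f (z + axis i h) - f z) / h) \<longlongrightarrow> D) (at 0)"

lemma partial_deriv_eq: "has_partial i f z D \<Longrightarrow> partial_deriv i f z = D"
  unfolding has_partial_def partial_deriv_def by (intro tendsto_Lim) auto

lemma has_partial_add:
  "has_partial i f z D \<Longrightarrow> has_partial i g z E \<Longrightarrow> has_partial i (\<lambda>w. f w + g w) z (D + E)"
  unfolding has_partial_def
  by (drule (1) tendsto_add) (simp add: add_divide_distrib[symmetric] add_diff_add)

lemma has_partial_const: "has_partial i (\<lambda>_. c) z 0"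
  by (simp add: has_partial_def)

lemma has_partial_continuous:
  assumes "has_partial i f z D"
  shows "((\<lambda>h. f (z + axis i h)) \<longlongrightarrow> f z) (at 0)"
proof -
  have "((\<lambda>h. (f (z + axis i h) - f z) / h * h + f z) \<longlongrightarrow> D * 0 + f z) (at 0)"
    using assms unfolding has_partial_def by (intro tendsto_intros) auto
  moreover have "\<forall>\<^sub>F h in at 0. (f (z + axis i h) - f z) / h * h + f z = f (z + axis i h)"
    by (auto simp: eventually_at_filter)
  ultimately show ?thesis by (auto elim: Lim_transform_eventually)
qed

lemma has_partial_mult:
  assumes "has_partial i f z D" "has_partial i g z E"
  shows "has_partial i (\<lambda>w. f w * g w) z (D * g z + f z * E)"
proof -
  have "((\<lambda>h. (f (z + axis i h) - f z) / h * g (z + axis i h) + f z * ((g (z + axis i h) - g z) / h))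
      \<longlongrightarrow> D * g z + f z * E) (at 0)"
    using assms has_partial_continuous[OF assms(2)] unfolding has_partial_def
    by (intro tendsto_intros)
  thus ?thesis unfolding has_partial_def
    by (rule Lim_transform_eventually) (auto simp: eventually_at_filter field_simps)
qed

lemma has_partial_cmult: "has_partial i f z D \<Longrightarrow> has_partial i (\<lambda>w. c * f w) z (c * D)"
  using has_partial_mult[OF has_partial_const, of i f z D c] by simp

lemma has_partial_nth: "has_partial i (\<lambda>w. w $ j) z (if i = j then 1 else 0)"
proof -
  have "\<forall>\<^sub>F h in at 0. (if i = j then 1 else 0) = ((z + axis i h) $ j - z $ j) / h"
    by (auto simp: eventually_at_filter axis_def)
  thus ?thesis unfolding has_partial_def by (rule Lim_transform_eventually[rotated]) simp
qed

text \<open>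
  The derivatives of \<open>T_s\<close>, of \<open>\<eta>\<close> and of power series all come from quadratic error estimates.
  Unlike derivatives, such estimates survive limits of functions.
\<close>

lemma has_partial_taylor:
  fixes f :: "'p::prime_card padic ^ 3 \<Rightarrow> 'p padic"
  assumes r: "r > 0"
    and le: "\<And>h. padic_abs h < r \<Longrightarrow> padic_abs (f (z + axis i h) - f z - h * D) \<le> C * (padic_abs h)\<^sup>2"
  shows "has_partial i f z D"
  unfolding has_partial_def tendsto_dist_iff[of _ D]
proof (rule Lim_null_comparison)
  have "norm (dist ((f (z + axis i h) - f z) / h) D) \<le> C * padic_abs h" if "h \<noteq> 0" "dist h 0 < r" for h
  proof -
    have h: "padic_abs h > 0" using that padic_abs_nonneg[of h] by (simp add: order_less_le)
    have "(f (z + axis i h) - f z) / h - D = (f (z + axis i h) - f z - h * D) / h"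
      using that by (simp add: field_simps)
    hence "norm (dist ((f (z + axis i h) - f z) / h) D) = padic_abs (f (z + axis i h) - f z - h * D) / padic_abs h"
      by (simp add: dist_padic_def padic_abs_divide padic_abs_nonneg)
    also have "\<dots> \<le> C * (padic_abs h)\<^sup>2 / padic_abs h"
      using le[of h] that h by (intro divide_right_mono) (auto simp: dist_padic_def)
    finally show ?thesis using h that(1) by (simp add: power2_eq_square)
  qed
  thus "\<forall>\<^sub>F h in at 0. norm (dist ((f (z + axis i h) - f z) / h) D) \<le> C * padic_abs h"
    using r by (auto simp: eventually_at)
  have "((\<lambda>h :: 'p padic. C * padic_abs h) \<longlongrightarrow> C * padic_abs (0 :: 'p padic)) (at 0)"
    by (rule tendsto_mult_left[OF tendsto_padic_abs[OF tendsto_ident_at]])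
  thus "((\<lambda>h. C * padic_abs (h :: 'p padic)) \<longlongrightarrow> 0) (at 0)" by simp
qed

lemma axis_tendsto_0:
  "((\<lambda>h. z + axis i h) \<longlongrightarrow> (z :: 'p::prime_card padic ^ 3)) (at 0)"
proof (rule vec_tendstoI)
  fix j
  have "((\<lambda>h. z $ j + (if j = i then h else 0)) \<longlongrightarrow> z $ j + (if j = i then 0 else 0)) (at 0)"
    by (cases "j = i") (auto intro!: tendsto_eq_intros)
  thus "((\<lambda>h. (z + axis i h) $ j) \<longlongrightarrow> z $ j) (at 0)"
    by (simp add: axis_def eq_commute cong: if_cong)
qed

lemma has_partial_cong:
  assumes "open U" "z \<in> U" "\<And>w. w \<in> U \<Longrightarrow> f w = g w" "has_partial i f z D"
  shows "has_partial i g z D"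
proof -
  have "\<forall>\<^sub>F h in at 0. z + axis i h \<in> U"
    using topological_tendstoD[OF axis_tendsto_0 assms(1,2)] .
  hence "\<forall>\<^sub>F h in at 0. (f (z + axis i h) - f z) / h = (g (z + axis i h) - g z) / h"
    by eventually_elim (use assms in auto)
  with assms(4) show ?thesis unfolding has_partial_def by (rule Lim_transform_eventually)
qed


section \<open>Derivatives of the Hasse polynomials\<close>

text \<open>
  The formal derivatives of \<open>T_s\<close> in closed form: differentiating with respect to \<open>z\<^sub>i\<close> lowers the
  exponent of \<open>t - z\<^sub>i\<close>. In \<open>hasse_deriv2\<close> the two directions are distinct.
\<close>

definition hasse_deriv :: "nat \<Rightarrow> nat \<Rightarrow> 3 \<Rightarrow> 'r::comm_ring_1 ^ 3 \<Rightarrow> 'r" where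
  "hasse_deriv p s i v = - of_nat ((p ^ s - 1) div 2) *
     poly.coeff (zprod v ((\<lambda>_. (p ^ s - 1) div 2)(i := (p ^ s - 1) div 2 - 1))) (p ^ s - 1)"

definition hasse_deriv2 :: "nat \<Rightarrow> nat \<Rightarrow> 3 \<Rightarrow> 3 \<Rightarrow> 'r::comm_ring_1 ^ 3 \<Rightarrow> 'r" where
  "hasse_deriv2 p s i j v = (of_nat ((p ^ s - 1) div 2))\<^sup>2 *
     poly.coeff (zprod v ((\<lambda>_. (p ^ s - 1) div 2)
       (i := (p ^ s - 1) div 2 - 1, j := (p ^ s - 1) div 2 - 1))) (p ^ s - 1)"

lemma (in filtered_ring) zprod_taylor:
  assumes v: "\<And>l. v $ l \<in> I 0" and y: "y \<in> I 0"
  shows "\<exists>q\<in>I 0. poly.coeff (zprod (v + axis i y) a) n = poly.coeff (zprod v a) n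
    - of_nat (a i) * y * poly.coeff (zprod v (a(i := a i - 1))) n + y\<^sup>2 * q"
proof -
  interpret P: filtered_ring p I_poly by (rule filtered_ring_poly)
  let ?X = "[:- (v $ i), 1:]" and ?R = "\<Prod>l\<in>UNIV - {i}. [:- (v $ l), 1:] ^ a l"
  have lin: "[:- (v $ l), 1:] \<in> I_poly 0" for l
    using v by (auto simp: I_poly_def coeff_pCons intro: I_minus I_one I_zero split: nat.splits)
  have R: "?R \<in> I_poly 0" by (intro P.I_prod0 P.I_power0 lin)
  have "[:- y:] \<in> I_poly 0"
    using y by (auto simp: I_poly_def coeff_pCons intro: I_minus I_zero split: nat.splits)
  then obtain q where q: "q \<in> I_poly 0"
    "(?X + [:- y:]) ^ a i = ?X ^ a i + of_nat (a i) * ?X ^ (a i - 1) * [:- y:] + [:- y:]\<^sup>2 * q"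
    using P.taylor_power[OF lin] by blast
  have 1: "zprod v b = ?X ^ b i * (\<Prod>l\<in>UNIV - {i}. [:- (v $ l), 1:] ^ b l)" for b
    by (rule zprod_split)
  have "zprod (v + axis i y) a = (?X + [:- y:]) ^ a i * (\<Prod>l\<in>UNIV - {i}. [:- ((v + axis i y) $ l), 1:] ^ a l)"
    unfolding zprod_def by (subst prod.remove[of _ i]) (auto simp: axis_def)
  also have "(\<Prod>l\<in>UNIV - {i}. [:- ((v + axis i y) $ l), 1:] ^ a l) = ?R"
    by (rule prod.cong) (auto simp: axis_def)
  also have "(?X + [:- y:]) ^ a i * ?R = zprod v a - Polynomial.smult (of_nat (a i) * y) (?X ^ (a i - 1) * ?R) + Polynomial.smult (y\<^sup>2) (q * ?R)"
    unfolding q(2) 1[of a] by (simp add: algebra_simps of_nat_poly power2_eq_square)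
  also have "?X ^ (a i - 1) * ?R = zprod v (a(i := a i - 1))"
    by (rule zprod_upd[symmetric])
  finally have "zprod (v + axis i y) a
    = zprod v a - Polynomial.smult (of_nat (a i) * y) (zprod v (a(i := a i - 1))) + Polynomial.smult (y\<^sup>2) (q * ?R)" .
  moreover have "poly.coeff (q * ?R) n \<in> I 0"
    using P.I_mult0[OF q(1) R] by (simp add: I_poly_def)
  ultimately show ?thesis by auto
qed

lemma (in filtered_ring) hasse_deriv_int:
  assumes "\<And>l. v $ l \<in> I 0"
  shows "hasse_deriv q s i v \<in> I 0" "hasse_deriv2 q s i j v \<in> I 0"
  unfolding hasse_deriv_def hasse_deriv2_def
  by (intro I_mult0 I_minus I_power0 I_of_nat zprod_coeff_int assms)+

lemma (in filtered_ring) hasse_taylor: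
  assumes "\<And>l. v $ l \<in> I 0" "y \<in> I 0"
  shows "\<exists>q\<in>I 0. hasse p' s (v + axis i y) = hasse p' s v + y * hasse_deriv p' s i v + y\<^sup>2 * q"
proof -
  obtain q where "q \<in> I 0" "hasse p' s (v + axis i y) = hasse p' s v
    - of_nat ((p' ^ s - 1) div 2) * y * poly.coeff (zprod v ((\<lambda>_. (p' ^ s - 1) div 2)(i := (p' ^ s - 1) div 2 - 1)))
        (p' ^ s - 1) + y\<^sup>2 * q"
    using zprod_taylor[OF assms, of i "\<lambda>_. (p' ^ s - 1) div 2" "p' ^ s - 1"] unfolding hasse_def by auto
  thus ?thesis by (auto simp: hasse_deriv_def algebra_simps intro!: bexI[of _ q])
qed

lemma (in filtered_ring) hasse_deriv_taylor:
  assumes "\<And>l. v $ l \<in> I 0" "y \<in> I 0" "i \<noteq> j"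
  shows "\<exists>q\<in>I 0. hasse_deriv p' s j (v + axis i y)
    = hasse_deriv p' s j v + y * hasse_deriv2 p' s i j v + y\<^sup>2 * q"
proof -
  let ?n = "(p' ^ s - 1) div 2"
  obtain q where q: "q \<in> I 0" "poly.coeff (zprod (v + axis i y) ((\<lambda>_. ?n)(j := ?n - 1))) (p' ^ s - 1)
    = poly.coeff (zprod v ((\<lambda>_. ?n)(j := ?n - 1))) (p' ^ s - 1)
    - of_nat ?n * y * poly.coeff (zprod v ((\<lambda>_. ?n)(j := ?n - 1, i := ?n - 1))) (p' ^ s - 1) + y\<^sup>2 * q"
    using zprod_taylor[OF assms(1,2), of i "(\<lambda>_. ?n)(j := ?n - 1)" "p' ^ s - 1"] assms(3) by auto
  have "- of_nat ?n * q \<in> I 0" by (intro I_mult0 I_minus I_of_nat q)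
  moreover have "(\<lambda>_. ?n)(j := ?n - 1, i := ?n - 1) = (\<lambda>_. ?n)(i := ?n - 1, j := ?n - 1)"
    using assms(3) by (simp add: fun_upd_twist)
  ultimately show ?thesis
    unfolding hasse_deriv_def hasse_deriv2_def q(2)
    by (intro bexI[of _ "- of_nat ?n * q"]) (simp_all add: algebra_simps power2_eq_square)
qed

text \<open>
  With \<open>\<Phi> = (t - v\<^sub>1) (t - v\<^sub>2) (t - v\<^sub>3)\<close> this is \<open>\<Phi> ^ n\<close> times the partial fraction decomposition of
  \<open>1 / ((t - v\<^sub>i) (t - v\<^sub>j))\<close>. It is the source of the denominators in the KZ connection.
\<close>

lemma zprod_partial_fractions:
  fixes v :: "'r::comm_ring_1 ^ 3"
  assumes "i \<noteq> j" "n > 0"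
  shows "Polynomial.smult (v $ i - v $ j) (zprod v ((\<lambda>_. n)(i := n - 1, j := n - 1)))
    = zprod v ((\<lambda>_. n)(i := n - 1)) - zprod v ((\<lambda>_. n)(j := n - 1))"
proof -
  let ?L = "\<lambda>l. [:- (v $ l), 1:]" 
  let ?R = "\<Prod>l\<in>UNIV - {i} - {j}. ?L l ^ n"
  have 1: "zprod v a = ?L i ^ a i * (?L j ^ a j * (\<Prod>l\<in>UNIV - {i} - {j}. ?L l ^ a l))" for a
    unfolding zprod_def using assms by (subst prod.remove[of _ i]; (subst prod.remove[of _ j])?) auto
  have R: "(\<Prod>l\<in>UNIV - {i} - {j}. ?L l ^ a l) = ?R" if "\<And>l. l \<noteq> i \<Longrightarrow> l \<noteq> j \<Longrightarrow> a l = n" for a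
    using that by (intro prod.cong) auto
  obtain m where m: "n = Suc m" using assms(2) by (cases n) auto
  have eqs: "zprod v ((\<lambda>_. n)(i := n - 1, j := n - 1)) = ?L i ^ m * (?L j ^ m * ?R)"
    "zprod v ((\<lambda>_. n)(i := n - 1)) = ?L i ^ m * (?L j ^ n * ?R)"
    "zprod v ((\<lambda>_. n)(j := n - 1)) = ?L i ^ n * (?L j ^ m * ?R)"
    unfolding 1[of "(\<lambda>_. n)(i := n - 1, j := n - 1)"] 1[of "(\<lambda>_. n)(i := n - 1)"] 1[of "(\<lambda>_. n)(j := n - 1)"]
    by (subst R; use assms(1) m in auto)+
  have "Polynomial.smult (v $ i - v $ j) g = (?L j - ?L i) * g" for g by simp
  thus ?thesis unfolding eqs by (simp only: m power_Suc) (simp only: algebra_simps)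
qed

text \<open>
  The off-diagonal part of the KZ equations, satisfied by the gradient of \<open>T_s\<close> with
  \<open>- (p ^ s - 1) / 2\<close> in place of the parameter \<open>1 / 2\<close>, hence modulo \<open>p ^ s\<close> with that parameter.
\<close>

lemma hasse_deriv2_eq:
  fixes v :: "'r::comm_ring_1 ^ 3"
  assumes "i \<noteq> j"
  shows "(v $ i - v $ j) * hasse_deriv2 p s i j v
    = - of_nat ((p ^ s - 1) div 2) * (hasse_deriv p s i v - hasse_deriv p s j v)"
proof (cases "(p ^ s - 1) div 2 = 0")
  case True
  thus ?thesis by (simp add: hasse_deriv2_def)
next
  case False
  let ?n = "(p ^ s - 1) div 2"
  have "(v $ i - v $ j) * poly.coeff (zprod v ((\<lambda>_. ?n)(i := ?n - 1, j := ?n - 1))) (p ^ s - 1)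
      = poly.coeff (Polynomial.smult (v $ i - v $ j) (zprod v ((\<lambda>_. ?n)(i := ?n - 1, j := ?n - 1)))) (p ^ s - 1)"
    by simp
  also have "\<dots> = poly.coeff (zprod v ((\<lambda>_. ?n)(i := ?n - 1))) (p ^ s - 1)
      - poly.coeff (zprod v ((\<lambda>_. ?n)(j := ?n - 1))) (p ^ s - 1)"
    using False by (subst zprod_partial_fractions[OF assms]) auto
  finally have *: "(v $ i - v $ j) * poly.coeff (zprod v ((\<lambda>_. ?n)(i := ?n - 1, j := ?n - 1))) (p ^ s - 1)
      = poly.coeff (zprod v ((\<lambda>_. ?n)(i := ?n - 1))) (p ^ s - 1)
      - poly.coeff (zprod v ((\<lambda>_. ?n)(j := ?n - 1))) (p ^ s - 1)" .
  have "(v $ i - v $ j) * hasse_deriv2 p s i j v = (of_nat ?n)\<^sup>2 *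
     ((v $ i - v $ j) * poly.coeff (zprod v ((\<lambda>_. ?n)(i := ?n - 1, j := ?n - 1))) (p ^ s - 1))"
    by (simp add: hasse_deriv2_def algebra_simps)
  thus ?thesis unfolding * by (simp add: hasse_deriv_def power2_eq_square algebra_simps)
qed

lemma pderiv_zprod:
  fixes v :: "'r::idom ^ 3"
  shows "pderiv (zprod v (\<lambda>_. n)) = Polynomial.smult (of_nat n) (\<Sum>i\<in>UNIV. zprod v ((\<lambda>_. n)(i := n - 1)))"
proof -
  have "pderiv ([:- (v $ i), 1:] ^ n) = Polynomial.smult (of_nat n) ([:- (v $ i), 1:] ^ (n - 1))" for i
    unfolding pderiv_power by (simp add: pderiv_pCons)
  hence "pderiv (zprod v (\<lambda>_. n)) = (\<Sum>i\<in>UNIV. (\<Prod>l\<in>UNIV - {i}. [:- (v $ l), 1:] ^ n)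
      * Polynomial.smult (of_nat n) ([:- (v $ i), 1:] ^ (n - 1)))"
    unfolding zprod_def pderiv_prod by simp
  also have "\<dots> = (\<Sum>i\<in>UNIV. Polynomial.smult (of_nat n) (zprod v ((\<lambda>_. n)(i := n - 1))))"
    by (intro sum.cong refl) (simp add: zprod_upd mult.commute)
  finally show ?thesis by (simp add: smult_sum2)
qed

text \<open>
  The sum of the partial derivatives is minus the coefficient of a \<open>t\<close>-derivative, and the
  coefficient of \<open>t ^ (p ^ s - 1)\<close> in a derivative carries the factor \<open>p ^ s\<close>.
\<close>

lemma sum_hasse_deriv:
  fixes v :: "'r::idom ^ 3"
  assumes "p > 0"
  shows "(\<Sum>i\<in>UNIV. hasse_deriv p s i v)
    = - of_nat (p ^ s) * poly.coeff (zprod v (\<lambda>_. (p ^ s - 1) div 2)) (p ^ s)"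
proof -
  let ?n = "(p ^ s - 1) div 2" and ?N = "p ^ s - 1"
  have "(\<Sum>i\<in>UNIV. hasse_deriv p s i v) = - poly.coeff (pderiv (zprod v (\<lambda>_. ?n))) ?N"
    by (simp add: hasse_deriv_def pderiv_zprod coeff_sum sum_distrib_left sum_negf)
  moreover have "Suc ?N = p ^ s" using assms by simp
  ultimately show ?thesis by (simp only: coeff_pderiv) simp
qed

text \<open>
  Euler's relation: \<open>T_s\<close> is homogeneous of degree \<open>(p ^ s - 1) / 2\<close>. It is read off from
  \<open>z\<^sub>i / (t - z\<^sub>i) = t / (t - z\<^sub>i) - 1\<close>, multiplied by \<open>\<Phi> ^ ((p ^ s - 1) div 2)\<close>.
\<close>

lemma euler_hasse_deriv:
  fixes v :: "'r::idom ^ 3"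
  assumes "odd p"
  shows "(\<Sum>i\<in>UNIV. v $ i * hasse_deriv p s i v) = of_nat ((p ^ s - 1) div 2) * hasse p s v"
proof -
  let ?n = "(p ^ s - 1) div 2" and ?N = "p ^ s - 1"
  let ?\<Psi> = "\<lambda>i. zprod v ((\<lambda>_. ?n)(i := ?n - 1))"
  have N: "?N = 2 * ?n" using assms by simp
  show ?thesis
  proof (cases "?n = 0")
    case True
    thus ?thesis by (simp add: hasse_deriv_def)
  next
    case False
    have \<Psi>: "Polynomial.smult (v $ i) (?\<Psi> i) = pCons 0 (?\<Psi> i) - zprod v (\<lambda>_. ?n)" for i
    proof -
      have "zprod v (\<lambda>_. ?n) = [:- (v $ i), 1:] * ?\<Psi> i"
        unfolding zprod_upd zprod_split[of v "\<lambda>_. ?n" i] mult.assoc[symmetric] power_Suc[symmetric]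
        using False by simp
      thus ?thesis by simp
    qed
    have "(\<Sum>i\<in>UNIV. v $ i * hasse_deriv p s i v)
        = - of_nat ?n * (\<Sum>i\<in>UNIV. poly.coeff (Polynomial.smult (v $ i) (?\<Psi> i)) ?N)"
      by (simp add: hasse_deriv_def sum_distrib_left algebra_simps)
    also have "\<dots> = - poly.coeff (pCons 0 (Polynomial.smult (of_nat ?n) (\<Sum>i\<in>UNIV. ?\<Psi> i))) ?N + 3 * of_nat ?n * hasse p s v"
      unfolding \<Psi> by (simp add: sum_subtractf sum_negf hasse_def coeff_pCons coeff_sum algebra_simps sum_distrib_left split: nat.splits)
    also have "Polynomial.smult (of_nat ?n) (\<Sum>i\<in>UNIV. ?\<Psi> i) = pderiv (zprod v (\<lambda>_. ?n))"
      by (simp add: pderiv_zprod)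
    also have "poly.coeff (pCons 0 (pderiv (zprod v (\<lambda>_. ?n)))) ?N = of_nat ?N * hasse p s v"
      by (auto simp: coeff_pCons coeff_pderiv hasse_def split: nat.splits)
    finally have "(\<Sum>i\<in>UNIV. v $ i * hasse_deriv p s i v)
        = - (of_nat ?N * hasse p s v) + 3 * of_nat ?n * hasse p s v" .
    moreover have "(of_nat ?N :: 'r) = 2 * of_nat ?n"
      by (subst N) simp
    ultimately show ?thesis by (simp add: algebra_simps)
  qed
qed

section \<open>The filtration by powers of $p$\<close>

definition padic_ideal :: "nat \<Rightarrow> 'p::prime_card padic set" where
  "padic_ideal k = {x. padic_abs x \<le> (1 / real CARD('p)) ^ k}"

text \<open>
  Polynomials in an infinitesimal \<open>h\<close> of which only the first-order jet counts: a congruence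
  for \<open>T_s(z + h e\<^sub>i)\<close> in this filtration is a congruence for \<open>T_s\<close> together with its \<open>i\<close>-th derivative.
\<close>

definition jet_ideal :: "nat \<Rightarrow> 'p::prime_card padic poly set" where
  "jet_ideal k = {f. poly.coeff f 0 \<in> padic_ideal k \<and> poly.coeff f 1 \<in> padic_ideal k}"

lemma padic_ideal_0: "x \<in> padic_ideal 0 \<longleftrightarrow> padic_abs x \<le> 1"
  by (simp add: padic_ideal_def)

lemma filtered_ring_padic:
  "filtered_ring CARD('p) (padic_ideal :: nat \<Rightarrow> 'p::prime_card padic set)"
proof
  fix x y :: "'p padic" and j k
  show "x * y \<in> padic_ideal (j + k)" if "x \<in> padic_ideal j" "y \<in> padic_ideal k"
    using that by (auto simp: padic_ideal_def padic_abs_mult power_add padic_abs_nonneg intro!: mult_mono simp del: power_one_over)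
  show "x \<in> padic_ideal k" if "x \<in> padic_ideal (Suc k)"
  proof -
    have "(1 / real CARD('p)) ^ Suc k \<le> (1 / real CARD('p)) ^ k"
      using card_gt_1[where 'p = 'p] by (intro power_decreasing) auto
    thus ?thesis using that unfolding padic_ideal_def by (auto intro: order.trans)
  qed
qed (auto simp: padic_ideal_def padic_abs_card intro: padic_abs_add_le simp del: power_one_over)

lemma coeff_mult_Suc_0:
  "poly.coeff (f * g) (Suc 0) = poly.coeff f 0 * poly.coeff g 1 + poly.coeff f 1 * poly.coeff g 0"
  for f g :: "'a::comm_ring_1 poly"
  by (simp add: coeff_mult)

lemma filtered_ring_jet:
  "filtered_ring CARD('p) (jet_ideal :: nat \<Rightarrow> 'p::prime_card padic poly set)"
proof -
  interpret filtered_ring "CARD('p)" "padic_ideal :: nat \<Rightarrow> 'p padic set"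
    by (rule filtered_ring_padic)
  show ?thesis
  proof
    fix x y :: "'p padic poly" and j k
    show "x * y \<in> jet_ideal (j + k)" if "x \<in> jet_ideal j" "y \<in> jet_ideal k"
      using that by (auto simp: jet_ideal_def coeff_mult_0 coeff_mult_Suc_0 intro!: I_add I_mult)
    show "of_nat CARD('p) \<in> (jet_ideal 1 :: 'p padic poly set)"
      using I_p I_zero by (auto simp: jet_ideal_def of_nat_poly)
  qed (auto simp: jet_ideal_def intro: I_zero I_add I_minus I_Suc I_one)
qed

text \<open>
  With this choice the Taylor expansions proved for filtered rings become plain identities.
\<close>

lemma filtered_ring_trivial: "filtered_ring p (\<lambda>_. UNIV)"
  by standard auto

text \<open>
  If \<open>padic_abs a < 1\<close> then some power of \<open>a\<close> lies in the first ideal; cancelling it would put 1 there.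
\<close>

lemma padic_regular_iff:
  "filtered_ring.regular padic_ideal (a :: 'p::prime_card padic) \<longleftrightarrow> padic_abs a = 1"
proof -
  interpret filtered_ring "CARD('p)" "padic_ideal :: nat \<Rightarrow> 'p padic set"
    by (rule filtered_ring_padic)
  show ?thesis
  proof
    assume r: "regular a"
    hence le: "padic_abs a \<le> 1" by (simp add: regular_def padic_ideal_0)
    show "padic_abs a = 1"
    proof (rule ccontr)
      assume "padic_abs a \<noteq> 1"
      hence "padic_abs a < 1" using le by simp
      then obtain n where "padic_abs a ^ n < 1 / real CARD('p)"
        using real_arch_pow_inv[of "1 / real CARD('p)" "padic_abs a"] card_gt_1[where 'p = 'p] by auto
      hence "a ^ n * 1 \<in> padic_ideal 1" by (simp add: padic_ideal_def padic_abs_power)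
      hence "1 \<in> (padic_ideal 1 :: 'p padic set)"
        using regular_power[OF r, of n] I_one unfolding regular_def by blast
      thus False using card_gt_1[where 'p = 'p] by (simp add: padic_ideal_def)
    qed
  next
    assume "padic_abs a = 1"
    thus "regular a" by (auto simp: regular_def padic_ideal_def padic_abs_mult)
  qed
qed

lemma jet_regularI:
  fixes f :: "'p::prime_card padic poly"
  assumes f: "f \<in> jet_ideal 0" and unit: "padic_abs (poly.coeff f 0) = 1"
  shows "filtered_ring.regular jet_ideal f"
proof -
  interpret P: filtered_ring "CARD('p)" "padic_ideal :: nat \<Rightarrow> 'p padic set"
    by (rule filtered_ring_padic)
  interpret filtered_ring "CARD('p)" "jet_ideal :: nat \<Rightarrow> 'p padic poly set"
    by (rule filtered_ring_jet)
  have "g \<in> jet_ideal k" if "f * g \<in> jet_ideal k" for g k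
  proof -
    have 0: "poly.coeff g 0 \<in> padic_ideal k"
      using that unit by (simp add: jet_ideal_def coeff_mult_0 padic_ideal_def padic_abs_mult)
    have "poly.coeff f 0 * poly.coeff g 1 + poly.coeff f 1 * poly.coeff g 0 \<in> padic_ideal k"
      using that by (simp add: jet_ideal_def coeff_mult_Suc_0)
    moreover have "poly.coeff f 1 * poly.coeff g 0 \<in> padic_ideal k"
      using f 0 by (intro P.I_mult0) (auto simp: jet_ideal_def)
    ultimately have "poly.coeff f 0 * poly.coeff g 1 + poly.coeff f 1 * poly.coeff g 0
        - poly.coeff f 1 * poly.coeff g 0 \<in> padic_ideal k" by (rule P.I_diff)
    hence "poly.coeff f 0 * poly.coeff g 1 \<in> padic_ideal k" by simp
    with 0 unit show ?thesis by (simp add: jet_ideal_def padic_ideal_def padic_abs_mult)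
  qed
  thus ?thesis unfolding regular_def using f by blast
qed

section \<open>First-order jets of the Hasse polynomials\<close>

definition vconst :: "'r::comm_ring_1 ^ 3 \<Rightarrow> 'r poly ^ 3" where
  "vconst z = (\<chi> l. [:z $ l:])"

lemma const_poly_sum: "[:sum f A:] = (\<Sum>x\<in>A. [:f x :: 'r::comm_ring_1:])"
proof (induction A rule: infinite_finite_induct)
  case (insert x A)
  have "[:f x + sum f A:] = [:f x:] + [:sum f A:]" by simp
  thus ?case unfolding sum.insert[OF insert.hyps] insert.IH .
qed auto

lemma coeff_zprod_vconst:
  fixes z :: "'r::comm_ring_1 ^ 3"
  shows "poly.coeff (zprod (vconst z) a) n = [:poly.coeff (zprod z a) n:]"
proof -
  let ?\<phi> = "map_poly (\<lambda>c :: 'r. [:c:])"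
  have mult: "?\<phi> (f * g) = ?\<phi> f * ?\<phi> g" for f g
    by (intro poly_eqI) (simp add: coeff_map_poly coeff_mult const_poly_sum mult.commute)
  have one: "?\<phi> 1 = 1" by (intro poly_eqI) (simp add: coeff_map_poly)
  have pow: "?\<phi> (f ^ n) = ?\<phi> f ^ n" for f n
    by (induction n) (simp_all add: one mult)
  have prod: "?\<phi> (prod F A) = (\<Prod>l\<in>A. ?\<phi> (F l))" for F and A :: "3 set"
    by (induction A rule: infinite_finite_induct) (simp_all add: one mult)
  have lin: "?\<phi> [:- c, 1:] = [:- [:c:], 1:]" for c
    by (intro poly_eqI) (simp add: coeff_map_poly coeff_pCons split: nat.splits)
  have "?\<phi> (zprod z a) = zprod (vconst z) a"
    by (simp add: zprod_def prod pow lin vconst_def)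
  hence "poly.coeff (zprod (vconst z) a) n = poly.coeff (?\<phi> (zprod z a)) n" by simp
  thus ?thesis by (simp add: coeff_map_poly)
qed

text \<open>
  The infinitesimal is a general polynomial \<open>y\<close> without constant term, since the Frobenius lift turns
  \<open>h\<close> into \<open>(z\<^sub>i + h) ^ p - z\<^sub>i ^ p\<close>.
\<close>

lemma hasse_jet:
  fixes z :: "'r::comm_ring_1 ^ 3"
  assumes "poly.coeff y 0 = 0"
  shows "poly.coeff (hasse p s (vconst z + axis i y)) 0 = hasse p s z"
    and "poly.coeff (hasse p s (vconst z + axis i y)) 1 = hasse_deriv p s i z * poly.coeff y 1"
proof -
  interpret filtered_ring p "\<lambda>_. UNIV :: 'r poly set" by (rule filtered_ring_trivial)
  obtain q where q: "hasse p s (vconst z + axis i y)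
      = hasse p s (vconst z) + y * hasse_deriv p s i (vconst z) + y\<^sup>2 * q"
    using hasse_taylor[of "vconst z" y p s i] by auto
  have 0: "hasse p s (vconst z) = [:hasse p s z:]"
    by (simp add: hasse_def coeff_zprod_vconst)
  have 1: "hasse_deriv p s i (vconst z) = [:hasse_deriv p s i z:]"
    by (simp add: hasse_deriv_def coeff_zprod_vconst of_nat_poly)
  show "poly.coeff (hasse p s (vconst z + axis i y)) 0 = hasse p s z"
    unfolding q 0 1 by (simp only: coeff_add coeff_mult_0 coeff_pCons_0 power2_eq_square assms mult_zero_left add_0_right)
  show "poly.coeff (hasse p s (vconst z + axis i y)) 1 = hasse_deriv p s i z * poly.coeff y 1"
    unfolding q 0 1 One_nat_def
    by (simp only: coeff_add coeff_mult_0 coeff_mult_Suc_0 One_nat_def coeff_pCons_0 coeff_pCons_Suc coeff_0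
        power2_eq_square assms mult_zero_left mult_zero_right add_0_right add_0_left mult.commute[of _ "hasse_deriv p s i z"])
qed

lemma coeff_power_Suc_0:
  "poly.coeff (f ^ n) (Suc 0) = of_nat n * poly.coeff f 0 ^ (n - 1) * poly.coeff f 1"
  for f :: "'a::comm_ring_1 poly"
proof (induction n)
  case (Suc n)
  have "poly.coeff f 0 * (of_nat n * poly.coeff f 0 ^ (n - 1) * poly.coeff f 1)
      = of_nat n * poly.coeff f 0 ^ n * poly.coeff f 1"
    by (cases n) (simp_all only: of_nat_0 mult_zero_left mult_zero_right diff_Suc_1 power_Suc ac_simps)
  hence "poly.coeff (f ^ Suc n) (Suc 0) = of_nat n * poly.coeff f 0 ^ n * poly.coeff f 1 + poly.coeff f 1 * poly.coeff f 0 ^ n"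
    unfolding power_Suc coeff_mult_Suc_0 coeff_0_power using Suc by simp
  thus ?case by (simp add: algebra_simps)
qed simp

lemma T_KZ_eq_hasse: "T_KZ s z = hasse CARD('p) s z" for z :: "'p::prime_card padic ^ 3"
proof -
  have prod_3: "prod f (UNIV :: 3 set) = f 1 * f 2 * f 3" for f :: "3 \<Rightarrow> 'p padic poly"
    unfolding UNIV_3 by (simp add: mult.assoc)
  show ?thesis unfolding T_KZ_def hasse_def zprod_def prod_3 power_mult_distrib ..
qed

lemma domain_D_iff:
  "z \<in> domain_D \<longleftrightarrow> (\<forall>l. padic_abs (z $ l) \<le> 1) \<and> padic_abs (hasse CARD('p) 1 z) = 1"
  for z :: "'p::prime_card padic ^ 3"
  by (simp add: domain_D_def padic_integers_def T_KZ_eq_hasse)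

section \<open>The limit $\eta$ and its derivatives\<close>

context
  assumes odd: "odd CARD('p::prime_card)"
begin

lemma filtered_ring_odd_padic: "filtered_ring_odd CARD('p) (padic_ideal :: nat \<Rightarrow> 'p padic set)"
  by (intro filtered_ring_odd.intro filtered_ring_odd_axioms.intro filtered_ring_padic prime_card odd)

lemma filtered_ring_odd_jet: "filtered_ring_odd CARD('p) (jet_ideal :: nat \<Rightarrow> 'p padic poly set)"
  by (intro filtered_ring_odd.intro filtered_ring_odd_axioms.intro filtered_ring_jet prime_card odd)

lemma hasse_unit_twist:
  fixes z :: "'p padic ^ 3"
  assumes "z \<in> domain_D"
  shows "padic_abs (hasse CARD('p) s (vpow z (CARD('p) ^ m))) = 1"
proof -
  interpret filtered_ring_odd "CARD('p)" "padic_ideal :: nat \<Rightarrow> 'p padic set"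
    by (rule filtered_ring_odd_padic)
  show ?thesis
    unfolding padic_regular_iff[symmetric]
    by (rule regular_hasse) (use assms in \<open>auto simp: domain_D_iff padic_ideal_0 padic_regular_iff\<close>)
qed

lemma hasse_unit: "z \<in> domain_D \<Longrightarrow> padic_abs (hasse CARD('p) s z) = 1" for z :: "'p padic ^ 3"
  using hasse_unit_twist[of z s 0] by simp

lemma vpow_domain_D: "z \<in> domain_D \<Longrightarrow> vpow z CARD('p) \<in> domain_D" for z :: "'p padic ^ 3"
  using hasse_unit_twist[of z 1 1]
  by (auto simp: domain_D_iff padic_abs_power padic_abs_nonneg intro: power_le_one)

lemma hasse_deriv_le:
  fixes z :: "'p padic ^ 3"
  assumes "z \<in> domain_D"
  shows "padic_abs (hasse_deriv CARD('p) s i z) \<le> 1" "padic_abs (hasse_deriv2 CARD('p) s i j z) \<le> 1"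
proof -
  interpret filtered_ring "CARD('p)" "padic_ideal :: nat \<Rightarrow> 'p padic set"
    by (rule filtered_ring_padic)
  have "z $ l \<in> padic_ideal 0" for l using assms by (simp add: domain_D_iff padic_ideal_0)
  from hasse_deriv_int[OF this] 
  show "padic_abs (hasse_deriv CARD('p) s i z) \<le> 1" "padic_abs (hasse_deriv2 CARD('p) s i j z) \<le> 1"
    by (simp_all add: padic_ideal_0)
qed

text \<open>
  The logarithmic derivative of the Dwork congruence. Its twisted terms acquire the factor
  \<open>p * z\<^sub>i ^ (p - 1)\<close> from the chain rule for \<open>z \<mapsto> z ^ p\<close>.
\<close>

lemma log_deriv_congruence:
  fixes z :: "'p padic ^ 3" and i :: 3
  assumes z: "z \<in> domain_D"
  defines "L \<equiv> \<lambda>s z. hasse_deriv CARD('p) s i z / hasse CARD('p) s z"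
  shows "padic_abs ((L (Suc (Suc s)) z - L (Suc s) z)
      - of_nat CARD('p) * z $ i ^ (CARD('p) - 1) * (L (Suc s) (vpow z CARD('p)) - L s (vpow z CARD('p))))
      \<le> (1 / real CARD('p)) ^ Suc s"
proof -
  let ?p = "CARD('p)" and ?w = "vpow z CARD('p)"
  interpret filtered_ring_odd "CARD('p)" "jet_ideal :: nat \<Rightarrow> 'p padic poly set"
    by (rule filtered_ring_odd_jet)
  interpret P: filtered_ring "CARD('p)" "padic_ideal :: nat \<Rightarrow> 'p padic set"
    by (rule filtered_ring_padic)
  define X :: "'p padic poly" where "X = [:0, 1:]"
  define v where "v = vconst z + axis i X"
  \<comment> \<open>the infinitesimal displacement of \<open>z ^ p\<close>, with linear coefficient \<open>c\<close>\<close>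
  define y where "y = ([:z $ i:] + X) ^ ?p - [:z $ i ^ ?p:]"
  define c where "c = of_nat ?p * z $ i ^ (?p - 1)"
  have w: "?w \<in> domain_D" by (rule vpow_domain_D[OF z])
  have X: "poly.coeff X 0 = 0" "poly.coeff X 1 = 1" by (auto simp: X_def)
  have y: "poly.coeff y 0 = 0" "poly.coeff y 1 = c"
    by (auto simp: y_def c_def X coeff_0_power coeff_power_Suc_0 X_def)
  have vp: "vpow v ?p = vconst ?w + axis i y"
    by (auto simp: vec_eq_iff v_def vconst_def axis_def y_def poly_const_pow)
  have int: "v $ l \<in> jet_ideal 0" for l
    using z by (auto simp: v_def vconst_def axis_def jet_ideal_def padic_ideal_0 domain_D_iff X
        coeff_pCons X_def)
  have reg: "regular (hasse ?p 1 v)"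
    using z by (intro jet_regularI hasse_int int) (auto simp: v_def hasse_jet(1)[OF X(1)] domain_D_iff)
  define A0 A1 C0 C1 where "A0 = hasse ?p (Suc (Suc s)) z" and "A1 = hasse_deriv ?p (Suc (Suc s)) i z"
    and "C0 = hasse ?p (Suc s) z" and "C1 = hasse_deriv ?p (Suc s) i z"
  define B0 B1 D0 D1 where "B0 = hasse ?p s ?w" and "B1 = hasse_deriv ?p s i ?w"
    and "D0 = hasse ?p (Suc s) ?w" and "D1 = hasse_deriv ?p (Suc s) i ?w"
  note defs = A0_def A1_def B0_def B1_def C0_def C1_def D0_def D1_def
  have u: "padic_abs A0 = 1" "padic_abs B0 = 1" "padic_abs C0 = 1" "padic_abs D0 = 1"
    unfolding defs using z w by (auto intro: hasse_unit)
  hence nz: "A0 \<noteq> 0" "B0 \<noteq> 0" "C0 \<noteq> 0" "D0 \<noteq> 0" by auto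
  have jv: "poly.coeff (hasse ?p r v) 0 = hasse ?p r z" 
      "poly.coeff (hasse ?p r v) (Suc 0) = hasse_deriv ?p r i z" for r
    using hasse_jet[OF X(1), of ?p r z i] X(2) by (simp_all add: v_def)
  have jw: "poly.coeff (hasse ?p r (vpow v ?p)) 0 = hasse ?p r ?w"
      "poly.coeff (hasse ?p r (vpow v ?p)) (Suc 0) = hasse_deriv ?p r i ?w * c" for r
    using hasse_jet[OF y(1), of ?p r ?w i] y(2) by (simp_all add: vp)
  have "hasse ?p (Suc (Suc s)) v * hasse ?p s (vpow v ?p)
      - hasse ?p (Suc s) v * hasse ?p (Suc s) (vpow v ?p) \<in> jet_ideal (Suc s)"
    by (rule dwork_congruence[OF int reg])
  hence e0: "A0 * B0 - C0 * D0 \<in> padic_ideal (Suc s)"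
    and e1: "(A0 * (B1 * c) + A1 * B0) - (C0 * (D1 * c) + C1 * D0) \<in> padic_ideal (Suc s)"
    unfolding jet_ideal_def mem_Collect_eq coeff_diff coeff_mult_0 coeff_mult_Suc_0 One_nat_def jv jw defs
    by auto
  let ?X1 = "A0 * (B1 * c) + A1 * B0" and ?Y1 = "C0 * (D1 * c) + C1 * D0"
  have Y1: "?Y1 \<in> padic_ideal 0"
    using hasse_deriv_le(1)[OF z] hasse_deriv_le(1)[OF w] u z unfolding c_def
    by (intro P.I_add P.I_mult0 P.I_of_nat P.I_power0) (auto simp: padic_ideal_0 defs domain_D_iff)
  have eq: "(A1 / A0 - C1 / C0) - c * (D1 / D0 - B1 / B0)
      = ((?X1 - ?Y1) * (C0 * D0) - ?Y1 * (A0 * B0 - C0 * D0)) / (A0 * B0 * (C0 * D0))"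
    using nz by (simp add: field_simps)
  have "(?X1 - ?Y1) * (C0 * D0) - ?Y1 * (A0 * B0 - C0 * D0) \<in> padic_ideal (Suc s)"
    by (intro P.I_diff P.I_mult0'[OF e1] P.I_mult0[OF Y1 e0]) (simp add: padic_ideal_0 padic_abs_mult u)
  hence "padic_abs ((A1 / A0 - C1 / C0) - c * (D1 / D0 - B1 / B0)) \<le> (1 / real CARD('p)) ^ Suc s"
    unfolding eq by (simp add: padic_abs_divide padic_abs_mult u padic_ideal_def)
  thus ?thesis by (simp add: defs c_def L_def)
qed

text \<open>
  The chain rule factor \<open>p\<close> supplies the power of \<open>p\<close> by which the induction hypothesis, applied at
  the point \<open>z ^ p\<close>, falls short.
\<close>

lemma log_deriv_cauchy:
  fixes z :: "'p padic ^ 3"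
  assumes "z \<in> domain_D"
  shows "padic_abs (hasse_deriv CARD('p) (Suc s) i z / hasse CARD('p) (Suc s) z
      - hasse_deriv CARD('p) s i z / hasse CARD('p) s z) \<le> (1 / real CARD('p)) ^ s"
  using assms
proof (induction s arbitrary: z)
  case 0
  show ?case using 0 hasse_deriv_le(1)[OF 0] hasse_unit[OF 0]
    by (auto intro!: padic_abs_diff_le simp: padic_abs_divide simp del: One_nat_def)
next
  case (Suc s)
  let ?p = "CARD('p)" and ?w = "vpow z CARD('p)"
  let ?l = "\<lambda>s z. hasse_deriv CARD('p) s i z / hasse CARD('p) s z"
  let ?a = "?l (Suc (Suc s)) z - ?l (Suc s) z"
    and ?b = "of_nat ?p * z $ i ^ (?p - 1) * (?l (Suc s) ?w - ?l s ?w)"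
  have "padic_abs (z $ i) ^ (?p - 1) \<le> 1"
    using Suc.prems by (intro power_le_one) (auto simp: domain_D_iff padic_abs_nonneg)
  hence "padic_abs ?b \<le> (1 / real ?p * 1) * (1 / real ?p) ^ s"
    unfolding padic_abs_mult padic_abs_card padic_abs_power
    by (intro mult_mono Suc.IH vpow_domain_D Suc.prems) (auto simp: padic_abs_nonneg)
  hence "padic_abs ((?a - ?b) + ?b) \<le> (1 / real ?p) ^ Suc s"
    using log_deriv_congruence[OF Suc.prems, where i = i and s = s] by (intro padic_abs_add_le) (simp_all add: mult.commute)
  thus ?case by simp
qed

lemma padic_convergent:
  fixes X :: "nat \<Rightarrow> 'p padic"
  assumes "\<And>s. padic_abs (X (Suc s) - X s) \<le> (1 / real CARD('p)) ^ s"
  shows "convergent X"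
proof -
  have tail: "padic_abs (X n - X m) \<le> (1 / real CARD('p)) ^ m" if "n \<ge> m" for m n
    using that
  proof (induction rule: dec_induct)
    case (step n)
    have "padic_abs (X (Suc n) - X n) \<le> (1 / real CARD('p)) ^ m"
      by (rule order.trans[OF assms power_decreasing])
        (use step card_gt_1[where 'p = 'p] in auto)
    from padic_abs_add_le[OF this step.IH] show ?case by simp
  qed simp
  have "Cauchy X"
  proof (rule metric_CauchyI)
    fix e :: real assume "e > 0"
    then obtain M where M: "(1 / real CARD('p)) ^ M < e"
      using real_arch_pow_inv[of e "1 / real CARD('p)"] card_gt_1[where 'p = 'p] by auto
    have "dist (X m) (X n) < e" if "m \<ge> M" "n \<ge> M" for m n
    proof -
      have "padic_abs ((X m - X M) - (X n - X M)) \<le> (1 / real CARD('p)) ^ M"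
        by (intro padic_abs_diff_le tail that)
      thus ?thesis using M by (simp add: dist_padic_def)
    qed
    thus "\<exists>M. \<forall>m\<ge>M. \<forall>n\<ge>M. dist (X m) (X n) < e" by blast
  qed
  thus ?thesis by (rule Cauchy_convergent)
qed

lemma eta_approx_eq:
  fixes z :: "'p padic ^ 3"
  assumes "z \<in> domain_D"
  shows "eta_approx s i z = hasse_deriv CARD('p) s i z / hasse CARD('p) s z"
proof -
  interpret filtered_ring "CARD('p)" "padic_ideal :: nat \<Rightarrow> 'p padic set"
    by (rule filtered_ring_padic)
  have int: "z $ l \<in> padic_ideal 0" for l using assms by (simp add: domain_D_iff padic_ideal_0)
  have "has_partial i (T_KZ s) z (hasse_deriv CARD('p) s i z)"
  proof (rule has_partial_taylor[of 1 _ _ _ _ 1])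
    fix h :: "'p padic" assume "padic_abs h < 1"
    hence "h \<in> padic_ideal 0" by (simp add: padic_ideal_0)
    then obtain q where q: "q \<in> padic_ideal 0" "hasse CARD('p) s (z + axis i h)
        = hasse CARD('p) s z + h * hasse_deriv CARD('p) s i z + h\<^sup>2 * q"
      using hasse_taylor[OF int] by blast
    have "padic_abs (h\<^sup>2 * q) \<le> (padic_abs h)\<^sup>2 * 1"
      using q(1) unfolding padic_abs_mult padic_abs_power
      by (intro mult_mono) (auto simp: padic_ideal_0 padic_abs_nonneg)
    thus "padic_abs (T_KZ s (z + axis i h) - T_KZ s z - h * hasse_deriv CARD('p) s i z) \<le> 1 * (padic_abs h)\<^sup>2"
      by (simp add: T_KZ_eq_hasse q(2))
  qed simp
  thus ?thesis by (simp add: eta_approx_def partial_deriv_eq T_KZ_eq_hasse)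
qed

lemma eta_tendsto:
  fixes z :: "'p padic ^ 3"
  assumes "z \<in> domain_D"
  shows "(\<lambda>s. hasse_deriv CARD('p) s i z / hasse CARD('p) s z) \<longlonglongrightarrow> eta z $ i"
proof -
  have "convergent (\<lambda>s. hasse_deriv CARD('p) s i z / hasse CARD('p) s z)"
    by (intro padic_convergent log_deriv_cauchy assms)
  thus ?thesis
    by (simp add: eta_def eta_approx_eq[OF assms] convergent_LIMSEQ_iff)
qed

text \<open>
  Up to sign this is the parameter of the KZ equations that \<open>T_s\<close> satisfies.
\<close>

lemma half_tendsto:
  "(\<lambda>s. of_nat ((CARD('p) ^ s - 1) div 2) :: 'p padic) \<longlonglongrightarrow> - (1 / 2)"
proof -
  have eq: "(of_nat ((CARD('p) ^ s - 1) div 2) :: 'p padic) = (of_nat CARD('p) ^ s - 1) * inverse 2" for s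
  proof -
    have "CARD('p) ^ s = 2 * ((CARD('p) ^ s - 1) div 2) + 1" using odd by simp
    hence "(of_nat (CARD('p) ^ s) :: 'p padic) = of_nat (2 * ((CARD('p) ^ s - 1) div 2) + 1)" by (rule arg_cong)
    thus ?thesis by (simp add: field_simps)
  qed
  have "(\<lambda>s. (of_nat CARD('p) ^ s - 1) * inverse 2 :: 'p padic) \<longlonglongrightarrow> (0 - 1) * inverse 2"
    by (intro tendsto_intros card_power_tendsto_0)
  moreover have "(0 - 1) * inverse 2 = - (1 / 2 :: 'p padic)" by simp
  ultimately show ?thesis unfolding eq by (simp only:)
qed

lemma sum_eta:
  fixes z :: "'p padic ^ 3"
  assumes z: "z \<in> domain_D"
  shows "(\<Sum>i\<in>UNIV. eta z $ i) = 0"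
proof -
  let ?p = "CARD('p)"
  interpret filtered_ring "CARD('p)" "padic_ideal :: nat \<Rightarrow> 'p padic set"
    by (rule filtered_ring_padic)
  have int: "z $ l \<in> padic_ideal 0" for l using z by (simp add: domain_D_iff padic_ideal_0)
  have "(\<lambda>s. \<Sum>i\<in>UNIV. hasse_deriv ?p s i z / hasse ?p s z) \<longlonglongrightarrow> (\<Sum>i\<in>UNIV. eta z $ i)"
    by (intro tendsto_sum eta_tendsto z)
  moreover have "(\<lambda>s. \<Sum>i\<in>UNIV. hasse_deriv ?p s i z / hasse ?p s z) \<longlonglongrightarrow> 0"
    unfolding tendsto_dist_iff[where l = "0 :: 'p padic"]
  proof (rule Lim_null_comparison[OF always_eventually padic_abs_power_card_tendsto[where 'p = 'p]], rule allI)
    fix s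
    have "padic_abs (poly.coeff (zprod z (\<lambda>_. (?p ^ s - 1) div 2)) (?p ^ s)) \<le> 1"
      using zprod_coeff_int[OF int] by (simp add: padic_ideal_0)
    thus "norm (dist (\<Sum>i\<in>UNIV. hasse_deriv ?p s i z / hasse ?p s z) 0) \<le> (1 / real CARD('p)) ^ s"
      unfolding sum_divide_distrib[symmetric] sum_hasse_deriv[OF zero_less_card_finite]
      by (simp add: dist_padic_def padic_abs_divide padic_abs_mult hasse_unit[OF z] padic_abs_power
          padic_abs_card padic_abs_nonneg divide_right_mono)
  qed
  ultimately show ?thesis by (rule LIMSEQ_unique)
qed

text \<open>
  In particular \<open>eta z\<close> is nonzero, and a vector \<open>x = c *s eta z\<close> determines its coefficient by
  \<open>c = - 2 * (\<Sum>i. z\<^sub>i * x\<^sub>i)\<close>.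
\<close>

lemma euler_eta:
  fixes z :: "'p padic ^ 3"
  assumes z: "z \<in> domain_D"
  shows "(\<Sum>i\<in>UNIV. z $ i * eta z $ i) = - (1 / 2)"
proof -
  let ?p = "CARD('p)"
  have "(\<lambda>s. \<Sum>i\<in>UNIV. z $ i * (hasse_deriv ?p s i z / hasse ?p s z)) \<longlonglongrightarrow> (\<Sum>i\<in>UNIV. z $ i * eta z $ i)"
    by (intro tendsto_sum tendsto_mult tendsto_const eta_tendsto z)
  moreover have "(\<Sum>i\<in>UNIV. z $ i * (hasse_deriv ?p s i z / hasse ?p s z)) = of_nat ((?p ^ s - 1) div 2)" for s
  proof -
    have "hasse ?p s z \<noteq> 0" using hasse_unit[OF z, of s] by auto
    thus ?thesis using euler_hasse_deriv[OF odd, of z s]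
      by (simp add: sum_divide_distrib[symmetric])
  qed
  ultimately show ?thesis using half_tendsto LIMSEQ_unique by simp
qed

text \<open>
  For each \<open>s\<close> the quotient rule holds with an error of at most \<open>|h|\<^sup>2\<close>, uniformly in \<open>s\<close>, because all
  Taylor remainders are integral and \<open>T_s\<close> is a unit at both points. By \<open>hasse_deriv2_eq\<close> the first-order
  coefficient is an expression in the logarithmic derivatives alone, so both sides converge.
\<close>

lemma eta_taylor:
  fixes z :: "'p padic ^ 3"
  assumes z: "z \<in> domain_D" and w: "z + axis i h \<in> domain_D" and h: "padic_abs h \<le> 1"
    and ij: "i \<noteq> j" and zij: "z $ i \<noteq> z $ j"
  shows "padic_abs (eta (z + axis i h) $ j - eta z $ j
      - h * (1 / 2 * (eta z $ i - eta z $ j) / (z $ i - z $ j) - eta z $ i * eta z $ j)) \<le> (padic_abs h)\<^sup>2"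
proof -
  let ?p = "CARD('p)"
  interpret filtered_ring "CARD('p)" "padic_ideal :: nat \<Rightarrow> 'p padic set"
    by (rule filtered_ring_padic)
  have int: "z $ l \<in> padic_ideal 0" for l using z by (simp add: domain_D_iff padic_ideal_0)
  have hI: "h \<in> padic_ideal 0" using h by (simp add: padic_ideal_0)
  let ?e = "\<lambda>s i z. hasse_deriv ?p s i z / hasse ?p s z"
  let ?n = "\<lambda>s. of_nat ((?p ^ s - 1) div 2) :: 'p padic"
  let ?E = "\<lambda>s. - ?n s * (?e s i z - ?e s j z) * inverse (z $ i - z $ j) - ?e s i z * ?e s j z"
  have le: "padic_abs (?e s j (z + axis i h) - ?e s j z - h * ?E s) \<le> (padic_abs h)\<^sup>2" for s
  proof -
    define T T' where "T = hasse ?p s z" and "T' = hasse ?p s (z + axis i h)"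
    define Ii Ij Iij where "Ii = hasse_deriv ?p s i z" and "Ij = hasse_deriv ?p s j z"
      and "Iij = hasse_deriv2 ?p s i j z"
    have u: "padic_abs T = 1" "padic_abs T' = 1" unfolding T_def T'_def by (intro hasse_unit z w)+
    hence nz: "T \<noteq> 0" "T' \<noteq> 0" by auto
    have I: "Ii \<in> padic_ideal 0" "Ij \<in> padic_ideal 0" "Iij \<in> padic_ideal 0" "T \<in> padic_ideal 0" "T' \<in> padic_ideal 0"
      unfolding Ii_def Ij_def Iij_def using hasse_deriv_le[OF z] u by (auto simp: padic_ideal_0)
    obtain q1 where q1: "q1 \<in> padic_ideal 0" "T' = T + h * Ii + h\<^sup>2 * q1"
      unfolding T_def T'_def Ii_def using hasse_taylor[OF int hI] by blast
    obtain q2 where q2: "q2 \<in> padic_ideal 0" "hasse_deriv ?p s j (z + axis i h) = Ij + h * Iij + h\<^sup>2 * q2"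
      unfolding Ij_def Iij_def using hasse_deriv_taylor[OF int hI ij] by blast
    have "(z $ i - z $ j) * Iij = - ?n s * (Ii - Ij)"
      unfolding Iij_def Ii_def Ij_def by (rule hasse_deriv2_eq[OF ij])
    hence "Iij = - ?n s * (Ii - Ij) * inverse (z $ i - z $ j)"
      using zij by (simp add: field_simps)
    hence "?E s = Iij / T - Ii / T * (Ij / T)"
      using nz by (simp add: T_def[symmetric] Ii_def[symmetric] Ij_def[symmetric] diff_divide_distrib[symmetric])
    hence "?e s j (z + axis i h) - ?e s j z - h * ?E s
        = (Ij + h * Iij + h\<^sup>2 * q2) / T' - Ij / T - h * (Iij / T - Ii / T * (Ij / T))"
      by (simp only: q2(2) T_def T'_def Ij_def)
    also have "\<dots> = ((Ij + h * Iij + h\<^sup>2 * q2) * T\<^sup>2 - Ij * T * T' - h * (Iij * T - Ii * Ij) * T') / (T\<^sup>2 * T')"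
      using nz by (simp add: field_simps power2_eq_square)
    also have "(Ij + h * Iij + h\<^sup>2 * q2) * T\<^sup>2 - Ij * T * T' - h * (Iij * T - Ii * Ij) * T'
        = h\<^sup>2 * (q2 * T\<^sup>2 - Ij * T * q1 - (Iij * T - Ii * Ij) * (Ii + h * q1))"
      unfolding q1(2) by (simp add: algebra_simps power2_eq_square)
    finally have eq: "?e s j (z + axis i h) - ?e s j z - h * ?E s
      = h\<^sup>2 * (q2 * T\<^sup>2 - Ij * T * q1 - (Iij * T - Ii * Ij) * (Ii + h * q1)) / (T\<^sup>2 * T')" .
    have "q2 * T\<^sup>2 - Ij * T * q1 - (Iij * T - Ii * Ij) * (Ii + h * q1) \<in> padic_ideal 0"
      by (intro I_diff I_mult0 I_add I_power0 I q1 q2 hI)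
    thus ?thesis unfolding eq
      by (simp add: padic_abs_divide padic_abs_mult padic_abs_power u padic_ideal_0 mult_left_le)
  qed
  have "(\<lambda>s. padic_abs (?e s j (z + axis i h) - ?e s j z - h * ?E s)) \<longlonglongrightarrow>
     padic_abs (eta (z + axis i h) $ j - eta z $ j - h * (- (- (1 / 2)) * (eta z $ i - eta z $ j)
       * inverse (z $ i - z $ j) - eta z $ i * eta z $ j))"
    by (intro tendsto_padic_abs tendsto_diff tendsto_mult tendsto_minus tendsto_const eta_tendsto half_tendsto z w)
  hence "padic_abs (eta (z + axis i h) $ j - eta z $ j - h * (- (- (1 / 2)) * (eta z $ i - eta z $ j)
       * inverse (z $ i - z $ j) - eta z $ i * eta z $ j)) \<le> (padic_abs h)\<^sup>2"
    by (rule LIMSEQ_le_const2) (use le in blast)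
  thus ?thesis by (simp only: divide_inverse minus_minus)
qed

end

section \<open>Unconditional summation\<close>

lemma has_sum_metric_iff:
  fixes f :: "'a \<Rightarrow> 'b::{metric_space, comm_monoid_add}"
  shows "(f has_sum S) UNIV \<longleftrightarrow> (\<forall>e>0. \<exists>X. finite X \<and> (\<forall>Y. finite Y \<and> X \<subseteq> Y \<longrightarrow> dist (sum f Y) S < e))"
  by (simp add: has_sum_def tendsto_iff eventually_finite_subsets_at_top)

text \<open>
  The terms tend to zero along the cofinite filter. In a complete non-archimedean field this is
  equivalent to unconditional summability, and it replaces absolute convergence.
\<close>

definition vanishing :: "('a \<Rightarrow> 'p::prime_card padic) \<Rightarrow> bool" where
  "vanishing f \<longleftrightarrow> (\<forall>e>0. finite {x. padic_abs (f x) \<ge> e})"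

lemma vanishingD: "vanishing f \<Longrightarrow> e > 0 \<Longrightarrow> finite {x. padic_abs (f x) \<ge> e}"
  by (simp add: vanishing_def)

lemma vanishing_bounded:
  assumes "vanishing f" obtains B where "B > 0" "\<And>x. padic_abs (f x) \<le> B"
proof -
  let ?A = "{x. padic_abs (f x) \<ge> 1}"
  have fin: "finite ?A" using assms by (auto intro: vanishingD)
  let ?B = "1 + (\<Sum>x\<in>?A. padic_abs (f x))"
  have nn: "(\<Sum>x\<in>?A. padic_abs (f x)) \<ge> 0" by (intro sum_nonneg padic_abs_nonneg)
  have "padic_abs (f x) \<le> ?B" for x
  proof (cases "x \<in> ?A")
    case True
    hence "padic_abs (f x) \<le> (\<Sum>x\<in>?A. padic_abs (f x))"
      using fin by (intro member_le_sum padic_abs_nonneg) auto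
    thus ?thesis by simp
  next
    case False thus ?thesis using nn by simp
  qed
  moreover have "?B > 0" using nn by simp
  ultimately show ?thesis using that by blast
qed

lemma vanishing_le:
  fixes g :: "'a \<Rightarrow> 'p::prime_card padic" and f :: "'a \<Rightarrow> 'q::prime_card padic"
  assumes "vanishing f" "C > 0" "\<And>x. padic_abs (g x) \<le> C * padic_abs (f x)"
  shows "vanishing g"
  unfolding vanishing_def
proof (intro allI impI)
  fix e :: real assume e: "e > 0"
  have "{x. padic_abs (g x) \<ge> e} \<subseteq> {x. padic_abs (f x) \<ge> e / C}"
    using assms(2,3) by (auto simp: pos_divide_le_eq mult.commute intro: order.trans)
  thus "finite {x. padic_abs (g x) \<ge> e}"
    by (rule finite_subset) (use assms e in \<open>auto intro: vanishingD\<close>)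
qed

lemma vanishing_imp_summable:
  fixes f :: "'a \<Rightarrow> 'p::prime_card padic"
  assumes "vanishing f" shows "f summable_on UNIV"
proof -
  define F where "F n = {x. padic_abs (f x) \<ge> 1 / real (Suc n)}" for n
  have fin: "finite (F n)" for n using assms by (simp add: F_def vanishingD)
  have mono: "F m \<subseteq> F n" if "m \<le> n" for m n
  proof -
    have "1 / real (Suc n) \<le> 1 / real (Suc m)" using that by (intro frac_le) auto
    thus ?thesis unfolding F_def by (auto simp del: of_nat_Suc)
  qed
  have est: "padic_abs (sum f G - sum f (F n)) \<le> 1 / real (Suc n)" if "finite G" "F n \<subseteq> G" for G n
  proof -
    have "sum f G - sum f (F n) = sum f (G - F n)" using that by (simp add: sum_diff)
    thus ?thesis by (auto simp: F_def intro!: padic_abs_sum_le)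
  qed
  have "Cauchy (\<lambda>n. sum f (F n))"
  proof (rule metric_CauchyI)
    fix e :: real assume "e > 0"
    then obtain M where M: "1 / real (Suc M) < e" using nat_approx_posE by blast
    have "dist (sum f (F m)) (sum f (F n)) < e" if "m \<ge> M" "n \<ge> M" for m n
    proof -
      have "padic_abs ((sum f (F m) - sum f (F M)) - (sum f (F n) - sum f (F M))) \<le> 1 / real (Suc M)"
        by (intro padic_abs_diff_le est fin mono that)
      thus ?thesis using M by (simp add: dist_padic_def)
    qed
    thus "\<exists>M. \<forall>m\<ge>M. \<forall>n\<ge>M. dist (sum f (F m)) (sum f (F n)) < e" by blast
  qed
  then obtain S where S: "(\<lambda>n. sum f (F n)) \<longlonglongrightarrow> S"
    using Cauchy_convergent convergent_def by blast
  have "(f has_sum S) UNIV"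
    unfolding has_sum_metric_iff
  proof (intro allI impI)
    fix e :: real assume "e > 0"
    then obtain M where M: "1 / real (Suc M) < e" using nat_approx_posE by blast
    from S have "\<forall>\<^sub>F n in sequentially. dist (sum f (F n)) S < e"
      using \<open>e > 0\<close> by (rule tendstoD)
    then obtain n where n: "n \<ge> M" "dist (sum f (F n)) S < e"
      using eventually_sequentially eventually_conj[OF _ eventually_ge_at_top[of M]]
      by (metis (no_types, lifting) eventually_happens' sequentially_bot)
    have "dist (sum f G) S < e" if "finite G" "F n \<subseteq> G" for G
    proof -
      have "1 / real (Suc n) \<le> 1 / real (Suc M)" using n(1) by (intro frac_le) auto
      hence "padic_abs (sum f G - sum f (F n)) < e" using est[OF that] M by linarith
      moreover have "sum f G - S = (sum f G - sum f (F n)) + (sum f (F n) - S)" by simp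
      ultimately show ?thesis using n(2) padic_abs_ultra[of "sum f G - sum f (F n)" "sum f (F n) - S"]
        by (simp add: dist_padic_def)
    qed
    thus "\<exists>X. finite X \<and> (\<forall>Y. finite Y \<and> X \<subseteq> Y \<longrightarrow> dist (sum f Y) S < e)"
      using fin by blast
  qed
  thus ?thesis by (rule has_sum_imp_summable)
qed

lemma has_sum_imp_vanishing:
  fixes f :: "'a \<Rightarrow> 'p::prime_card padic"
  assumes "(f has_sum S) UNIV" shows "vanishing f"
  unfolding vanishing_def
proof (intro allI impI)
  fix e :: real assume "e > 0"
  hence "\<exists>X. finite X \<and> (\<forall>Y. finite Y \<and> X \<subseteq> Y \<longrightarrow> dist (sum f Y) S < e)"
    using assms unfolding has_sum_metric_iff by simp
  then obtain F where F: "finite F" "\<And>Y. finite Y \<Longrightarrow> F \<subseteq> Y \<Longrightarrow> dist (sum f Y) S < e"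
    by blast
  have "padic_abs (f x) < e" if "x \<notin> F" for x
  proof -
    have "f x = (sum f (insert x F) - S) - (sum f F - S)" using that F(1) by simp
    hence "padic_abs (f x) \<le> max (padic_abs (sum f (insert x F) - S)) (padic_abs (sum f F - S))"
      using padic_abs_ultra_diff by metis
    moreover have "F \<subseteq> insert x F" by blast
    ultimately show ?thesis using F(2)[of F] F(2)[of "insert x F"] F(1) by (simp add: dist_padic_def)
  qed
  hence "{x. padic_abs (f x) \<ge> e} \<subseteq> F" by (auto simp: not_less[symmetric])
  thus "finite {x. padic_abs (f x) \<ge> e}" using F(1) by (rule finite_subset)
qed

lemma has_sum_padic_abs_le:
  fixes f :: "'a \<Rightarrow> 'p::prime_card padic"
  assumes "(f has_sum S) UNIV" "\<And>x. padic_abs (f x) \<le> B" "B \<ge> 0"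
  shows "padic_abs S \<le> B"
proof (rule tendsto_upperbound)
  show "((\<lambda>F. padic_abs (sum f F)) \<longlongrightarrow> padic_abs S) (finite_subsets_at_top UNIV)"
    using assms(1) unfolding has_sum_def by (rule tendsto_padic_abs)
qed (auto intro!: always_eventually padic_abs_sum_le assms)

lemma has_sum_product:
  fixes f :: "'a \<Rightarrow> 'p::prime_card padic" and g :: "'b \<Rightarrow> 'p padic"
  assumes f: "(f has_sum S) UNIV" and g: "(g has_sum T) UNIV"
  shows "((\<lambda>(x, y). f x * g y) has_sum S * T) UNIV"
proof -
  obtain A where A: "A > 0" "\<And>x. padic_abs (f x) \<le> A"
    using vanishing_bounded[OF has_sum_imp_vanishing[OF f]] by blast
  obtain B where B: "B > 0" "\<And>x. padic_abs (g x) \<le> B"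
    using vanishing_bounded[OF has_sum_imp_vanishing[OF g]] by blast
  have "vanishing (\<lambda>(x, y). f x * g y)"
    unfolding vanishing_def
  proof (intro allI impI)
    fix e :: real assume e: "e > 0"
    have "{xy. e \<le> padic_abs (case xy of (x, y) \<Rightarrow> f x * g y)}
        \<subseteq> {x. padic_abs (f x) \<ge> e / B} \<times> {y. padic_abs (g y) \<ge> e / A}"
    proof
      fix w assume w: "w \<in> {xy. e \<le> padic_abs (case xy of (x, y) \<Rightarrow> f x * g y)}"
      obtain x y where xy: "w = (x, y)" by force
      have *: "e \<le> padic_abs (f x * g y)" using w xy by simp
      have "padic_abs (f x) * padic_abs (g y) \<le> padic_abs (f x) * B"
        by (intro mult_left_mono B padic_abs_nonneg)
      moreover have "padic_abs (f x) * padic_abs (g y) \<le> A * padic_abs (g y)"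
        by (intro mult_right_mono A padic_abs_nonneg)
      ultimately show "w \<in> {x. padic_abs (f x) \<ge> e / B} \<times> {y. padic_abs (g y) \<ge> e / A}"
        unfolding xy using * A B by (auto simp: padic_abs_mult pos_divide_le_eq mult.commute)
    qed
    thus "finite {xy. e \<le> padic_abs (case xy of (x, y) \<Rightarrow> f x * g y)}"
      by (rule finite_subset)
        (use e A B in \<open>auto intro!: finite_cartesian_product vanishingD has_sum_imp_vanishing[OF f] has_sum_imp_vanishing[OF g]\<close>)
  qed
  hence sm: "(\<lambda>(x, y). f x * g y) summable_on UNIV \<times> UNIV"
    using vanishing_imp_summable by simp
  have "((\<lambda>(x, y). f x * g y) has_sum S * T) (UNIV \<times> UNIV)"
    by (rule has_sum_SigmaI[OF _ _ sm, of "\<lambda>x. f x * T"])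
      (auto intro: has_sum_cmult_right has_sum_cmult_left f g)
  thus ?thesis by simp
qed

lemma vanishing_geometric:
  fixes f :: "nat \<times> nat \<Rightarrow> 'p::prime_card padic"
  assumes t: "0 \<le> t" "t < 1" and C: "C > 0" and le: "\<And>m n. padic_abs (f (m, n)) \<le> C * t ^ (m + n)"
  shows "vanishing f"
  unfolding vanishing_def
proof (intro allI impI)
  fix e :: real assume "e > 0"
  then obtain N where N: "t ^ N < e / C"
    using real_arch_pow_inv[of "e / C" t] t C by auto
  have "{x. e \<le> padic_abs (f x)} \<subseteq> {..<N} \<times> {..<N}"
  proof
    fix w assume w: "w \<in> {x. e \<le> padic_abs (f x)}"
    obtain m n where mn: "w = (m, n)" by force
    have *: "e \<le> padic_abs (f (m, n))" using w mn by simp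
    have "\<not> m + n \<ge> N"
    proof
      assume "m + n \<ge> N"
      hence "t ^ (m + n) \<le> t ^ N" using t by (intro power_decreasing) auto
      hence "t ^ (m + n) < e / C" using N by linarith
      hence "C * t ^ (m + n) < e" using C by (simp add: pos_less_divide_eq mult.commute)
      thus False using * le[of m n] by linarith
    qed
    thus "w \<in> {..<N} \<times> {..<N}" using mn by auto
  qed
  thus "finite {x. e \<le> padic_abs (f x)}" by (rule finite_subset) simp
qed

section \<open>Analytic functions\<close>

definition vmonom :: "'p::prime_card padic ^ 3 \<Rightarrow> nat ^ 3 \<Rightarrow> 'p padic" where
  "vmonom x k = (\<Prod>i\<in>UNIV. (x $ i) ^ (k $ i))"

text \<open>
  The scalar form of \<^const>\<open>padic_analytic_at\<close>, for which products make sense.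
\<close>

definition analytic_coord :: "('p::prime_card padic ^ 3 \<Rightarrow> 'p padic) \<Rightarrow> 'p padic ^ 3 \<Rightarrow> bool" where
  "analytic_coord f a \<longleftrightarrow> (\<exists>r>0. \<exists>c. \<forall>z. (\<forall>i. dist (z $ i) (a $ i) < r) \<longrightarrow>
     ((\<lambda>k. vmonom (z - a) k * c k) has_sum f z) UNIV)"

lemma analytic_coordI:
  assumes "r > 0" "\<And>z. (\<forall>i. dist (z $ i) (a $ i) < r) \<Longrightarrow> ((\<lambda>k. vmonom (z - a) k * c k) has_sum f z) UNIV"
  shows "analytic_coord f a"
  unfolding analytic_coord_def using assms by blast

lemma has_sum_vec_iff:
  fixes f :: "'a \<Rightarrow> 'p::prime_card padic ^ 3"
  shows "(f has_sum S) A \<longleftrightarrow> (\<forall>l. ((\<lambda>x. f x $ l) has_sum S $ l) A)"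
proof
  assume f: "(f has_sum S) A"
  show "\<forall>l. ((\<lambda>x. f x $ l) has_sum S $ l) A"
  proof
    fix l
    show "((\<lambda>x. f x $ l) has_sum S $ l) A"
      using tendsto_vec_nth[OF f[unfolded has_sum_def], of l] by (simp add: has_sum_def sum_component)
  qed
next
  assume "\<forall>l. ((\<lambda>x. f x $ l) has_sum S $ l) A"
  thus "(f has_sum S) A"
    unfolding has_sum_def by (intro vec_tendstoI) (simp add: sum_component)
qed

lemma padic_analytic_at_iff:
  "padic_analytic_at f a \<longleftrightarrow> (\<forall>l. analytic_coord (\<lambda>z. f z $ l) a)"
proof
  assume "padic_analytic_at f a"
  then obtain r c where r: "r > 0" and c: "\<And>z. (\<forall>i. dist (z $ i) (a $ i) < r) \<Longrightarrow>
      ((\<lambda>k. vmonom (z - a) k *s c k) has_sum f z) UNIV"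
    unfolding padic_analytic_at_def vmonom_def by auto
  show "\<forall>l. analytic_coord (\<lambda>z. f z $ l) a"
  proof
    fix l
    show "analytic_coord (\<lambda>z. f z $ l) a"
    proof (rule analytic_coordI[OF r])
      show "((\<lambda>k. vmonom (z - a) k * c k $ l) has_sum f z $ l) UNIV"
        if "\<forall>i. dist (z $ i) (a $ i) < r" for z
        using c[OF that] unfolding has_sum_vec_iff by simp
    qed
  qed
next
  assume "\<forall>l. analytic_coord (\<lambda>z. f z $ l) a"
  then obtain r c where r: "\<And>l. r l > 0" and c: "\<And>l z. (\<forall>i. dist (z $ i) (a $ i) < r l) \<Longrightarrow>
      ((\<lambda>k. vmonom (z - a) k * c l k) has_sum f z $ l) UNIV"
    unfolding analytic_coord_def by metis
  define R where "R = Min (range r)"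
  have "R > 0" unfolding R_def using r by simp
  moreover have "((\<lambda>k. vmonom (z - a) k *s (\<chi> l. c l k)) has_sum f z) UNIV"
    if "\<forall>i. dist (z $ i) (a $ i) < R" for z
    unfolding has_sum_vec_iff
  proof
    fix l
    have "R \<le> r l" by (simp add: R_def)
    thus "((\<lambda>k. (vmonom (z - a) k *s (\<chi> l. c l k)) $ l) has_sum f z $ l) UNIV"
      using that by (auto intro!: c less_le_trans[of _ R "r l"])
  qed
  ultimately show "padic_analytic_at f a"
    unfolding padic_analytic_at_def vmonom_def
    by (intro exI[of _ R] conjI exI[of _ "\<lambda>k. \<chi> l. c l k"]) auto
qed

lemma analytic_coord_add:
  assumes "analytic_coord f a" "analytic_coord g a"
  shows "analytic_coord (\<lambda>z. f z + g z) a"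
proof -
  obtain r c where r: "r > 0" and c: "\<And>z. (\<forall>i. dist (z $ i) (a $ i) < r) \<Longrightarrow>
      ((\<lambda>k. vmonom (z - a) k * c k) has_sum f z) UNIV" using assms(1) unfolding analytic_coord_def by blast
  obtain r' c' where r': "r' > 0" and c': "\<And>z. (\<forall>i. dist (z $ i) (a $ i) < r') \<Longrightarrow>
      ((\<lambda>k. vmonom (z - a) k * c' k) has_sum g z) UNIV" using assms(2) unfolding analytic_coord_def by blast
  have "((\<lambda>k. vmonom (z - a) k * (c k + c' k)) has_sum f z + g z) UNIV"
    if "\<forall>i. dist (z $ i) (a $ i) < min r r'" for z
    unfolding distrib_left using that by (intro has_sum_add c c') auto
  thus ?thesis using r r' by (intro analytic_coordI[of "min r r'"]) auto
qed

lemma finite_vec_le: "finite {k :: nat ^ 3. \<forall>i. k $ i \<le> n $ i}"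
proof -
  have "($) ` {k :: nat ^ 3. \<forall>i. k $ i \<le> n $ i} \<subseteq> (\<Pi>\<^sub>E i\<in>UNIV. {..n $ i})" by auto
  hence "finite (($) ` {k :: nat ^ 3. \<forall>i. k $ i \<le> n $ i})"
    by (rule finite_subset) (auto intro: finite_PiE)
  thus ?thesis by (rule finite_imageD) (auto simp: inj_on_def vec_eq_iff)
qed

lemma vmonom_add: "vmonom x (k + l) = vmonom x k * vmonom x l"
  by (simp add: vmonom_def power_add prod.distrib)

text \<open>
  The Cauchy product: the double series converges unconditionally and is regrouped by the total
  exponent \<open>n = k + l\<close>.
\<close>

lemma analytic_coord_mult:
  fixes f g :: "'p::prime_card padic ^ 3 \<Rightarrow> 'p padic"
  assumes "analytic_coord f a" "analytic_coord g a"
  shows "analytic_coord (\<lambda>z. f z * g z) a"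
proof -
  obtain r c where r: "r > 0" and c: "\<And>z. (\<forall>i. dist (z $ i) (a $ i) < r) \<Longrightarrow>
      ((\<lambda>k. vmonom (z - a) k * c k) has_sum f z) UNIV" using assms(1) unfolding analytic_coord_def by blast
  obtain r' c' where r': "r' > 0" and c': "\<And>z. (\<forall>i. dist (z $ i) (a $ i) < r') \<Longrightarrow>
      ((\<lambda>k. vmonom (z - a) k * c' k) has_sum g z) UNIV" using assms(2) unfolding analytic_coord_def by blast
  define L where "L n = {k :: nat ^ 3. \<forall>i. k $ i \<le> n $ i}" for n
  define d where "d n = (\<Sum>k\<in>L n. c k * c' (n - k))" for n
  have "((\<lambda>n. vmonom (z - a) n * d n) has_sum f z * g z) UNIV"
    if z: "\<forall>i. dist (z $ i) (a $ i) < min r r'" for z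
  proof (rule has_sum_SigmaD)
    let ?x = "z - a"
    have "((\<lambda>(k, l). vmonom ?x k * c k * (vmonom ?x l * c' l)) has_sum f z * g z) UNIV"
      using z by (intro has_sum_product c c') auto
    also have "?this \<longleftrightarrow> ((\<lambda>(n, k). vmonom ?x n * (c k * c' (n - k))) has_sum f z * g z) (Sigma UNIV L)"
      by (rule has_sum_reindex_bij_witness[of _ "\<lambda>(n, k). (k, n - k)" "\<lambda>(k, l). (k + l, k)"])
        (auto simp: L_def vec_eq_iff vmonom_add algebra_simps)
    finally show "((\<lambda>(n, k). vmonom ?x n * (c k * c' (n - k))) has_sum f z * g z) (Sigma UNIV L)" .
    show "((\<lambda>y. case (n, y) of (n, k) \<Rightarrow> vmonom ?x n * (c k * c' (n - k))) has_sum vmonom ?x n * d n) (L n)" for n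
      using finite_vec_le[of n] by (auto simp: d_def sum_distrib_left L_def intro!: has_sum_finiteI)
  qed
  thus ?thesis using r r' by (intro analytic_coordI[of "min r r'"]) auto
qed

lemma analytic_coord_const: "analytic_coord (\<lambda>_. C) a"
proof -
  have "((\<lambda>k. vmonom x k * (if k = 0 then C else 0)) has_sum C) UNIV" for x :: "'a padic ^ 3"
  proof -
    have "((\<lambda>k. vmonom x k * (if k = 0 then C else 0)) has_sum C) {0}"
      by (intro has_sum_finiteI) (auto simp: vmonom_def)
    thus ?thesis by (rule has_sum_cong_neutral[THEN iffD1, rotated -1]) auto
  qed
  thus ?thesis by (intro analytic_coordI[of 1]) auto
qed

lemma analytic_coord_cmult: "analytic_coord f a \<Longrightarrow> analytic_coord (\<lambda>z. C * f z) a"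
  by (intro analytic_coord_mult analytic_coord_const)

lemma analytic_coord_diff:
  assumes "analytic_coord f a" "analytic_coord g a"
  shows "analytic_coord (\<lambda>z. f z - g z) a"
  using analytic_coord_add[OF assms(1) analytic_coord_cmult[OF assms(2), of "-1"]] by simp

lemma analytic_coord_sum:
  assumes "\<And>l. l \<in> A \<Longrightarrow> analytic_coord (f l) a"
  shows "analytic_coord (\<lambda>z. \<Sum>l\<in>A. f l z) a"
  using assms
  by (induction A rule: infinite_finite_induct) (auto intro: analytic_coord_const analytic_coord_add)

section \<open>Differentiation of power series\<close>

definition vdeg :: "nat ^ 3 \<Rightarrow> nat" where
  "vdeg k = (\<Sum>i\<in>UNIV. k $ i)"

lemma padic_abs_vmonom_le:
  assumes "\<And>i. padic_abs (x $ i) \<le> \<rho>"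
  shows "padic_abs (vmonom x k) \<le> \<rho> ^ vdeg k"
  unfolding vmonom_def vdeg_def padic_abs_prod padic_abs_power power_sum
  by (intro prod_mono conjI power_mono assms zero_le_power padic_abs_nonneg)

text \<open>
  The radius is shrunk to the absolute value of some \<open>\<pi>\<close> in the field, so that the series can be evaluated
  at the corner \<open>a + (\<pi>, \<pi>, \<pi>)\<close> of the polydisc. Its convergence there bounds all coefficients.
\<close>

lemma analytic_coord_coefficients:
  fixes f :: "'p::prime_card padic ^ 3 \<Rightarrow> 'p padic"
  assumes "analytic_coord f a"
  obtains \<pi> c where "padic_abs \<pi> > 0" "vanishing (\<lambda>k. \<pi> ^ vdeg k * c k)"
    "\<And>z. (\<forall>i. dist (z $ i) (a $ i) < padic_abs \<pi>) \<Longrightarrow> ((\<lambda>k. vmonom (z - a) k * c k) has_sum f z) UNIV"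
proof -
  obtain r c where r: "r > 0" and c: "\<And>z. (\<forall>i. dist (z $ i) (a $ i) < r) \<Longrightarrow>
      ((\<lambda>k. vmonom (z - a) k * c k) has_sum f z) UNIV" using assms unfolding analytic_coord_def by blast
  obtain M where M: "(1 / real CARD('p)) ^ M < r"
    using real_arch_pow_inv[OF r, of "1 / real CARD('p)"] card_gt_1[where 'p = 'p] by auto
  define \<pi> where "\<pi> = (of_nat CARD('p) ^ M :: 'p padic)"
  have \<pi>: "padic_abs \<pi> < r" "padic_abs \<pi> > 0"
    using M card_gt_1[where 'p = 'p] by (auto simp: \<pi>_def padic_abs_power padic_abs_card)
  have "((\<lambda>k. vmonom ((a + (\<chi> l. \<pi>)) - a) k * c k) has_sum f (a + (\<chi> l. \<pi>))) UNIV"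
    by (rule c) (simp add: dist_padic_def \<pi>)
  moreover have "vmonom ((a + (\<chi> l. \<pi>)) - a) k = \<pi> ^ vdeg k" for k
    by (simp add: vmonom_def vdeg_def power_sum)
  ultimately have "vanishing (\<lambda>k. \<pi> ^ vdeg k * c k)"
    using has_sum_imp_vanishing by simp
  moreover have "((\<lambda>k. vmonom (z - a) k * c k) has_sum f z) UNIV"
    if "\<forall>i. dist (z $ i) (a $ i) < padic_abs \<pi>" for z
    using that \<pi>(1) by (intro c) (auto intro: less_trans)
  ultimately show ?thesis using that \<pi>(2) by blast
qed

text \<open>
  Rescaling by \<open>\<pi>\<close> reduces the estimate to the unit ball, where the Taylor remainder is integral.
\<close>

lemma power_taylor_scaled:
  fixes u h \<pi> :: "'p::prime_card padic"
  assumes \<pi>: "padic_abs \<pi> > 0" and u: "padic_abs u \<le> padic_abs \<pi>" and h: "padic_abs h \<le> padic_abs \<pi>"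
  shows "padic_abs ((u + h) ^ n - u ^ n - h * (of_nat n * u ^ (n - 1)))
    \<le> (padic_abs h / padic_abs \<pi>)\<^sup>2 * padic_abs \<pi> ^ n"
proof -
  interpret filtered_ring "CARD('p)" "padic_ideal :: nat \<Rightarrow> 'p padic set"
    by (rule filtered_ring_padic)
  have \<pi>0: "\<pi> \<noteq> 0" using \<pi> by auto
  define u' h' where "u' = u / \<pi>" and "h' = h / \<pi>"
  have uh: "u = \<pi> * u'" "h = \<pi> * h'" using \<pi>0 by (auto simp: u'_def h'_def)
  have "u' \<in> padic_ideal 0" "h' \<in> padic_ideal 0"
    using u h \<pi> by (auto simp: u'_def h'_def padic_ideal_0 padic_abs_divide)
  from taylor_power[OF this, of n] obtain q where q: "q \<in> padic_ideal 0"
    "(u' + h') ^ n = u' ^ n + of_nat n * u' ^ (n - 1) * h' + h'\<^sup>2 * q" by blast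
  have 1: "h * (of_nat n * u ^ (n - 1)) = \<pi> ^ n * (of_nat n * u' ^ (n - 1) * h')"
    unfolding uh by (cases n) (auto simp: power_mult_distrib algebra_simps)
  have 2: "(u + h) ^ n = \<pi> ^ n * (u' + h') ^ n" "u ^ n = \<pi> ^ n * u' ^ n"
    unfolding uh by (simp_all add: power_mult_distrib flip: distrib_left)
  have "(u + h) ^ n - u ^ n - h * (of_nat n * u ^ (n - 1)) = \<pi> ^ n * (h'\<^sup>2 * q)"
    unfolding 1 2 q(2) by (simp add: algebra_simps)
  hence "padic_abs ((u + h) ^ n - u ^ n - h * (of_nat n * u ^ (n - 1)))
      = padic_abs \<pi> ^ n * ((padic_abs h / padic_abs \<pi>)\<^sup>2 * padic_abs q)"
    by (simp add: padic_abs_mult padic_abs_power h'_def padic_abs_divide)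
  also have "\<dots> \<le> padic_abs \<pi> ^ n * ((padic_abs h / padic_abs \<pi>)\<^sup>2 * 1)"
    using q(1) \<pi> by (intro mult_left_mono) (auto simp: padic_ideal_0)
  finally show ?thesis by (simp add: mult.commute)
qed

lemma vmonom_split: "vmonom x k = x $ i ^ (k $ i) * (\<Prod>l\<in>UNIV - {i}. x $ l ^ (k $ l))"
  unfolding vmonom_def by (rule prod.remove) auto

lemma vdeg_split: "vdeg k = k $ i + (\<Sum>l\<in>UNIV - {i}. k $ l)"
  unfolding vdeg_def by (rule sum.remove) auto

definition vmonom_deriv :: "3 \<Rightarrow> 'p::prime_card padic ^ 3 \<Rightarrow> nat ^ 3 \<Rightarrow> 'p padic" where
  "vmonom_deriv i x k = of_nat (k $ i) * vmonom x (k - axis i 1)"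

lemma vmonom_taylor:
  fixes x :: "'p::prime_card padic ^ 3" and \<pi> h :: "'p padic"
  assumes \<pi>: "padic_abs \<pi> > 0" and x: "\<And>l. padic_abs (x $ l) \<le> padic_abs \<pi>" and h: "padic_abs h \<le> padic_abs \<pi>"
  shows "padic_abs (vmonom (x + axis i h) k - vmonom x k - h * vmonom_deriv i x k)
    \<le> (padic_abs h / padic_abs \<pi>)\<^sup>2 * padic_abs \<pi> ^ vdeg k"
proof -
  let ?R = "\<Prod>l\<in>UNIV - {i}. x $ l ^ (k $ l)"
  have "(\<Prod>l\<in>UNIV - {i}. (x + axis i h) $ l ^ (k $ l)) = ?R"
    by (rule prod.cong) (auto simp: axis_def)
  hence 1: "vmonom (x + axis i h) k = (x $ i + h) ^ (k $ i) * ?R"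
    unfolding vmonom_split[of "x + axis i h" k i] by (simp add: axis_def)
  have "(\<Prod>l\<in>UNIV - {i}. x $ l ^ ((k - axis i 1) $ l)) = ?R"
    by (rule prod.cong) (auto simp: axis_def)
  hence 2: "vmonom_deriv i x k = (of_nat (k $ i) * x $ i ^ (k $ i - 1)) * ?R"
    unfolding vmonom_deriv_def vmonom_split[of x "k - axis i 1" i] by (simp add: axis_def)
  have "vmonom (x + axis i h) k - vmonom x k - h * vmonom_deriv i x k
      = ((x $ i + h) ^ (k $ i) - x $ i ^ (k $ i) - h * (of_nat (k $ i) * x $ i ^ (k $ i - 1))) * ?R"
    unfolding 1 2 vmonom_split[of x k i] by (simp add: algebra_simps)
  also have "padic_abs \<dots> \<le> ((padic_abs h / padic_abs \<pi>)\<^sup>2 * padic_abs \<pi> ^ (k $ i)) *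
      padic_abs \<pi> ^ (\<Sum>l\<in>UNIV - {i}. k $ l)"
    unfolding padic_abs_mult
  proof (rule mult_mono)
    show "padic_abs ?R \<le> padic_abs \<pi> ^ (\<Sum>l\<in>UNIV - {i}. k $ l)"
      unfolding padic_abs_prod padic_abs_power power_sum
      by (intro prod_mono conjI power_mono x zero_le_power padic_abs_nonneg)
    show "padic_abs ((x $ i + h) ^ (k $ i) - x $ i ^ (k $ i) - h * (of_nat (k $ i) * x $ i ^ (k $ i - 1)))
        \<le> (padic_abs h / padic_abs \<pi>)\<^sup>2 * padic_abs \<pi> ^ (k $ i)"
      by (rule power_taylor_scaled[OF \<pi> x h])
  qed (simp_all add: padic_abs_nonneg)
  finally show ?thesis unfolding vdeg_split[of k i] by (simp add: power_add mult.assoc)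
qed

text \<open>
  Termwise differentiation. The remainder of the difference quotient is estimated term by term with
  \<open>vmonom_taylor\<close>, and by the ultrametric inequality the sum obeys the same bound. The formula for the
  derivative holds at every point of one polydisc, which makes the derivative analytic.
\<close>

lemma analytic_coord_partial:
  fixes f :: "'p::prime_card padic ^ 3 \<Rightarrow> 'p padic"
  assumes "analytic_coord f a"
  shows "has_partial i f a (partial_deriv i f a)" and "analytic_coord (partial_deriv i f) a"
proof -
  obtain \<pi> c where \<pi>: "padic_abs \<pi> > 0" and van: "vanishing (\<lambda>k. \<pi> ^ vdeg k * c k)"
    and c: "\<And>z. (\<forall>i. dist (z $ i) (a $ i) < padic_abs \<pi>) \<Longrightarrow> ((\<lambda>k. vmonom (z - a) k * c k) has_sum f z) UNIV"
    using analytic_coord_coefficients[OF assms] by blast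
  obtain B where B: "B > 0" "\<And>k. padic_abs (\<pi> ^ vdeg k * c k) \<le> B"
    using vanishing_bounded[OF van] by blast
  have B': "padic_abs \<pi> ^ vdeg k * padic_abs (c k) \<le> B" for k
    using B(2)[of k] by (simp add: padic_abs_mult padic_abs_power)
  define d where "d m = of_nat (m $ i + 1) * c (m + axis i 1)" for m
  have deriv: "\<exists>D. has_partial i f z D \<and> ((\<lambda>m. vmonom (z - a) m * d m) has_sum D) UNIV"
    if z: "\<forall>l. dist (z $ l) (a $ l) < padic_abs \<pi>" for z
  proof -
    let ?x = "z - a"
    have x: "padic_abs (?x $ l) \<le> padic_abs \<pi>" for l
      using z by (simp add: dist_padic_def less_imp_le)
    let ?g = "\<lambda>k. vmonom_deriv i ?x k * c k"
    have shift: "?g (m + axis i 1) = vmonom ?x m * d m" for m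
      by (simp add: vmonom_deriv_def d_def axis_def mult.commute mult.left_commute)
    have inj: "inj (\<lambda>m :: nat ^ 3. m + axis i 1)" by (simp add: inj_on_def)
    have "vanishing (\<lambda>m. \<pi> ^ vdeg (m + axis i 1) * c (m + axis i 1))"
      unfolding vanishing_def
    proof (intro allI impI)
      fix e :: real assume "e > 0"
      hence "finite ((\<lambda>m. m + axis i 1) -` {k. padic_abs (\<pi> ^ vdeg k * c k) \<ge> e})"
        by (intro finite_vimageI vanishingD[OF van] inj)
      thus "finite {m. padic_abs (\<pi> ^ vdeg (m + axis i 1) * c (m + axis i 1)) \<ge> e}"
        by (simp add: vimage_def)
    qed
    hence "vanishing (\<lambda>m. vmonom ?x m * d m)"
    proof (rule vanishing_le[where C = "1 / padic_abs \<pi>"])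
      fix m
      have deg: "vdeg (m + axis i 1) = Suc (vdeg m)"
        by (simp add: vdeg_def sum.distrib axis_def)
      have "padic_abs (d m) \<le> 1 * padic_abs (c (m + axis i 1))"
        unfolding d_def padic_abs_mult by (intro mult_right_mono padic_abs_of_nat_le padic_abs_nonneg)
      hence "padic_abs (vmonom ?x m * d m) \<le> padic_abs \<pi> ^ vdeg m * padic_abs (c (m + axis i 1))"
        unfolding padic_abs_mult by (intro mult_mono padic_abs_vmonom_le x) (auto simp: padic_abs_nonneg)
      thus "padic_abs (vmonom ?x m * d m) \<le> 1 / padic_abs \<pi> * padic_abs (\<pi> ^ vdeg (m + axis i 1) * c (m + axis i 1))"
        unfolding padic_abs_mult padic_abs_power deg using \<pi> by (cases "\<pi> = 0") simp_all
    qed (use \<pi> in simp)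
    then obtain D where D: "((\<lambda>m. vmonom ?x m * d m) has_sum D) UNIV"
      using vanishing_imp_summable summable_on_def by blast
    hence "(?g has_sum D) (range (\<lambda>m. m + axis i 1))"
      unfolding has_sum_reindex[OF inj] o_def shift .
    hence g: "(?g has_sum D) UNIV"
    proof (rule has_sum_cong_neutral[THEN iffD1, rotated -1])
      fix k :: "nat ^ 3" assume k: "k \<in> UNIV - range (\<lambda>m. m + axis i 1)"
      have "k $ i = 0"
      proof (rule ccontr)
        assume "k $ i \<noteq> 0"
        hence "k = (k - axis i 1) + axis i 1" by (auto simp: vec_eq_iff axis_def)
        thus False using k by blast
      qed
      thus "?g k = 0" by (simp add: vmonom_deriv_def)
    qed auto
    have "has_partial i f z D"
    proof (rule has_partial_taylor[OF \<pi>, of _ _ _ _ "B / (padic_abs \<pi>)\<^sup>2"])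
      fix h :: "'p padic" assume h: "padic_abs h < padic_abs \<pi>"
      have zh: "\<forall>l. dist ((z + axis i h) $ l) (a $ l) < padic_abs \<pi>"
      proof
        fix l
        have "(z + axis i h) $ l - a $ l = (z $ l - a $ l) + (if l = i then h else 0)"
          by (simp add: axis_def)
        hence "dist ((z + axis i h) $ l) (a $ l)
            \<le> max (padic_abs (z $ l - a $ l)) (padic_abs (if l = i then h else 0))"
          unfolding dist_padic_def by (simp only: padic_abs_ultra)
        also have "\<dots> < padic_abs \<pi>" using h \<pi> z by (simp add: dist_padic_def)
        finally show "dist ((z + axis i h) $ l) (a $ l) < padic_abs \<pi>" .
      qed
      have xh: "z + axis i h - a = ?x + axis i h" by simp
      have "((\<lambda>k. (vmonom (?x + axis i h) k * c k + - (vmonom ?x k * c k)) + - (h * ?g k))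
          has_sum (f (z + axis i h) + - f z) + - (h * D)) UNIV"
        using c[OF zh] c[OF z] g unfolding xh
        by (intro has_sum_add has_sum_cmult_right) (auto simp: has_sum_uminus intro!: has_sum_cmult_right)
      hence "padic_abs ((f (z + axis i h) + - f z) + - (h * D)) \<le> B / (padic_abs \<pi>)\<^sup>2 * (padic_abs h)\<^sup>2"
      proof (rule has_sum_padic_abs_le)
        fix k
        have "(vmonom (?x + axis i h) k * c k + - (vmonom ?x k * c k)) + - (h * ?g k)
            = (vmonom (?x + axis i h) k - vmonom ?x k - h * vmonom_deriv i ?x k) * c k"
          by (simp add: algebra_simps)
        also have "padic_abs \<dots> \<le> ((padic_abs h / padic_abs \<pi>)\<^sup>2 * padic_abs \<pi> ^ vdeg k) * padic_abs (c k)"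
          unfolding padic_abs_mult
          by (intro mult_right_mono vmonom_taylor \<pi> x less_imp_le[OF h] padic_abs_nonneg)
        also have "\<dots> = (padic_abs h / padic_abs \<pi>)\<^sup>2 * (padic_abs \<pi> ^ vdeg k * padic_abs (c k))" by simp
        also have "\<dots> \<le> (padic_abs h / padic_abs \<pi>)\<^sup>2 * B"
          by (intro mult_left_mono B') auto
        finally show "padic_abs ((vmonom (?x + axis i h) k * c k + - (vmonom ?x k * c k)) + - (h * ?g k))
            \<le> B / (padic_abs \<pi>)\<^sup>2 * (padic_abs h)\<^sup>2" by (simp add: power_divide mult.commute)
      qed (use B(1) in simp)
      thus "padic_abs (f (z + axis i h) - f z - h * D) \<le> B / (padic_abs \<pi>)\<^sup>2 * (padic_abs h)\<^sup>2" by simp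
    qed
    with D show ?thesis by blast
  qed
  show "has_partial i f a (partial_deriv i f a)"
    using deriv[of a] \<pi> partial_deriv_eq by fastforce
  show "analytic_coord (partial_deriv i f) a"
  proof (rule analytic_coordI[OF \<pi>])
    show "((\<lambda>k. vmonom (z - a) k * d k) has_sum partial_deriv i f z) UNIV"
      if "\<forall>i. dist (z $ i) (a $ i) < padic_abs \<pi>" for z
      using deriv[OF that] partial_deriv_eq by blast
  qed
qed

section \<open>Analyticity of the coefficients of the connection\<close>

lemma has_sum_geometric:
  fixes w :: "'p::prime_card padic"
  assumes "padic_abs w < 1" "((\<lambda>n. w ^ n) has_sum S) UNIV"
  shows "S * (1 - w) = 1"
proof -
  have "(\<lambda>n. padic_abs w ^ n) \<longlonglongrightarrow> 0" using assms(1) padic_abs_nonneg by (intro LIMSEQ_realpow_zero)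
  hence w: "(\<lambda>n. w ^ n) \<longlonglongrightarrow> 0" by (subst tendsto_dist_iff) (simp add: dist_padic_def padic_abs_power)
  have "(\<lambda>n. (\<Sum>k<n. w ^ k) * (1 - w)) \<longlonglongrightarrow> S * (1 - w)"
    using has_sum_imp_sums[OF assms(2)] unfolding sums_def by (intro tendsto_intros)
  moreover have "(\<Sum>k<n. w ^ k) * (1 - w) = 1 - w ^ n" for n
  proof (induction n)
    case (Suc n)
    have "(\<Sum>k<Suc n. w ^ k) * (1 - w) = (\<Sum>k<n. w ^ k) * (1 - w) + w ^ n * (1 - w)"
      by (simp only: sum.lessThan_Suc distrib_right)
    also have "\<dots> = 1 - w ^ Suc n" unfolding Suc by (simp add: algebra_simps)
    finally show ?case .
  qed simp
  moreover have "(\<lambda>n. 1 - w ^ n) \<longlonglongrightarrow> 1 - 0" by (intro tendsto_intros w)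
  ultimately show ?thesis using LIMSEQ_unique by fastforce
qed

text \<open>
  The geometric series in \<open>(y - x) / d\<close>, with its powers expanded into monomials.
\<close>

lemma has_sum_inverse_difference:
  fixes x y d :: "'p::prime_card padic"
  assumes d: "d \<noteq> 0" and x: "padic_abs x < padic_abs d" and y: "padic_abs y < padic_abs d"
  shows "((\<lambda>(m, n). x ^ m * y ^ n * ((-1) ^ m * of_nat ((m + n) choose m) / d ^ Suc (m + n)))
    has_sum 1 / (d + x - y)) UNIV"
proof -
  let ?f = "\<lambda>(m, n). x ^ m * y ^ n * ((-1) ^ m * of_nat ((m + n) choose m) / d ^ Suc (m + n))"
  define t where "t = max (padic_abs x) (padic_abs y) / padic_abs d"
  have dpos: "padic_abs d > 0" using d padic_abs_nonneg[of d] by (simp add: order_less_le)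
  have t: "0 \<le> t" "t < 1" using x y dpos padic_abs_nonneg[of x] by (auto simp: t_def le_max_iff_disj)
  have "vanishing ?f"
  proof (rule vanishing_geometric[OF t, of "1 / padic_abs d"])
    fix m n
    have "padic_abs (?f (m, n)) = padic_abs x ^ m * padic_abs y ^ n * (padic_abs (of_nat ((m + n) choose m) :: 'p padic)
        / padic_abs d ^ Suc (m + n))"
      by (simp add: padic_abs_mult padic_abs_power padic_abs_divide del: power_Suc)
    also have "\<dots> \<le> max (padic_abs x) (padic_abs y) ^ m * max (padic_abs x) (padic_abs y) ^ n * (1 / padic_abs d ^ Suc (m + n))"
      by (intro mult_mono power_mono divide_right_mono padic_abs_of_nat_le)
        (auto simp: padic_abs_nonneg le_max_iff_disj)
    also have "\<dots> = 1 / padic_abs d * t ^ (m + n)"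
      by (simp add: t_def power_divide power_add)
    finally show "padic_abs (?f (m, n)) \<le> 1 / padic_abs d * t ^ (m + n)" .
  qed (use dpos in simp)
  then obtain S where S: "(?f has_sum S) UNIV"
    using vanishing_imp_summable summable_on_def by blast
  define w where "w = (y - x) / d"
  have "(?f has_sum S) UNIV \<longleftrightarrow> ((\<lambda>(N, m). x ^ m * y ^ (N - m) * ((-1) ^ m * of_nat (N choose m) / d ^ Suc N)) has_sum S) (Sigma UNIV (\<lambda>N. {..N}))"
    by (rule has_sum_reindex_bij_witness[of _ "\<lambda>(N, m). (m, N - m)" "\<lambda>(m, n). (m + n, m)"]) auto
  hence "((\<lambda>(N, m). x ^ m * y ^ (N - m) * ((-1) ^ m * of_nat (N choose m) / d ^ Suc N)) has_sum S) (Sigma UNIV (\<lambda>N. {..N}))"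
    using S by blast
  hence "((\<lambda>N. 1 / d * w ^ N) has_sum S) UNIV"
  proof (rule has_sum_SigmaD)
    fix N
    have "1 / d * w ^ N = ((- x) + y) ^ N / d ^ Suc N"
      by (simp add: w_def power_divide)
    also have "\<dots> = (\<Sum>m\<le>N. x ^ m * y ^ (N - m) * ((-1) ^ m * of_nat (N choose m) / d ^ Suc N))"
      unfolding binomial_ring sum_divide_distrib
      by (intro sum.cong refl) (simp add: power_minus[of x] mult_ac)
    finally show "((\<lambda>m. case (N, m) of (N, m) \<Rightarrow> x ^ m * y ^ (N - m) * ((-1) ^ m * of_nat (N choose m) / d ^ Suc N))
        has_sum 1 / d * w ^ N) {..N}"
      by (intro has_sum_finiteI) auto
  qed
  from has_sum_cmult_right[OF this, of d] have "((\<lambda>N. w ^ N) has_sum d * S) UNIV" using d by simp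
  moreover have "padic_abs (y - x) < padic_abs d"
    using padic_abs_ultra_diff[of y x] x y by (metis le_less_trans max_less_iff_conj)
  hence "padic_abs w < 1"
    using dpos by (simp add: w_def padic_abs_divide)
  ultimately have "d * S * (1 - w) = 1" by (intro has_sum_geometric)
  moreover have "d * (1 - w) = d + x - y" using d by (simp add: w_def field_simps)
  ultimately have "S * (d + x - y) = 1" by (metis mult.assoc mult.commute)
  hence "S = 1 / (d + x - y)" by (metis mult_zero_right nonzero_eq_divide_eq zero_neq_one)
  thus ?thesis using S by simp
qed

lemma analytic_coord_inverse_difference:
  fixes a :: "'p::prime_card padic ^ 3"
  assumes ij: "a $ i \<noteq> a $ j"
  shows "analytic_coord (\<lambda>z. 1 / (z $ i - z $ j)) a"
proof -
  have "i \<noteq> j" using ij by auto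
  define d where "d = a $ i - a $ j"
  define e where "e = (\<lambda>(m, n). axis i m + axis j n :: nat ^ 3)"
  define c where "c k = (if k \<in> range e then (-1) ^ (k $ i) * of_nat ((k $ i + k $ j) choose (k $ i)) / d ^ Suc (k $ i + k $ j) else 0)" for k
  have d: "d \<noteq> 0" using ij by (simp add: d_def)
  have comp: "e (m, n) $ i = m" "e (m, n) $ j = n" for m n
    using \<open>i \<noteq> j\<close> by (auto simp: e_def axis_def)
  have inj: "inj e" by (rule injI) (metis comp surj_pair)
  have mon: "vmonom x (e (m, n)) = x $ i ^ m * x $ j ^ n" for x :: "'p padic ^ 3" and m n
  proof -
    have "vmonom x (axis l m) = x $ l ^ m" for l m
      unfolding vmonom_split[of x "axis l m" l] by (simp add: axis_def prod.neutral)
    thus ?thesis by (simp add: e_def vmonom_add)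
  qed
  show ?thesis
  proof (rule analytic_coordI)
    show "padic_abs d > 0" using d padic_abs_nonneg[of d] by (simp add: order_less_le)
    fix z assume z: "\<forall>l. dist (z $ l) (a $ l) < padic_abs d"
    have "((\<lambda>(m, n). (z - a) $ i ^ m * (z - a) $ j ^ n * ((-1) ^ m * of_nat ((m + n) choose m) / d ^ Suc (m + n)))
        has_sum 1 / (d + (z - a) $ i - (z - a) $ j)) UNIV"
      using z by (intro has_sum_inverse_difference d) (auto simp: dist_padic_def)
    note A = this
    have B: "(\<lambda>(m, n). (z - a) $ i ^ m * (z - a) $ j ^ n * ((-1) ^ m * of_nat ((m + n) choose m) / d ^ Suc (m + n)))
        = (\<lambda>k. vmonom (z - a) k * c k) \<circ> e"
      by (auto simp: fun_eq_iff mon c_def comp)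
    have C: "d + (z - a) $ i - (z - a) $ j = z $ i - z $ j" by (simp add: d_def)
    have "((\<lambda>k. vmonom (z - a) k * c k) has_sum 1 / (z $ i - z $ j)) (range e)"
      unfolding has_sum_reindex[OF inj] using A unfolding B C .
    thus "((\<lambda>k. vmonom (z - a) k * c k) has_sum 1 / (z $ i - z $ j)) UNIV"
      by (rule has_sum_cong_neutral[THEN iffD1, rotated -1]) (auto simp: c_def)
  qed
qed

section \<open>Invariance of the line bundle\<close>

lemma Omega_mult:
  fixes x :: "'p::prime_card padic ^ 3"
  assumes "i \<noteq> j"
  shows "(\<Sum>b\<in>UNIV. Omega i j $ a $ b * x $ b)
    = (if a = i then x $ j - x $ i else if a = j then x $ i - x $ j else 0)"
  using assms exhaust_3[of i] exhaust_3[of j] exhaust_3[of a]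
  by (elim disjE) (simp_all add: Omega_def Omega12_def Omega13_def Omega23_def sum_3 doubleton_eq_iff vector_3)

lemma H_KZ_mult:
  fixes x :: "'p::prime_card padic ^ 3"
  shows "(H_KZ i z *v x) $ a = (\<Sum>j\<in>UNIV - {i}. 1 / 2 *
    (if a = i then x $ j - x $ i else if a = j then x $ i - x $ j else 0) / (z $ i - z $ j))"
proof -
  have "(H_KZ i z *v x) $ a = (\<Sum>b\<in>UNIV. \<Sum>j\<in>UNIV - {i}. 1 / 2 * (Omega i j $ a $ b * x $ b) / (z $ i - z $ j))"
    by (simp add: matrix_vector_mult_def H_KZ_def sum_distrib_right sum_distrib_left)
  also have "\<dots> = (\<Sum>j\<in>UNIV - {i}. \<Sum>b\<in>UNIV. 1 / 2 * (Omega i j $ a $ b * x $ b) / (z $ i - z $ j))"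
    by (rule sum.swap)
  also have "\<dots> = (\<Sum>j\<in>UNIV - {i}. 1 / 2 * (\<Sum>b\<in>UNIV. Omega i j $ a $ b * x $ b) / (z $ i - z $ j))"
    by (simp only: sum_distrib_left sum_divide_distrib)
  also have "\<dots> = (\<Sum>j\<in>UNIV - {i}. 1 / 2 *
    (if a = i then x $ j - x $ i else if a = j then x $ i - x $ j else 0) / (z $ i - z $ j))"
  proof (intro sum.cong refl)
    fix j assume "j \<in> UNIV - {i}"
    hence "i \<noteq> j" by auto
    show "1 / 2 * (\<Sum>b\<in>UNIV. Omega i j $ a $ b * x $ b) / (z $ i - z $ j) = 1 / 2 *
        (if a = i then x $ j - x $ i else if a = j then x $ i - x $ j else 0) / (z $ i - z $ j)"
      unfolding Omega_mult[OF \<open>i \<noteq> j\<close>] ..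
  qed
  finally show ?thesis .
qed

text \<open>
  Vectors of \<open>W_KZ\<close> are determined by their components other than the \<open>i\<close>-th, so with \<open>sum_H_KZ\<close>
  this describes the action of \<open>H_KZ i z\<close> on \<open>W_KZ\<close>.
\<close>

lemma H_KZ_off_diagonal:
  fixes x :: "'p::prime_card padic ^ 3"
  assumes "a \<noteq> i"
  shows "(H_KZ i z *v x) $ a = 1 / 2 * (x $ i - x $ a) / (z $ i - z $ a)"
proof -
  have "(H_KZ i z *v x) $ a = (\<Sum>j\<in>UNIV - {i}. if j = a then 1 / 2 * (x $ i - x $ a) / (z $ i - z $ a) else 0)"
    unfolding H_KZ_mult using assms by (intro sum.cong) auto
  thus ?thesis using assms by (simp add: sum.delta')
qed

lemma sum_H_KZ: "(\<Sum>a\<in>UNIV. (H_KZ i z *v x) $ a) = (0 :: 'p::prime_card padic)"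
proof -
  have "(\<Sum>a\<in>UNIV. (H_KZ i z *v x) $ a) = (H_KZ i z *v x) $ i + (\<Sum>a\<in>UNIV - {i}. (H_KZ i z *v x) $ a)"
    by (rule sum.remove) auto
  also have "(\<Sum>a\<in>UNIV - {i}. (H_KZ i z *v x) $ a) = (\<Sum>a\<in>UNIV - {i}. 1 / 2 * (x $ i - x $ a) / (z $ i - z $ a))"
    by (intro sum.cong refl H_KZ_off_diagonal) auto
  also have "(H_KZ i z *v x) $ i + \<dots>
      = (\<Sum>j\<in>UNIV - {i}. 1 / 2 * (x $ j - x $ i) / (z $ i - z $ j) + 1 / 2 * (x $ i - x $ j) / (z $ i - z $ j))"
    unfolding H_KZ_mult by (simp only: sum.distrib if_True simp_thms)
  also have "\<dots> = 0"
    by (intro sum.neutral ballI) (simp only: add_divide_distrib[symmetric] distrib_left[symmetric], simp)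
  finally show ?thesis .
qed

lemma open_distinct_coords: "open (distinct_coords :: ('p::prime_card padic ^ 3) set)"
proof -
  have "open {z :: 'p padic ^ 3. z $ i \<noteq> z $ j}" for i j
    by (intro open_Collect_neq) (auto simp: continuous_on_def intro!: tendsto_vec_nth tendsto_ident_at)
  hence "open ({z :: 'p padic ^ 3. z $ 1 \<noteq> z $ 2} \<inter> ({z. z $ 1 \<noteq> z $ 3} \<inter> {z. z $ 2 \<noteq> z $ 3}))"
    by (intro open_Int)
  moreover have "{z :: 'p padic ^ 3. z $ 1 \<noteq> z $ 2} \<inter> ({z. z $ 1 \<noteq> z $ 3} \<inter> {z. z $ 2 \<noteq> z $ 3}) = distinct_coords"
    by (auto simp: distinct_coords_def)
  ultimately show ?thesis by simp
qed

lemma distinct_coordsD: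
  assumes "z \<in> distinct_coords" "i \<noteq> j" shows "z $ i \<noteq> z $ j"
  using assms exhaust_3[of i] exhaust_3[of j] by (auto simp: distinct_coords_def)

lemma nabla_KZ_analytic:
  fixes s :: "'p::prime_card padic ^ 3 \<Rightarrow> 'p padic ^ 3"
  assumes s: "padic_analytic_at s z" and z: "z \<in> distinct_coords"
  shows "padic_analytic_at (nabla_KZ i s) z"
  unfolding padic_analytic_at_iff
proof
  fix a
  have s': "analytic_coord (\<lambda>w. s w $ l) z" for l using s by (simp add: padic_analytic_at_iff)
  have "analytic_coord (\<lambda>w. \<Sum>j\<in>UNIV - {i}. (1 / 2 *
      (if a = i then s w $ j - s w $ i else if a = j then s w $ i - s w $ j else 0)) * (1 / (w $ i - w $ j))) z"
  proof (intro analytic_coord_sum analytic_coord_mult[OF analytic_coord_cmult] analytic_coord_inverse_difference)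
    fix j assume "j \<in> UNIV - {i}"
    thus "z $ i \<noteq> z $ j" using distinct_coordsD[OF z] by auto
    show "analytic_coord (\<lambda>w. if a = i then s w $ j - s w $ i else if a = j then s w $ i - s w $ j else 0) z"
      by (cases "a = i"; cases "a = j") (auto intro: analytic_coord_diff analytic_coord_const s')
  qed
  hence "analytic_coord (\<lambda>w. (H_KZ i w *v s w) $ a) z"
    by (simp add: H_KZ_mult)
  thus "analytic_coord (\<lambda>w. nabla_KZ i s w $ a) z"
    unfolding nabla_KZ_def vector_minus_component vec_lambda_beta
    by (intro analytic_coord_diff analytic_coord_partial s')
qed

lemma eta_has_partial:
  fixes z :: "'p::prime_card padic ^ 3"
  assumes odd: "odd CARD('p)" and U: "open U" "U \<subseteq> domain_D" and z: "z \<in> U"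
    and ij: "i \<noteq> j" and zij: "z $ i \<noteq> z $ j"
  shows "has_partial i (\<lambda>w. eta w $ j) z
    (1 / 2 * (eta z $ i - eta z $ j) / (z $ i - z $ j) - eta z $ i * eta z $ j)"
proof -
  have "\<forall>\<^sub>F h in at 0. z + axis i h \<in> U"
    using topological_tendstoD[OF axis_tendsto_0 U(1) z] .
  then obtain r where r: "r > 0" "\<And>h. h \<noteq> 0 \<Longrightarrow> dist h 0 < r \<Longrightarrow> z + axis i h \<in> U"
    unfolding eventually_at by blast
  have "z + axis i h \<in> domain_D" if "padic_abs h < r" for h
  proof (cases "h = 0")
    case True
    hence "z + axis i h = z" by (simp add: vec_eq_iff axis_def)
    show ?thesis unfolding \<open>z + axis i h = z\<close> using z U(2) by auto
  next
    case False thus ?thesis using r(2)[of h] that U(2) by (auto simp: dist_padic_def)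
  qed
  thus ?thesis
    using z U(2) r(1)
    by (intro has_partial_taylor[of "min r 1" _ _ _ _ 1] order.trans[OF eta_taylor[OF odd _ _ _ ij zij]]) auto
qed

theorem theorem6p11:
  fixes U :: "('p::prime_card padic ^ 3) set"
    and s :: "'p padic ^ 3 \<Rightarrow> 'p padic ^ 3"
    and i :: 3
  assumes "odd CARD('p)"
    and "is_section U s"
  shows "is_section (U \<inter> distinct_coords) (nabla_KZ i s)"
proof -
  have U: "open U" "U \<subseteq> domain_D" and an: "\<And>z. z \<in> U \<Longrightarrow> padic_analytic_at s z"
    and W: "\<And>z. z \<in> U \<Longrightarrow> s z $ 1 + s z $ 2 + s z $ 3 = 0" and L: "\<And>z. z \<in> U \<Longrightarrow> s z \<in> line_L z"
    using assms(2) by (auto simp: is_section_def padic_analytic_on_def W_KZ_def)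
  \<comment> \<open>By Euler's relation this is the coefficient of \<open>s\<close> with respect to \<open>eta\<close>. The formula shows that it
    is differentiable.\<close>
  define f where "f w = -2 * (\<Sum>l\<in>UNIV. w $ l * s w $ l)" for w
  have sf: "s w $ k = f w * eta w $ k" if w: "w \<in> U" for w k
  proof -
    obtain c where c: "s w = c *s eta w"
      using L[OF w] unfolding line_L_def vec.span_singleton by blast
    have "(\<Sum>l\<in>UNIV. w $ l * s w $ l) = c * (\<Sum>l\<in>UNIV. w $ l * eta w $ l)"
      unfolding c by (simp add: sum_distrib_left mult.left_commute)
    also have "\<dots> = c * (- (1 / 2))" using euler_eta[OF assms(1)] w U(2) by auto
    finally have "f w = c" by (simp add: f_def)
    thus ?thesis by (simp add: c)
  qed
  have "nabla_KZ i s z \<in> W_KZ \<and> nabla_KZ i s z \<in> line_L z" if z: "z \<in> U" "z \<in> distinct_coords" for z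
  proof -
    have zD: "z \<in> domain_D" using z U by auto
    let ?S = "\<lambda>k. partial_deriv i (\<lambda>w. s w $ k) z"
    have S: "has_partial i (\<lambda>w. s w $ k) z (?S k)" for k
      using an[OF z(1)] by (intro analytic_coord_partial) (simp add: padic_analytic_at_iff)
    note M = has_partial_mult[OF has_partial_nth S]
    have "\<exists>D. has_partial i f z D"
      unfolding f_def sum_3
      by (rule exI, rule has_partial_cmult[OF has_partial_add[OF has_partial_add[OF M M] M]])
    then obtain D where D: "has_partial i f z D" by blast
    \<comment> \<open>Leibniz' rule for \<open>s = f *s eta\<close>: the KZ terms cancel and this factor of \<open>eta\<close> remains.\<close>
    define \<mu> where "\<mu> = D - f z * eta z $ i"
    have off: "nabla_KZ i s z $ k = \<mu> * eta z $ k" if k: "k \<noteq> i" for k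
    proof -
      let ?E = "1 / 2 * (eta z $ i - eta z $ k) / (z $ i - z $ k) - eta z $ i * eta z $ k"
      have "has_partial i (\<lambda>w. eta w $ k) z ?E"
        using k by (intro eta_has_partial[OF assms(1) U z(1)] distinct_coordsD[OF z(2)]) auto
      hence "has_partial i (\<lambda>w. f w * eta w $ k) z (D * eta z $ k + f z * ?E)"
        by (rule has_partial_mult[OF D])
      hence "has_partial i (\<lambda>w. s w $ k) z (D * eta z $ k + f z * ?E)"
        by (rule has_partial_cong[OF U(1) z(1), rotated]) (simp add: sf)
      hence S': "?S k = D * eta z $ k + f z * ?E" by (rule partial_deriv_eq)
      have "(H_KZ i z *v s z) $ k = f z * (1 / 2 * (eta z $ i - eta z $ k) / (z $ i - z $ k))"
        unfolding H_KZ_off_diagonal[OF k] sf[OF z(1)] right_diff_distrib[symmetric]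
        by (simp only: times_divide_eq_right mult.left_commute)
      thus ?thesis
        unfolding nabla_KZ_def vector_minus_component vec_lambda_beta S' \<mu>_def
        by (simp only: right_diff_distrib left_diff_distrib) (simp add: mult.assoc)
    qed
    have "has_partial i (\<lambda>w. s w $ 1 + s w $ 2 + s w $ 3) z (?S 1 + ?S 2 + ?S 3)"
      by (intro has_partial_add S)
    hence "has_partial i (\<lambda>_. 0) z (?S 1 + ?S 2 + ?S 3)"
      by (rule has_partial_cong[OF U(1) z(1), rotated]) (simp add: W)
    hence "?S 1 + ?S 2 + ?S 3 = 0"
      using partial_deriv_eq has_partial_const by metis
    hence sum0: "(\<Sum>k\<in>UNIV. nabla_KZ i s z $ k) = 0"
      using sum_H_KZ[of i z "s z"] by (simp add: nabla_KZ_def sum_subtractf sum_3)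
    have "nabla_KZ i s z $ i = - (\<Sum>k\<in>UNIV - {i}. nabla_KZ i s z $ k)"
      using sum0 by (subst (asm) sum.remove[of _ i]) (auto simp: eq_neg_iff_add_eq_0)
    also have "\<dots> = \<mu> * - (\<Sum>k\<in>UNIV - {i}. eta z $ k)"
      by (simp add: off sum_distrib_left)
    also have "- (\<Sum>k\<in>UNIV - {i}. eta z $ k) = eta z $ i"
      using sum_eta[OF assms(1) zD] by (subst (asm) sum.remove[of _ i]) (auto simp: add_eq_0_iff2)
    finally have "nabla_KZ i s z $ k = \<mu> * eta z $ k" for k
      using off by (cases "k = i") auto
    hence "nabla_KZ i s z = \<mu> *s eta z" by (simp add: vec_eq_iff)
    moreover have "nabla_KZ i s z \<in> W_KZ" using sum0 by (simp add: W_KZ_def sum_3)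
    ultimately show ?thesis unfolding line_L_def vec.span_singleton by blast
  qed
  moreover have "padic_analytic_on (U \<inter> distinct_coords) (nabla_KZ i s)"
    unfolding padic_analytic_on_def using an by (auto intro: nabla_KZ_analytic)
  ultimately show ?thesis
    using U by (auto simp: is_section_def intro: open_distinct_coords)
qed

end
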